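(* Let $t\ge3$ be an integer, and let $Z\subset\mathbb{P}^2$ be a set of $\binom{t+1}{2}$ double points. Then the sequence $$\Delta H=(\underbrace{1,2,3,\ldots,t}_{t},\underbrace{t+1,\ldots,t+1}_{t})$$ is the first difference of the Hilbert function of $Z$ if and only if $Z$ is a set of double points whose support is a star configuration.
   Context: Let $k$ be an algebraically closed field of characteristic zero, $\mathbb{P}^2=\mathbb{P}^2_k$ and $R=k[x_0,x_1,x_2]$ with the standard grading. A set of $s$ double points is a scheme $Z=2P_1+\cdots+2P_s$, with $P_1,\ldots,P_s\in\mathbb{P}^2$ distinct, defined by $I_Z=I_{P_1}^2\cap\cdots\cap I_{P_s}^2$, where $I_{P_i}$ is the homogeneous ideal of $P_i$; its support is $\{P_1,\ldots,P_s\}$. The Hilbert function of $Z$ is $H_Z(i)=\dim_k(R/I_Z)_i$ and its first difference is $\Delta H_Z(i)=H_Z(i)-H_Z(i-1)$ with $H_Z(-1)=0$. A finite sequence $(h_0,\ldots,h_\sigma)$ being the first difference of $H_Z$ means $\Delta H_Z(i)=h_i$ for $0\le i\le\sigma$ and $\Delta H_Z(i)=0$ for $i>\sigma$. A star configuration of $\binom{t+1}{2}$ points in $\mathbb{P}^2$ is the set of all pairwise intersection points $\ell_i\cap\ell_j$ ($1\le i<j\le t+1$) of $t+1$ distinct lines $\ell_1,\ldots,\ell_{t+1}$ in $\mathbb{P}^2$ no three of which meet at a point. *)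

theory Defs
  imports "HOL-Analysis.Cartesian_Space" "HOL-Library.Poly_Mapping" "HOL-Library.Numeral_Type"
    "HOL-Computational_Algebra.Polynomial"
begin

section \<open>The graded ring \<open>k[x\<^sub>0, x\<^sub>1, x\<^sub>2]\<close>\<close>

text \<open>The variables are indexed by the three-element type \<^typ>\<open>3\<close>, so a monomial is an
  exponent vector \<^typ>\<open>3 \<Rightarrow>\<^sub>0 nat\<close>; multiplication in \<open>Poly_Mapping\<close> is convolution.\<close>

type_synonym 'k poly3 = "(3 \<Rightarrow>\<^sub>0 nat) \<Rightarrow>\<^sub>0 'k"

definition scale3 :: "'k::comm_ring_1 \<Rightarrow> 'k poly3 \<Rightarrow> 'k poly3" where
  "scale3 c f = Poly_Mapping.single 0 c * f"

definition eval3 :: "'k::comm_ring_1 poly3 \<Rightarrow> 'k ^ 3 \<Rightarrow> 'k" where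
  "eval3 f v = (\<Sum>m\<in>Poly_Mapping.keys f.
      Poly_Mapping.lookup f m * (\<Prod>i\<in>UNIV. (v $ i) ^ Poly_Mapping.lookup m i))"

text \<open>The homogeneous component \<open>R\<^sub>d\<close> (it contains 0).\<close>

definition forms :: "nat \<Rightarrow> 'k::comm_ring_1 poly3 set" where
  "forms d = {f. \<forall>m\<in>Poly_Mapping.keys f. (\<Sum>i\<in>UNIV. Poly_Mapping.lookup m i) = d}"

text \<open>A commutative ring as a module over itself: its submodules are the ideals, and
  \<open>ideal.span S\<close> is the ideal generated by \<open>S\<close>.\<close>

interpretation ideal: module "(*) :: 'a::comm_ring_1 \<Rightarrow> 'a \<Rightarrow> 'a"
  by unfold_locales (simp_all add: algebra_simps)

interpretation poly3: vector_space "scale3 :: 'k::field \<Rightarrow> 'k poly3 \<Rightarrow> 'k poly3"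
proof
  fix a b :: 'k and x y :: "'k poly3"
  show "scale3 a (x + y) = scale3 a x + scale3 a y"
    unfolding scale3_def by (rule distrib_left)
  show "scale3 (a + b) x = scale3 a x + scale3 b x"
    unfolding scale3_def single_add by (rule distrib_right)
  show "scale3 a (scale3 b x) = scale3 (a * b) x"
    unfolding scale3_def mult.assoc[symmetric] mult_single by simp
  show "scale3 1 x = x"
    unfolding scale3_def by simp
qed

definition ideal_square :: "'a::comm_ring_1 set \<Rightarrow> 'a set" where
  "ideal_square I = ideal.span {f * g | f g. f \<in> I \<and> g \<in> I}"


section \<open>Dimensions of quotient spaces\<close>

text \<open>\<open>B\<close> consists of elements of \<open>V\<close> whose classes form a basis of \<open>V / U\<close>
  (in particular these classes are pairwise distinct).\<close>

definition quotient_basis :: "'k::field poly3 set \<Rightarrow> 'k poly3 set \<Rightarrow> 'k poly3 set \<Rightarrow> bool" where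
  "quotient_basis V U B \<longleftrightarrow> finite B \<and> B \<subseteq> V \<and>
     (\<forall>c. (\<Sum>b\<in>B. scale3 (c b) b) \<in> U \<longrightarrow> (\<forall>b\<in>B. c b = 0)) \<and>
     (\<forall>v\<in>V. \<exists>c. v - (\<Sum>b\<in>B. scale3 (c b) b) \<in> U)"

definition quotient_dim :: "'k::field poly3 set \<Rightarrow> 'k poly3 set \<Rightarrow> nat" where
  "quotient_dim V U = (THE n. \<exists>B. quotient_basis V U B \<and> card B = n)"

lemma quotient_basis_card:
  fixes V U B :: "'k::field poly3 set"
  assumes V: "poly3.subspace V" and U: "poly3.subspace U" "U \<subseteq> V"
    and W: "finite W" "V \<subseteq> poly3.span W"
    and B: "quotient_basis V U B"
  shows "card B + poly3.dim U = poly3.dim V"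
proof -
  obtain A where A: "A \<subseteq> U" "poly3.independent A" "U \<subseteq> poly3.span A" "card A = poly3.dim U"
    using poly3.basis_exists by blast
  have finA: "finite A"
    using poly3.independent_span_bound[OF W(1) A(2)] A(1) U(2) W(2) by blast
  have spA: "poly3.span A = U"
    using A U(1) poly3.span_minimal by blast
  have B': "finite B" "B \<subseteq> V" "\<And>c. (\<Sum>b\<in>B. scale3 (c b) b) \<in> U \<Longrightarrow> \<forall>b\<in>B. c b = 0"
    "\<And>v. v \<in> V \<Longrightarrow> \<exists>c. v - (\<Sum>b\<in>B. scale3 (c b) b) \<in> U"
    using B unfolding quotient_basis_def by blast+
  have disj: "A \<inter> B = {}"
  proof (rule ccontr)
    assume "A \<inter> B \<noteq> {}"
    then obtain a where a: "a \<in> A" "a \<in> B" by blast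
    have "(\<Sum>b\<in>B. scale3 (if b = a then 1 else 0) b) = (\<Sum>b\<in>B. if b = a then b else 0)"
      by (intro sum.cong) auto
    also have "\<dots> = a" using a B'(1) by simp
    finally have "(\<Sum>b\<in>B. scale3 (if b = a then 1 else 0) b) \<in> U" using a A(1) by auto
    from B'(3)[OF this] a show False by auto
  qed
  have indep: "poly3.independent (A \<union> B)"
  proof (rule poly3.independent_if_scalars_zero)
    show "finite (A \<union> B)" using finA B'(1) by simp
    fix f x
    assume "(\<Sum>x\<in>A \<union> B. scale3 (f x) x) = 0" and x: "x \<in> A \<union> B"
    then have s: "(\<Sum>x\<in>A. scale3 (f x) x) + (\<Sum>x\<in>B. scale3 (f x) x) = 0"
      by (simp add: sum.union_disjoint finA B'(1) disj)
    have "(\<Sum>x\<in>A. scale3 (f x) x) \<in> U"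
      using A(1) by (intro poly3.subspace_sum[OF U(1)] poly3.subspace_scale[OF U(1)]) auto
    then have "- (\<Sum>x\<in>A. scale3 (f x) x) \<in> U"
      by (rule poly3.subspace_neg[OF U(1)])
    moreover have "(\<Sum>x\<in>B. scale3 (f x) x) = - (\<Sum>x\<in>A. scale3 (f x) x)"
      using s by (simp add: eq_neg_iff_add_eq_0 add.commute)
    ultimately have "(\<Sum>x\<in>B. scale3 (f x) x) \<in> U" by simp
    from B'(3)[OF this] have fB: "\<forall>b\<in>B. f b = 0" .
    then have "(\<Sum>x\<in>A. scale3 (f x) x) = 0" using s by simp
    then have "\<forall>a\<in>A. f a = 0" using A(2) finA poly3.independent_explicit_finite_subsets by blast
    with fB x show "f x = 0" by blast
  qed
  have "V \<subseteq> poly3.span (A \<union> B)"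
  proof
    fix v assume "v \<in> V"
    then obtain c where c: "v - (\<Sum>b\<in>B. scale3 (c b) b) \<in> U" using B'(4) by blast
    then have "v - (\<Sum>b\<in>B. scale3 (c b) b) \<in> poly3.span (A \<union> B)"
      using spA poly3.span_mono[of A "A \<union> B"] by blast
    moreover have "(\<Sum>b\<in>B. scale3 (c b) b) \<in> poly3.span (A \<union> B)"
      by (intro poly3.span_sum poly3.span_scale poly3.span_base) auto
    ultimately have "v - (\<Sum>b\<in>B. scale3 (c b) b) + (\<Sum>b\<in>B. scale3 (c b) b) \<in> poly3.span (A \<union> B)"
      by (rule poly3.span_add)
    then show "v \<in> poly3.span (A \<union> B)" by simp
  qed
  then have "card (A \<union> B) = poly3.dim V"
    using poly3.basis_card_eq_dim[OF _ _ indep] A(1) U(2) B'(2) by blast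
  then show ?thesis
    using A(4) by (simp add: card_Un_disjoint finA B'(1) disj)
qed

lemma quotient_basis_exists:
  fixes V U :: "'k::field poly3 set"
  assumes V: "poly3.subspace V" and U: "poly3.subspace U" "U \<subseteq> V"
    and W: "finite W" "V \<subseteq> poly3.span W"
  shows "\<exists>B. quotient_basis V U B"
proof -
  obtain A where A: "A \<subseteq> U" "poly3.independent A" "U \<subseteq> poly3.span A"
    by (rule poly3.basis_exists)
  have "A \<subseteq> V" using A(1) U(2) by blast
  then obtain C where C: "A \<subseteq> C" "C \<subseteq> V" "poly3.independent C" "V \<subseteq> poly3.span C"
    by (rule poly3.maximal_independent_subset_extend[OF _ A(2)])
  have finC: "finite C"
    using poly3.independent_span_bound[OF W(1) C(3)] C(2) W(2) by blast
  have finA: "finite A" using finC C(1) finite_subset by blast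
  have spA: "poly3.span A = U"
    using A U(1) poly3.span_minimal by blast
  have sumC: "(\<Sum>x\<in>C. scale3 (f x) x) = (\<Sum>x\<in>A. scale3 (f x) x) + (\<Sum>x\<in>C - A. scale3 (f x) x)" for f
    using sum.subset_diff[OF C(1) finC, of "\<lambda>x. scale3 (f x) x"] by (simp add: add.commute)
  have "quotient_basis V U (C - A)"
    unfolding quotient_basis_def
  proof (intro conjI allI impI ballI)
    show "finite (C - A)" using finC by simp
    show "C - A \<subseteq> V" using C(2) by blast
  next
    fix c b assume c: "(\<Sum>b\<in>C - A. scale3 (c b) b) \<in> U" and b: "b \<in> C - A"
    then obtain d where d: "(\<Sum>b\<in>C - A. scale3 (c b) b) = (\<Sum>a\<in>A. scale3 (d a) a)"
      using spA poly3.span_finite[OF finA] by auto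
    define f where "f x = (if x \<in> A then - d x else c x)" for x
    have "(\<Sum>x\<in>C. scale3 (f x) x) = 0"
      unfolding sumC using d by (simp add: f_def sum_negf)
    then have "f b = 0"
      using C(3) finC b poly3.independent_explicit_finite_subsets by blast
    then show "c b = 0" using b by (simp add: f_def)
  next
    fix v assume "v \<in> V"
    then obtain f where f: "v = (\<Sum>x\<in>C. scale3 (f x) x)"
      using C(4) poly3.span_finite[OF finC] by auto
    have "v - (\<Sum>b\<in>C - A. scale3 (f b) b) = (\<Sum>x\<in>A. scale3 (f x) x)"
      unfolding f sumC by simp
    also have "\<dots> \<in> U"
      using A(1) by (intro poly3.subspace_sum[OF U(1)] poly3.subspace_scale[OF U(1)]) auto
    finally show "\<exists>c. v - (\<Sum>b\<in>C - A. scale3 (c b) b) \<in> U" by blast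
  qed
  then show ?thesis by blast
qed

text \<open>The definite description in \<^const>\<open>quotient_dim\<close> is meaningful for
  finite-dimensional \<open>V\<close>, and has the expected value.\<close>

lemma quotient_dim_eq:
  fixes V U :: "'k::field poly3 set"
  assumes "poly3.subspace V" "poly3.subspace U" "U \<subseteq> V" "finite W" "V \<subseteq> poly3.span W"
  shows "quotient_dim V U = poly3.dim V - poly3.dim U"
  unfolding quotient_dim_def
proof (rule the_equality)
  show "\<exists>B. quotient_basis V U B \<and> card B = poly3.dim V - poly3.dim U"
    using quotient_basis_exists[OF assms] quotient_basis_card[OF assms] by (metis add_diff_cancel_right')
  show "n = poly3.dim V - poly3.dim U" if "\<exists>B. quotient_basis V U B \<and> card B = n" for n
    using that quotient_basis_card[OF assms] by fastforce
qed


section \<open>The projective plane\<close>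

text \<open>Points are the one-dimensional subspaces of \<open>k\<^sup>3\<close>.\<close>

definition proj_plane :: "('k::field ^ 3) set set" where
  "proj_plane = {P. vec.subspace P \<and> vec.dim P = 1}"

definition vanishes_at :: "'k::field poly3 \<Rightarrow> ('k ^ 3) set \<Rightarrow> bool" where
  "vanishes_at f P \<longleftrightarrow> (\<forall>v\<in>P. eval3 f v = 0)"

definition proj_lines :: "('k::field ^ 3) set set set" where
  "proj_lines = {{P \<in> proj_plane. vanishes_at f P} | f. f \<in> forms 1 \<and> f \<noteq> 0}"

definition point_ideal :: "('k::field ^ 3) set \<Rightarrow> 'k poly3 set" where
  "point_ideal P = ideal.span {f. (\<exists>d. f \<in> forms d) \<and> vanishes_at f P}"


section \<open>Double points, Hilbert functions and star configurations\<close>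

text \<open>A set of double points is determined by its support \<open>X\<close>.\<close>

definition double_points_ideal :: "('k::field ^ 3) set set \<Rightarrow> 'k poly3 set" where
  "double_points_ideal X = (\<Inter>P\<in>X. ideal_square (point_ideal P))"

text \<open>\<open>H(i) = dim (R / I)\<^sub>i\<close>, where \<open>(R / I)\<^sub>i = R\<^sub>i / (I \<inter> R\<^sub>i)\<close> for a homogeneous ideal \<open>I\<close>.\<close>

definition hilbert_function :: "'k::field poly3 set \<Rightarrow> nat \<Rightarrow> nat" where
  "hilbert_function I i = quotient_dim (forms i) (I \<inter> forms i)"

definition hilbert_diff :: "'k::field poly3 set \<Rightarrow> nat \<Rightarrow> int" where
  "hilbert_diff I i =
     int (hilbert_function I i) - (if i = 0 then 0 else int (hilbert_function I (i - 1)))"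

definition has_hilbert_diff :: "'k::field poly3 set \<Rightarrow> nat list \<Rightarrow> bool" where
  "has_hilbert_diff I h \<longleftrightarrow>
     (\<forall>i. hilbert_diff I i = (if i < length h then int (h ! i) else 0))"

text \<open>The pairwise intersections of \<open>t + 1\<close> distinct lines, no three of them concurrent.\<close>

definition star_configuration :: "nat \<Rightarrow> ('k::field ^ 3) set set \<Rightarrow> bool" where
  "star_configuration t X \<longleftrightarrow>
     (\<exists>L \<subseteq> proj_lines. finite L \<and> card L = t + 1 \<and>
        (\<forall>l\<in>L. \<forall>m\<in>L. \<forall>n\<in>L. l \<noteq> m \<longrightarrow> l \<noteq> n \<longrightarrow> m \<noteq> n \<longrightarrow> l \<inter> m \<inter> n = {}) \<and>
        X = \<Union>{l \<inter> m | l m. l \<in> L \<and> m \<in> L \<and> l \<noteq> m})"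

end

theory Submission
  imports Defs
begin

text \<open>Write \<open>N = (t + 1) choose 2\<close> for the number of points. The sequence says that \<open>Z\<close> imposes
  \<open>3 N\<close> independent conditions on forms of degree \<open>2 t - 1\<close>, and that in all degrees below
  \<open>2 t\<close> the ideal of \<open>Z\<close> consists of the multiples of one form \<open>F\<close> of degree \<open>t + 1\<close>.

  For a star configuration, \<open>F\<close> is the product of the lines: a form of degree less than \<open>2 t\<close>
  which is singular at the \<open>t\<close> points on one of the lines has too many zeros there, so all the
  lines divide it (\<open>singular_divisible_by_line\<close>). In degree \<open>2 t - 1\<close> this is the
  independence of the conditions, which then persists in higher degrees
  (\<open>star_dimensions\<close>).

  For the converse, \<open>F\<close> has to be broken into lines. Everything rests on the remark that a
  product of two forms vanishing on the support \<open>X\<close> is singular along \<open>X\<close>, hence a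
  multiple of \<open>F\<close> when its degree is less than \<open>2 t\<close>.

  \<^item> No nonzero form of degree less than \<open>t\<close> vanishes on \<open>X\<close> (\<open>vanishing_low\<close>). For
    such a form \<open>g\<close> of least degree, \<open>g\<^sup>2 = F A\<close>, and the form \<open>g A\<^sub>v / A\<close>, of smaller
    degree, again vanishes on \<open>X\<close>. So \<open>A\<close> is constant and \<open>F\<close> is a square, which
    contradicts the count of conditions.

  \<^item> Let \<open>L\<close> be a line that misses \<open>X\<close>. Restriction to \<open>L\<close> now identifies the forms of degree
    \<open>t\<close> vanishing on \<open>X\<close> with all binary forms of degree \<open>t\<close>, and a product of two such
    forms is divisible by \<open>F\<close> as soon as this holds on \<open>L\<close>
    (\<open>divisible_if_restriction_divisible\<close>). The argument with \<open>g\<^sup>2 = F A\<close>, repeated for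
    directions along \<open>L\<close>, shows that \<open>F\<close> has \<open>t + 1\<close> distinct zeros on \<open>L\<close>
    (\<open>restriction_squarefree\<close>).

  \<^item> For each zero \<open>\<phi>\<close> let \<open>g\<^sub>\<phi>\<close> be the form of degree \<open>t\<close> that vanishes on \<open>X\<close> and at
    the other zeros. It should be \<open>F\<close> divided by the line through \<open>\<phi>\<close>. Let \<open>X\<^sub>\<phi>\<close> be the set of
    points of \<open>X\<close> at which \<open>g\<^sub>\<phi>\<close> is smooth; they should be the points on that line. Since
    \<open>g\<^sub>\<phi> g\<^sub>\<psi>\<close> is a multiple of \<open>F\<close>, no point lies in three of these sets
    (\<open>no_three_components\<close>). A form of degree less than \<open>t\<close> vanishing on \<open>X\<^sub>\<phi>\<close> also vanishes
    at \<open>\<phi>\<close>, because its product with \<open>g\<^sub>\<phi>\<close> is a multiple of \<open>F\<close>. Counting such forms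
    degree by degree gives \<open>|X\<^sub>\<phi>| \<ge> t\<close>, and a linear form vanishing on \<open>X\<^sub>\<phi>\<close> in case of
    equality (\<open>line_through_component\<close>). As \<open>2 N = t (t + 1)\<close>, double counting
    forces equality everywhere (\<open>double_count\<close>).

  So there are \<open>t + 1\<close> distinct lines, and each of the \<open>N\<close> points lies on two of them. There are
  just \<open>N\<close> pairs of lines, so the configuration is a star.\<close>

section \<open>Polynomials in three variables\<close>

text \<open>This rule rewrites \<open>a * (b * x)\<close> to \<open>a * b * x\<close>, and so loops with associativity.\<close>

declare ideal.scale_scale [simp del]

abbreviation Const :: "'k::comm_ring_1 \<Rightarrow> 'k poly3" where
  "Const c \<equiv> Poly_Mapping.single 0 c"

definition Var :: "3 \<Rightarrow> 'k::comm_ring_1 poly3" where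
  "Var i = Poly_Mapping.single (Poly_Mapping.single i 1) 1"

lemma Const_simps [simp]:
  "Const (a + b) = Const a + Const b"
  "Const (a - b) = Const a - Const b"
  "Const (a * b) = Const a * Const b"
  "Const (- a) = - Const a"
  for a b :: "'k::comm_ring_1"
  by (simp_all add: single_add single_diff single_uminus mult_single)

lemma scale3_Const: "scale3 c f = Const c * f"
  by (simp add: scale3_def)

lemma single_degree_SucE:
  fixes m :: "3 \<Rightarrow>\<^sub>0 nat"
  assumes "(\<Sum>i\<in>UNIV. Poly_Mapping.lookup m i) = Suc d"
  obtains i m' where "m = Poly_Mapping.single i 1 + m'" "(\<Sum>i\<in>UNIV. Poly_Mapping.lookup m' i) = d"
proof -
  have "\<exists>i. Poly_Mapping.lookup m i \<noteq> 0"
  proof (rule ccontr)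
    assume "\<not> ?thesis"
    then have "(\<Sum>i\<in>UNIV. Poly_Mapping.lookup m i) = 0" by simp
    then show False using assms by simp
  qed
  then obtain i where i: "Poly_Mapping.lookup m i \<noteq> 0" ..
  define m' where "m' = m - Poly_Mapping.single i 1"
  have m: "m = Poly_Mapping.single i 1 + m'"
    by (rule poly_mapping_eqI) (use i in \<open>auto simp: m'_def lookup_add lookup_minus lookup_single when_def\<close>)
  have "(\<Sum>j\<in>UNIV. Poly_Mapping.lookup m j) = 1 + (\<Sum>j\<in>UNIV. Poly_Mapping.lookup m' j)"
    unfolding m by (simp add: lookup_add lookup_single when_def sum.distrib)
  then show thesis using that[OF m] assms by simp
qed

lemma poly_mapping_eq_sum_singles:
  "f = (\<Sum>m\<in>Poly_Mapping.keys f. Poly_Mapping.single m (Poly_Mapping.lookup f m))"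
  by (rule poly_mapping_eqI) (simp add: lookup_sum lookup_single when_def in_keys_iff)

lemma single_Suc_eq:
  "Poly_Mapping.single (Poly_Mapping.single i 1 + m) c = Var i * Poly_Mapping.single m (c::'k::comm_ring_1)"
  by (simp add: Var_def mult_single)

text \<open>Every monomial arises from a constant by multiplications with variables. Identities between
  operations on polynomials are checked with this rule, without looking at exponents.\<close>

lemma poly3_induct [case_names Const add Var]:
  fixes f :: "'k::comm_ring_1 poly3"
  assumes C: "\<And>c. P (Const c)" and A: "\<And>f g. P f \<Longrightarrow> P g \<Longrightarrow> P (f + g)"
    and V: "\<And>i f. P f \<Longrightarrow> P (Var i * f)"
  shows "P f"
proof -
  have S: "P (Poly_Mapping.single m c)" if "(\<Sum>i\<in>UNIV. Poly_Mapping.lookup m i) = d" for m c d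
    using that
  proof (induction d arbitrary: m)
    case 0
    then have "m = 0" by (intro poly_mapping_eqI) simp
    then show ?case by (simp add: C)
  next
    case (Suc d)
    then show ?case by (metis single_degree_SucE single_Suc_eq V)
  qed
  have Z: "P 0" using C[of 0] by simp
  have "P (\<Sum>m\<in>M. Poly_Mapping.single m (Poly_Mapping.lookup f m))" if "finite M" for M
    using that by (induction M) (auto intro: A S Z)
  from this[of "Poly_Mapping.keys f"] show ?thesis
    using poly_mapping_eq_sum_singles[of f] by simp
qed

subsection \<open>Forms\<close>

lemma forms_0 [simp, intro]: "0 \<in> forms d"
  by (simp add: forms_def)

lemma forms_add [intro]: "f \<in> forms d \<Longrightarrow> g \<in> forms d \<Longrightarrow> f + g \<in> forms d"
  unfolding forms_def using keys_add[of f g] by blast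

lemma forms_sum [intro]: "(\<And>i. i \<in> I \<Longrightarrow> f i \<in> forms d) \<Longrightarrow> sum f I \<in> forms d"
  by (induction I rule: infinite_finite_induct) auto

lemma forms_mult: "f \<in> forms d \<Longrightarrow> g \<in> forms e \<Longrightarrow> f * g \<in> forms (d + e)"
proof -
  assume *: "f \<in> forms d" "g \<in> forms e"
  show ?thesis unfolding forms_def
  proof clarify
    fix m assume "m \<in> Poly_Mapping.keys (f * g)"
    then obtain a b where "m = a + b" "a \<in> Poly_Mapping.keys f" "b \<in> Poly_Mapping.keys g"
      using keys_mult[of f g] by blast
    then show "(\<Sum>i\<in>UNIV. Poly_Mapping.lookup m i) = d + e"
      using * by (simp add: forms_def lookup_add sum.distrib)
  qed
qed

lemma forms_Const [simp, intro]: "Const c \<in> forms 0"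
  by (simp add: forms_def)

lemma forms_Var [simp, intro]: "Var i \<in> forms 1"
  by (simp add: forms_def Var_def lookup_single when_def)

lemma forms_Var_Suc_0 [simp]: "Var i \<in> forms (Suc 0)"
  using forms_Var by simp

lemma forms_Const_mult [intro]: "f \<in> forms d \<Longrightarrow> Const c * f \<in> forms d"
  using forms_mult[OF forms_Const, of f d c] by simp

lemma forms_Var_mult [intro]: "f \<in> forms d \<Longrightarrow> Var i * f \<in> forms (Suc d)"
  using forms_mult[OF forms_Var, of f d i] by simp

lemma forms_uminus [intro]: "f \<in> forms d \<Longrightarrow> - f \<in> forms d"
  using forms_Const_mult[of f d "-1"] by simp

lemma forms_diff [intro]: "f \<in> forms d \<Longrightarrow> g \<in> forms d \<Longrightarrow> f - g \<in> forms d"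
  using forms_add[OF _ forms_uminus, of f d g] by simp

lemma forms_0E:
  assumes "f \<in> forms 0" obtains c where "f = Const c"
proof -
  have "Poly_Mapping.keys f \<subseteq> {0}"
  proof
    fix m assume "m \<in> Poly_Mapping.keys f"
    then have "(\<Sum>i\<in>UNIV. Poly_Mapping.lookup m i) = 0" using assms by (auto simp: forms_def)
    then have "m = 0" by (intro poly_mapping_eqI) simp
    then show "m \<in> {0}" by simp
  qed
  then have "f = Const (Poly_Mapping.lookup f 0)"
    by (intro poly_mapping_eqI) (auto simp: lookup_single when_def in_keys_iff)
  then show thesis by (rule that)
qed

lemma forms_induct [consumes 1, case_names Const add Var]:
  fixes f :: "'k::comm_ring_1 poly3"
  assumes f: "f \<in> forms d"
    and C: "\<And>c. P 0 (Const c)"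
    and A: "\<And>d f g. f \<in> forms d \<Longrightarrow> g \<in> forms d \<Longrightarrow> P d f \<Longrightarrow> P d g \<Longrightarrow> P d (f + g)"
    and V: "\<And>d i f. f \<in> forms d \<Longrightarrow> P d f \<Longrightarrow> P (Suc d) (Var i * f)"
  shows "P d f"
proof -
  have S: "Poly_Mapping.single m c \<in> forms d \<and> P d (Poly_Mapping.single m c)"
    if "(\<Sum>i\<in>UNIV. Poly_Mapping.lookup m i) = d" for m c d
    using that
  proof (induction d arbitrary: m)
    case 0
    then have "m = 0" by (intro poly_mapping_eqI) simp
    then show ?case by (simp add: C)
  next
    case (Suc d)
    then show ?case by (metis single_degree_SucE single_Suc_eq V forms_Var_mult)
  qed
  have Z: "P d 0"
  proof (induction d)
    case 0 then show ?case using C[of 0] by simp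
  next
    case (Suc d) then show ?case using V[of 0 d 1] by simp
  qed
  have "(\<Sum>m\<in>M. Poly_Mapping.single m (Poly_Mapping.lookup f m)) \<in> forms d \<and>
     P d (\<Sum>m\<in>M. Poly_Mapping.single m (Poly_Mapping.lookup f m))"
    if "finite M" "M \<subseteq> Poly_Mapping.keys f" for M
    using that
  proof (induction M)
    case empty then show ?case using Z by simp
  next
    case (insert m M)
    have "(\<Sum>i\<in>UNIV. Poly_Mapping.lookup m i) = d" using insert.prems f by (auto simp: forms_def)
    from S[OF this] insert show ?case by (auto intro: A)
  qed
  from this[of "Poly_Mapping.keys f"] show ?thesis
    using poly_mapping_eq_sum_singles[of f] by simp
qed

subsection \<open>Substitution\<close>

text \<open>Evaluation at a point with coordinates in an algebra over the coefficients. Values in the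
  coefficient ring give \<open>eval3\<close>; linear polynomials in one variable \<open>s\<close> give the
  restriction to a line; values \<open>x\<^sub>j + w\<^sub>j s\<close> give the Taylor expansion in the direction \<open>w\<close>.\<close>

definition subst3 :: "('k::comm_ring_1 \<Rightarrow> 'a::comm_ring_1) \<Rightarrow> (3 \<Rightarrow> 'a) \<Rightarrow> 'k poly3 \<Rightarrow> 'a" where
  "subst3 c x f = (\<Sum>m\<in>Poly_Mapping.keys f. c (Poly_Mapping.lookup f m) * (\<Prod>i\<in>UNIV. x i ^ Poly_Mapping.lookup m i))"

locale coeff_hom =
  fixes c :: "'k::comm_ring_1 \<Rightarrow> 'a::comm_ring_1"
  assumes c_add: "c (a + b) = c a + c b" and c_mult: "c (a * b) = c a * c b" and c_1: "c 1 = 1"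
begin

lemma c_0: "c 0 = 0"
  using c_add[of 0 0] by simp

lemma subst3_superset:
  "finite S \<Longrightarrow> Poly_Mapping.keys f \<subseteq> S \<Longrightarrow>
    subst3 c x f = (\<Sum>m\<in>S. c (Poly_Mapping.lookup f m) * (\<Prod>i\<in>UNIV. x i ^ Poly_Mapping.lookup m i))"
  unfolding subst3_def by (intro sum.mono_neutral_left) (auto simp: in_keys_iff c_0)

lemma subst3_add: "subst3 c x (f + g) = subst3 c x f + subst3 c x g"
proof -
  let ?S = "Poly_Mapping.keys f \<union> Poly_Mapping.keys g"
  have "subst3 c x h = (\<Sum>m\<in>?S. c (Poly_Mapping.lookup h m) * (\<Prod>i\<in>UNIV. x i ^ Poly_Mapping.lookup m i))"
    if "h \<in> {f, g, f + g}" for h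
    by (rule subst3_superset) (use that keys_add[of f g] in auto)
  then show ?thesis by (simp add: lookup_add c_add algebra_simps sum.distrib)
qed

lemma subst3_single: "subst3 c x (Poly_Mapping.single m a) = c a * (\<Prod>i\<in>UNIV. x i ^ Poly_Mapping.lookup m i)"
  by (subst subst3_superset[of "{m}"]) (auto split: if_splits)

lemma subst3_Const: "subst3 c x (Const a) = c a"
  by (simp add: subst3_single)

lemma subst3_Var_mult: "subst3 c x (Var i * f) = x i * subst3 c x f"
proof -
  have "subst3 c x (Var i * Poly_Mapping.single m a) = x i * subst3 c x (Poly_Mapping.single m a)" for m a
  proof -
    have "(\<Prod>j\<in>UNIV. x j ^ (Poly_Mapping.lookup (Poly_Mapping.single i 1) j)) = (\<Prod>j\<in>UNIV. if j = i then x j else 1)"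
      by (intro prod.cong) (auto simp: lookup_single when_def)
    also have "\<dots> = x i" by simp
    finally have e: "(\<Prod>j\<in>UNIV. x j ^ (Poly_Mapping.lookup (Poly_Mapping.single i 1) j)) = x i" .
    show ?thesis
      unfolding single_Suc_eq[symmetric] subst3_single lookup_add power_add prod.distrib e
      by (rule mult.left_commute)
  qed
  note S = this
  have "subst3 c x (Var i * (\<Sum>m\<in>M. Poly_Mapping.single m (Poly_Mapping.lookup f m))) =
      x i * subst3 c x (\<Sum>m\<in>M. Poly_Mapping.single m (Poly_Mapping.lookup f m))" if "finite M" for M
    using that by (induction M) (simp_all add: subst3_add distrib_left S, simp add: subst3_def)
  from this[of "Poly_Mapping.keys f"] show ?thesis
    using poly_mapping_eq_sum_singles[of f] by simp
qed

lemma subst3_Var: "subst3 c x (Var i) = x i"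
  using subst3_Var_mult[of x i 1] by (metis mult.right_neutral subst3_Const c_1 single_one)

lemma subst3_mult: "subst3 c x (f * g) = subst3 c x f * subst3 c x g"
proof (induction f rule: poly3_induct)
  case (Const a)
  show ?case
  proof (induction g rule: poly3_induct)
    case (Const b)
    show ?case by (simp only: subst3_Const c_mult Const_simps(3)[symmetric])
  next
    case (add f g)
    then show ?case by (simp add: subst3_add distrib_left)
  next
    case (Var i f)
    have e: "Const a * (Var i * f) = Var i * (Const a * f)" by (rule mult.left_commute)
    show ?case unfolding e subst3_Var_mult Var by (rule mult.left_commute)
  qed
next
  case (add f h)
  then show ?case by (simp add: subst3_add distrib_right)
next
  case (Var i f)
  show ?case by (simp only: mult.assoc subst3_Var_mult Var)
qed

lemma subst3_minus: "subst3 c x (f - g) = subst3 c x f - subst3 c x g"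
  using subst3_add[of x "f - g" g] by simp

lemma subst3_uminus: "subst3 c x (- f) = - subst3 c x f"
  using subst3_minus[of x 0 f] by (simp add: subst3_def)

lemma subst3_0: "subst3 c x 0 = 0"
  by (simp add: subst3_def)

lemma subst3_1: "subst3 c x 1 = 1"
  using subst3_Const[of x 1] c_1 by simp

lemma subst3_sum: "subst3 c x (sum f I) = (\<Sum>i\<in>I. subst3 c x (f i))"
  by (induction I rule: infinite_finite_induct) (simp_all add: subst3_0 subst3_add)

lemma subst3_prod: "subst3 c x (prod f I) = (\<Prod>i\<in>I. subst3 c x (f i))"
  by (induction I rule: infinite_finite_induct) (simp_all add: subst3_1 subst3_mult)

lemmas subst3_simps = subst3_0 subst3_1 subst3_add subst3_minus subst3_uminus subst3_mult subst3_Const subst3_Var subst3_sum subst3_prod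

end

lemma eval3_subst3: "eval3 f v = subst3 (\<lambda>c. c) (($) v) f"
  by (simp add: eval3_def subst3_def)

interpretation id_hom: coeff_hom "\<lambda>c::'k::comm_ring_1. c"
  by unfold_locales auto

interpretation pconst_hom: coeff_hom "\<lambda>c::'k::comm_ring_1. [:c:]"
  by unfold_locales (auto simp: one_pCons)

interpretation pConst_hom: coeff_hom "\<lambda>c::'k::comm_ring_1. [:Const c:]"
  by unfold_locales (auto simp: one_pCons)

lemma eval3_simps [simp]:
  fixes f g :: "'k::comm_ring_1 poly3"
  shows "eval3 0 v = (0::'k)" "eval3 1 v = (1::'k)" "eval3 (f + g) v = eval3 f v + eval3 g v"
  "eval3 (f - g) v = eval3 f v - eval3 g v" "eval3 (- f) v = - eval3 f v"
  "eval3 (f * g) v = eval3 f v * eval3 g v"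
  "eval3 (Const c) v = (c::'k)" "eval3 (Var i) v = (v $ i::'k)" "eval3 (sum h I) v = (\<Sum>i\<in>I. eval3 (h i) v)"
  "eval3 (prod h I) v = (\<Prod>i\<in>I. eval3 (h i) v)"
  by (simp_all add: eval3_subst3 id_hom.subst3_simps)

subsection \<open>Restriction to a parametrised line\<close>

text \<open>The restriction to the line through the points \<open>v\<close> and \<open>w\<close>, in an affine coordinate for
  which \<open>w\<close> is the point at infinity. A form of degree \<open>d\<close> has its value at \<open>w\<close> as
  coefficient of degree \<open>d\<close>, so the degree drops exactly if the form vanishes there.\<close>

definition line_poly :: "'k::comm_ring_1 poly3 \<Rightarrow> 'k ^ 3 \<Rightarrow> 'k ^ 3 \<Rightarrow> 'k poly" where
  "line_poly f v w = subst3 (\<lambda>c. [:c:]) (\<lambda>j. [:v $ j, w $ j:]) f"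

lemma line_poly_simps [simp]:
  fixes f g :: "'k::comm_ring_1 poly3"
  shows "line_poly 0 v w = (0::'k poly)" "line_poly 1 v w = (1::'k poly)" "line_poly (f + g) v w = line_poly f v w + line_poly g v w"
  "line_poly (f - g) v w = line_poly f v w - line_poly g v w" "line_poly (- f) v w = - line_poly f v w"
  "line_poly (f * g) v w = line_poly f v w * line_poly g v w"
  "line_poly (Const c) v w = [:c::'k:]" "line_poly (Var i) v w = [:v $ i, w $ i:]" "line_poly (sum h I) v w = (\<Sum>i\<in>I. line_poly (h i) v w)"
  "line_poly (prod h I) v w = (\<Prod>i\<in>I. line_poly (h i) v w)"
  by (simp_all add: line_poly_def pconst_hom.subst3_simps)

lemma poly_line_poly: "poly (line_poly f v w) s = eval3 f (v + s *s w)"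
proof (induction f rule: poly3_induct)
  case (Var i f)
  then show ?case by (simp add: algebra_simps)
qed simp_all

lemma degree_line_poly: "f \<in> forms d \<Longrightarrow> degree (line_poly f v w) \<le> d"
proof (induction rule: forms_induct)
  case (add d f g)
  then show ?case by (simp add: degree_add_le)
next
  case (Var d i f)
  have "degree (line_poly (Var i * f) v w) \<le> degree [:v $ i, w $ i:] + degree (line_poly f v w)"
    unfolding line_poly_simps by (rule degree_mult_le)
  also have "\<dots> \<le> 1 + d" using Var by (intro add_mono) auto
  finally show ?case by simp
qed simp_all

lemma coeff_line_poly_top: "f \<in> forms d \<Longrightarrow> coeff (line_poly f v w) d = eval3 f w"
proof (induction rule: forms_induct)
  case (Var d i f)
  have "coeff (line_poly f v w) (Suc d) = 0"
    using degree_line_poly[OF Var(1)] by (simp add: coeff_eq_0 le_imp_less_Suc)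
  then show ?case using Var by simp
qed simp_all

lemma eval3_homogeneous: "f \<in> forms d \<Longrightarrow> eval3 f (s *s v) = s ^ d * eval3 f v"
  by (induction rule: forms_induct) (simp_all add: algebra_simps)

subsection \<open>Directional derivatives\<close>

text \<open>The derivative is the linear coefficient of \<open>f (x + s w)\<close> in \<open>s\<close>. The product rule is then the
  formula for the linear coefficient of a product.\<close>

definition dir_deriv :: "'k::comm_ring_1 ^ 3 \<Rightarrow> 'k poly3 \<Rightarrow> 'k poly3" where
  "dir_deriv w f = coeff (subst3 (\<lambda>c. [:Const c:]) (\<lambda>j. [:Var j, Const (w $ j):]) f) 1"

lemma dir_deriv_aux: "coeff (subst3 (\<lambda>c. [:Const c:]) (\<lambda>j. [:Var j, Const (w $ j):]) f) 0 = f"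
  by (induction f rule: poly3_induct)
    (simp_all add: pConst_hom.subst3_Const pConst_hom.subst3_add pConst_hom.subst3_Var_mult)

lemma dir_deriv_simps [simp]:
  fixes f g :: "'k::comm_ring_1 poly3"
  shows "dir_deriv w (0::'k poly3) = 0" "dir_deriv w (1::'k poly3) = 0" "dir_deriv w (f + g) = dir_deriv w f + dir_deriv w g"
  "dir_deriv w (f - g) = dir_deriv w f - dir_deriv w g" "dir_deriv w (- f) = - dir_deriv w f"
  "dir_deriv w (Const c) = 0" "dir_deriv w (Var i) = Const (w $ i)" "dir_deriv w (sum h I) = (\<Sum>i\<in>I. dir_deriv w (h i))"
  by (simp_all add: dir_deriv_def pConst_hom.subst3_simps coeff_sum)

lemma dir_deriv_mult [simp]: "dir_deriv w (f * g) = dir_deriv w f * g + f * dir_deriv w g"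
  using dir_deriv_aux[of w f] dir_deriv_aux[of w g]
  by (simp add: dir_deriv_def pConst_hom.subst3_simps coeff_mult)

lemma dir_deriv_add_dir: "dir_deriv (v + w) f = dir_deriv v f + dir_deriv w f"
  by (induction f rule: poly3_induct) (simp_all add: algebra_simps)

lemma dir_deriv_scale_dir: "dir_deriv (a *s w) f = Const a * dir_deriv w f"
  by (induction f rule: poly3_induct) (simp_all add: algebra_simps)

lemma dir_deriv_forms: "f \<in> forms d \<Longrightarrow> dir_deriv w f \<in> forms (d - 1)"
proof -
  assume "f \<in> forms d"
  then have "dir_deriv w f \<in> forms (d - 1) \<and> (d = 0 \<longrightarrow> dir_deriv w f = 0)"
  proof (induction rule: forms_induct)
    case (Var d i f)
    show ?case
    proof (cases d)
      case 0
      then show ?thesis using Var by auto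
    next
      case (Suc e)
      then have "Var i * dir_deriv w f \<in> forms d" using Var forms_Var_mult by fastforce
      then show ?thesis using Var by auto
    qed
  qed auto
  then show ?thesis ..
qed

lemma pderiv_line_poly: "pderiv (line_poly f v w) = line_poly (dir_deriv w f) v w"
  by (induction f rule: poly3_induct) (simp_all add: pderiv_add pderiv_mult pderiv_pCons pderiv_smult algebra_simps)

lemma eval3_euler: "f \<in> forms d \<Longrightarrow> eval3 (dir_deriv v f) v = of_nat d * eval3 f v"
  by (induction rule: forms_induct) (simp_all add: algebra_simps)

lemma dir_deriv_eq_sum: "dir_deriv w f = (\<Sum>i\<in>UNIV. Const (w $ i) * dir_deriv (axis i 1) f)"
proof (induction f rule: poly3_induct)
  case (Var i f)
  have "(\<Sum>j\<in>UNIV. Const (w $ j) * (Const (axis j 1 $ i) * f)) = (\<Sum>j\<in>UNIV. if j = i then Const (w $ i) * f else 0)"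
    by (intro sum.cong) (auto simp: axis_def)
  then show ?case using Var by (simp add: algebra_simps sum.distrib sum_distrib_left)
qed (simp_all add: algebra_simps sum.distrib)

section \<open>Dimension counts with linear functionals\<close>

text \<open>All polynomials together are infinite-dimensional, so a finite spanning set is carried along with
  each subspace.\<close>

definition fin_dim :: "'k::field poly3 set \<Rightarrow> bool" where
  "fin_dim V \<longleftrightarrow> poly3.subspace V \<and> (\<exists>W. finite W \<and> V \<subseteq> poly3.span W)"

definition functional :: "('k::field poly3 \<Rightarrow> 'k) \<Rightarrow> bool" where
  "functional \<phi> \<longleftrightarrow> (\<forall>f g. \<phi> (f + g) = \<phi> f + \<phi> g) \<and> (\<forall>c f. \<phi> (Const c * f) = c * \<phi> f)"

lemma fin_dim_subspace: "fin_dim V \<Longrightarrow> poly3.subspace V"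
  by (simp add: fin_dim_def)

lemma fin_dim_subset: "fin_dim V \<Longrightarrow> poly3.subspace U \<Longrightarrow> U \<subseteq> V \<Longrightarrow> fin_dim U"
  unfolding fin_dim_def by blast

lemma fin_dim_basis:
  assumes "fin_dim V"
  obtains B where "finite B" "B \<subseteq> V" "poly3.independent B" "poly3.span B = V" "card B = poly3.dim V"
proof -
  obtain B where B: "B \<subseteq> V" "poly3.independent B" "V \<subseteq> poly3.span B" "card B = poly3.dim V"
    by (rule poly3.basis_exists)
  obtain W where "finite W" "V \<subseteq> poly3.span W" using assms by (auto simp: fin_dim_def)
  with B have "finite B" using poly3.independent_span_bound[of W B] by blast
  moreover have "poly3.span B = V"
    using B poly3.span_minimal[of B V] fin_dim_subspace[OF assms] by blast
  ultimately show thesis using that B by blast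
qed

lemma card_independent_le_dim:
  assumes "fin_dim V" "poly3.independent C" "C \<subseteq> V"
  shows "finite C \<and> card C \<le> poly3.dim V"
  using fin_dim_basis[OF assms(1)] poly3.independent_span_bound[of _ C] assms by metis

lemma dim_mono_fin:
  assumes "fin_dim V" "U \<subseteq> V"
  shows "poly3.dim U \<le> poly3.dim V"
  using fin_dim_basis[OF assms(1)] poly3.dim_le_card[of U] assms(2) by metis

text \<open>Used to conclude that forms in an ideal are multiples of one form when there are enough multiples.\<close>

lemma subspace_eq_of_dim:
  assumes V: "fin_dim V" and U: "poly3.subspace U" "U \<subseteq> V" and d: "poly3.dim V \<le> poly3.dim U"
  shows "U = V"
proof (rule ccontr)
  assume "U \<noteq> V"
  then obtain v where v: "v \<in> V" "v \<notin> U" using U by blast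
  obtain B where B: "finite B" "B \<subseteq> U" "poly3.independent B" "poly3.span B = U" "card B = poly3.dim U"
    by (rule fin_dim_basis[OF fin_dim_subset[OF V U]])
  have "poly3.independent (insert v B)"
    using v B by (simp add: poly3.independent_insert)
  then have "card (insert v B) \<le> poly3.dim V"
    using card_independent_le_dim[OF V] v B U by blast
  moreover have "v \<notin> B" using v B by blast
  ultimately show False using B d by simp
qed

lemma functional_simps:
  assumes "functional \<phi>"
  shows "\<phi> (f + g) = \<phi> f + \<phi> g" "\<phi> (f - g) = \<phi> f - \<phi> g" "\<phi> (scale3 c f) = c * \<phi> f" "\<phi> 0 = 0"
proof -
  have *: "\<phi> (f + g) = \<phi> f + \<phi> g" "\<phi> (Const c * f) = c * \<phi> f" for f g c
    using assms by (auto simp: functional_def)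
  show "\<phi> (f + g) = \<phi> f + \<phi> g" "\<phi> (scale3 c f) = c * \<phi> f" by (auto simp: * scale3_Const)
  show "\<phi> (f - g) = \<phi> f - \<phi> g" using *(1)[of "f - g" g] by simp
  show "\<phi> 0 = 0" using *(2)[of 0 0] by simp
qed

lemma subspace_functional_kernel:
  "poly3.subspace V \<Longrightarrow> functional \<phi> \<Longrightarrow> poly3.subspace {v \<in> V. \<phi> v = 0}"
  by (auto simp: poly3.subspace_def functional_simps)

lemma subspace_functional_kernels:
  "poly3.subspace V \<Longrightarrow> (\<And>i. i \<in> I \<Longrightarrow> functional (\<phi> i)) \<Longrightarrow> poly3.subspace {v \<in> V. \<forall>i\<in>I. \<phi> i v = 0}"
  by (auto simp: poly3.subspace_def functional_simps)

lemma dim_functional_kernel: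
  assumes V: "fin_dim V" and \<phi>: "functional \<phi>" and v0: "v0 \<in> V" "\<phi> v0 \<noteq> 0"
  shows "poly3.dim V = poly3.dim {v \<in> V. \<phi> v = 0} + 1"
proof -
  let ?K = "{v \<in> V. \<phi> v = 0}"
  have V': "poly3.subspace V" using V by (rule fin_dim_subspace)
  have K: "fin_dim ?K" by (rule fin_dim_subset[OF V subspace_functional_kernel[OF V' \<phi>]]) auto
  obtain B where B: "finite B" "B \<subseteq> ?K" "poly3.independent B" "poly3.span B = ?K" "card B = poly3.dim ?K"
    by (rule fin_dim_basis[OF K])
  have nin: "v0 \<notin> poly3.span B" using v0 B by blast
  then have ind: "poly3.independent (insert v0 B)" using B by (simp add: poly3.independent_insert)
  have "V \<subseteq> poly3.span (insert v0 B)"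
  proof
    fix v assume v: "v \<in> V"
    let ?c = "\<phi> v / \<phi> v0"
    have "v - scale3 ?c v0 \<in> ?K"
      using v v0 V' by (simp add: functional_simps[OF \<phi>] poly3.subspace_diff poly3.subspace_scale)
    then have "v - scale3 ?c v0 \<in> poly3.span B" using B by simp
    then show "v \<in> poly3.span (insert v0 B)"
      using poly3.in_span_insert poly3.span_breakdown_eq by blast
  qed
  then have "card (insert v0 B) = poly3.dim V"
    using poly3.basis_card_eq_dim[OF _ _ ind] B v0 by blast
  moreover have "v0 \<notin> B" using nin poly3.span_base by blast
  ultimately show ?thesis using B by simp
qed

text \<open>Each linear condition lowers the dimension by at most one. All lower bounds below for the dimension
  of a space of curves through given points come from here.\<close>

lemma dim_functional_kernels_le:
  assumes V: "fin_dim V" and I: "finite I" and \<phi>: "\<And>i. i \<in> I \<Longrightarrow> functional (\<phi> i)"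
  shows "poly3.dim V \<le> poly3.dim {v \<in> V. \<forall>i\<in>I. \<phi> i v = 0} + card I"
  using I \<phi>
proof (induction I)
  case (insert i I)
  let ?U = "{v \<in> V. \<forall>i\<in>I. \<phi> i v = 0}"
  have U: "fin_dim ?U"
    using insert.prems by (intro fin_dim_subset[OF V] subspace_functional_kernels fin_dim_subspace[OF V]) auto
  have e: "{v \<in> ?U. \<phi> i v = 0} = {v \<in> V. \<forall>j\<in>insert i I. \<phi> j v = 0}" by auto
  have "poly3.dim ?U \<le> poly3.dim {v \<in> ?U. \<phi> i v = 0} + 1"
  proof (cases "\<exists>v\<in>?U. \<phi> i v \<noteq> 0")
    case True
    then show ?thesis using dim_functional_kernel[OF U, of "\<phi> i"] insert.prems by force
  next
    case False
    then have "{v \<in> ?U. \<phi> i v = 0} = ?U" by blast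
    then show ?thesis by simp
  qed
  then show ?case using insert unfolding e by simp
qed simp

text \<open>The dual elements make the conditions independent: the one belonging to a condition satisfies all
  the others, so that each step of the induction lowers the dimension.\<close>

lemma dim_functional_kernels_eq:
  assumes V: "fin_dim V" and I: "finite I" and \<phi>: "\<And>i. i \<in> I \<Longrightarrow> functional (\<phi> i)"
    and dual: "\<And>i. i \<in> I \<Longrightarrow> \<exists>v\<in>V. \<phi> i v \<noteq> 0 \<and> (\<forall>j\<in>I. j \<noteq> i \<longrightarrow> \<phi> j v = 0)"
  shows "poly3.dim V = poly3.dim {v \<in> V. \<forall>i\<in>I. \<phi> i v = 0} + card I"
  using I \<phi> dual
proof (induction I)
  case (insert i I)
  let ?U = "{v \<in> V. \<forall>i\<in>I. \<phi> i v = 0}"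
  have U: "fin_dim ?U"
    using insert.prems by (intro fin_dim_subset[OF V] subspace_functional_kernels fin_dim_subspace[OF V]) auto
  have e: "{v \<in> ?U. \<phi> i v = 0} = {v \<in> V. \<forall>j\<in>insert i I. \<phi> j v = 0}" by auto
  obtain v where v: "v \<in> V" "\<phi> i v \<noteq> 0" "\<forall>j\<in>insert i I. j \<noteq> i \<longrightarrow> \<phi> j v = 0"
    using insert.prems(2)[of i] by blast
  then have "v \<in> ?U" using insert.hyps by auto
  then have "poly3.dim ?U = poly3.dim {v \<in> ?U. \<phi> i v = 0} + 1"
    using dim_functional_kernel[OF U, of "\<phi> i" v] insert.prems v by simp
  moreover have "poly3.dim V = poly3.dim ?U + card I"
    using insert.prems by (intro insert.IH) (blast, metis insertCI)
  ultimately show ?case using insert.hyps unfolding e by simp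
qed simp

lemma span_mult:
  assumes "v \<in> poly3.span B" shows "h * v \<in> poly3.span ((*) h ` B)"
  using assms
proof (induction rule: poly3.span_induct_alt)
  case base then show ?case by (simp add: poly3.span_zero)
next
  case (step c x y)
  have "h * (scale3 c x + y) = scale3 c (h * x) + h * y"
    by (simp add: scale3_Const algebra_simps)
  moreover have "scale3 c (h * x) \<in> poly3.span ((*) h ` B)"
    using step(1) by (intro poly3.span_scale poly3.span_base) blast
  ultimately show ?case using step(2) by (simp add: poly3.span_add)
qed

lemma fin_dim_mult:
  assumes V: "fin_dim V"
  shows "fin_dim ((*) h ` V)"
proof -
  obtain B where B: "finite B" "poly3.span B = V" using fin_dim_basis[OF V] by metis
  have V': "poly3.subspace V" using V by (rule fin_dim_subspace)
  have "poly3.subspace ((*) h ` V)"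
    unfolding poly3.subspace_def
  proof (intro conjI allI ballI)
    show "0 \<in> (*) h ` V" using poly3.subspace_0[OF V'] by force
    show "x + y \<in> (*) h ` V" if "x \<in> (*) h ` V" "y \<in> (*) h ` V" for x y
      using that poly3.subspace_add[OF V'] by (force simp flip: distrib_left)
    show "scale3 c x \<in> (*) h ` V" if x: "x \<in> (*) h ` V" for c x
    proof -
      obtain y where y: "x = h * y" "y \<in> V" using x by blast
      then have "scale3 c x = h * scale3 c y" by (simp add: scale3_Const mult.left_commute)
      then show ?thesis using poly3.subspace_scale[OF V' y(2)] by blast
    qed
  qed
  moreover have "(*) h ` V \<subseteq> poly3.span ((*) h ` B)" using span_mult B by blast
  ultimately show ?thesis unfolding fin_dim_def using B by blast
qed

lemma dim_mult:
  assumes V: "fin_dim V" and h: "h \<noteq> 0"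
  shows "poly3.dim ((*) h ` V) = poly3.dim V"
proof -
  have inj: "inj_on ((*) h) S" for S using h by (auto simp: inj_on_def)
  obtain B where B: "finite B" "B \<subseteq> V" "poly3.independent B" "poly3.span B = V" "card B = poly3.dim V"
    by (rule fin_dim_basis[OF V])
  have "poly3.independent ((*) h ` B)"
  proof (rule poly3.independent_if_scalars_zero)
    fix c x assume s: "(\<Sum>x\<in>(*) h ` B. scale3 (c x) x) = 0" and x: "x \<in> (*) h ` B"
    have "(\<Sum>x\<in>(*) h ` B. scale3 (c x) x) = h * (\<Sum>b\<in>B. scale3 (c (h * b)) b)"
      unfolding sum.reindex[OF inj] sum_distrib_left
      by (intro sum.cong) (auto simp: scale3_Const mult.left_commute)
    with s h have "(\<Sum>b\<in>B. scale3 (c (h * b)) b) = 0" by simp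
    then have "\<forall>b\<in>B. c (h * b) = 0"
      using poly3.independentD[OF B(3,1) subset_refl, of "\<lambda>b. c (h * b)"] by blast
    then show "c x = 0" using x by blast
  qed (use B in simp)
  then have "card ((*) h ` B) \<le> poly3.dim ((*) h ` V)"
    using card_independent_le_dim[OF fin_dim_mult[OF V]] B by blast
  moreover have "poly3.dim ((*) h ` V) \<le> card ((*) h ` B)"
  proof (rule poly3.dim_le_card)
    show "(*) h ` V \<subseteq> poly3.span ((*) h ` B)" using B span_mult by blast
  qed (use B in simp)
  moreover have "card ((*) h ` B) = card B" using inj by (rule card_image)
  ultimately show ?thesis using B by simp
qed

lemma forms_subspace: "poly3.subspace (forms d)"
  by (auto simp: poly3.subspace_def scale3_Const)

lemma fin_dim_forms: "fin_dim (forms d)"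
proof -
  have "\<exists>W. finite W \<and> forms d \<subseteq> poly3.span (W :: 'a poly3 set)"
  proof -
    define W :: "nat \<Rightarrow> 'a poly3 set" where "W = rec_nat {1} (\<lambda>_ S. \<Union>i. (*) (Var i) ` S)"
    have W0: "W 0 = {1}" and WS: "W (Suc d) = (\<Union>i. (*) (Var i) ` W d)" for d
      by (simp_all add: W_def)
    have "finite (W d)" for d by (induction d) (auto simp: W0 WS)
    moreover have "f \<in> poly3.span (W d)" if "f \<in> forms d" for f d
      using that
    proof (induction rule: forms_induct)
      case (Const c)
      have "Const c = scale3 c 1" by (simp add: scale3_Const)
      then show ?case by (metis W0 poly3.span_base poly3.span_scale singletonI)
    next
      case (add d f g)
      then show ?case by (simp add: poly3.span_add)
    next
      case (Var d i f)
      from Var(2) show ?case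
      proof (induction rule: poly3.span_induct_alt)
        case base then show ?case by (simp add: poly3.span_zero)
      next
        case (step c x y)
        have "Var i * (scale3 c x + y) = scale3 c (Var i * x) + Var i * y"
          by (simp add: scale3_Const algebra_simps)
        moreover have "Var i * x \<in> W (Suc d)" using step by (auto simp: WS)
        ultimately show ?case using step by (simp add: poly3.span_add poly3.span_scale poly3.span_base)
      qed
    qed
    ultimately show ?thesis by blast
  qed
  then show ?thesis by (simp add: fin_dim_def forms_subspace)
qed

lemma functional_eval3: "functional (\<lambda>f. eval3 f v)"
  by (auto simp: functional_def)

lemma functional_eval3_dir_deriv: "functional (\<lambda>f. eval3 (dir_deriv w f) v)"
  by (auto simp: functional_def)

lemma functional_coeff_line_poly: "functional (\<lambda>f. coeff (line_poly f u w) j)"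
  by (auto simp: functional_def)

section \<open>Restriction to a line of the projective plane\<close>

text \<open>Coordinates adapted to the line \<open>L = 0\<close>, which is spanned by \<open>u\<close> and \<open>w\<close>: the linear
  forms \<open>A\<close>, \<open>B\<close>, \<open>L\<close> are the coordinate functions belonging to the basis \<open>u\<close>, \<open>w\<close>, \<open>m\<close>.\<close>

definition frame :: "'k::field ^ 3 \<Rightarrow> 'k ^ 3 \<Rightarrow> 'k ^ 3 \<Rightarrow> 'k poly3 \<Rightarrow> 'k poly3 \<Rightarrow> 'k poly3 \<Rightarrow> bool" where
  "frame u w m A B L \<longleftrightarrow> A \<in> forms 1 \<and> B \<in> forms 1 \<and> L \<in> forms 1 \<and>
     (\<forall>i. Var i = Const (u $ i) * A + Const (w $ i) * B + Const (m $ i) * L) \<and>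
     eval3 A u = 1 \<and> eval3 A w = 0 \<and> eval3 B u = 0 \<and> eval3 B w = 1 \<and>
     eval3 L u = 0 \<and> eval3 L w = 0 \<and> eval3 L m = 1"

lemma line_poly_linear_form:
  assumes "f \<in> forms 1" shows "line_poly f v w = [:eval3 f v, eval3 f w:]"
proof -
  have d: "degree (line_poly f v w) \<le> 1" using degree_line_poly[OF assms] .
  have "coeff (line_poly f v w) 0 = eval3 f v"
    using poly_line_poly[of f v w 0] by (simp add: poly_0_coeff_0)
  moreover have "coeff (line_poly f v w) 1 = eval3 f w"
    using coeff_line_poly_top[OF assms] .
  ultimately show ?thesis
    by (intro poly_eqI) (auto simp: coeff_pCons intro!: coeff_eq_0 le_less_trans[OF d] split: nat.splits)
qed

lemma linear_form_add:
  assumes "f \<in> forms 1" shows "eval3 f (v + s *s w) = eval3 f v + s * eval3 f w"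
  using poly_line_poly[of f v w s] by (simp add: line_poly_linear_form[OF assms])

text \<open>The inverse of restricting to the line \<open>L = 0\<close>, on which \<open>A = 1\<close> and \<open>B = s\<close>.\<close>

definition homogenise :: "'k::field poly3 \<Rightarrow> 'k poly3 \<Rightarrow> nat \<Rightarrow> 'k poly \<Rightarrow> 'k poly3" where
  "homogenise A B d p = (\<Sum>j\<le>d. Const (coeff p j) * (A ^ (d - j) * B ^ j))"

lemma forms_power: "f \<in> forms 1 \<Longrightarrow> f ^ n \<in> forms n"
proof (induction n)
  case 0
  then show ?case using forms_Const[of 1] by simp
next
  case (Suc n)
  then show ?case using forms_mult[of f 1 "f ^ n" n] by simp
qed

lemma homogenise_forms:
  assumes "A \<in> forms 1" "B \<in> forms 1" shows "homogenise A B d p \<in> forms d"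
  unfolding homogenise_def
proof (intro forms_sum forms_Const_mult)
  fix j assume "j \<in> {..d}"
  then show "A ^ (d - j) * B ^ j \<in> forms d"
    using forms_mult[OF forms_power[OF assms(1), of "d - j"] forms_power[OF assms(2), of j]] by simp
qed

lemma homogenise_add: "homogenise A B d (p + q) = homogenise A B d p + homogenise A B d q"
  by (simp add: homogenise_def algebra_simps sum.distrib)

lemma homogenise_smult: "homogenise A B d (smult c p) = Const c * homogenise A B d p"
  by (simp add: homogenise_def sum_distrib_left mult.assoc)

lemma homogenise_Suc:
  assumes "degree p \<le> d" shows "homogenise A B (Suc d) p = A * homogenise A B d p"
proof -
  have "homogenise A B (Suc d) p = (\<Sum>j\<le>d. Const (coeff p j) * (A ^ (Suc d - j) * B ^ j))"
    using assms by (simp add: homogenise_def coeff_eq_0)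
  also have "\<dots> = A * homogenise A B d p"
    unfolding homogenise_def sum_distrib_left
    by (intro sum.cong) (auto simp: Suc_diff_le algebra_simps)
  finally show ?thesis .
qed

lemma homogenise_pCons0: "homogenise A B (Suc d) (pCons 0 p) = B * homogenise A B d p"
  unfolding homogenise_def sum_distrib_left sum.atMost_Suc_shift
  by (simp add: algebra_simps)

lemma line_poly_power [simp]: "line_poly (f ^ n) u w = line_poly f u w ^ n"
  by (induction n) simp_all

lemma frame_direction:
  assumes "frame u w m A B L" "eval3 L v = 0"
  shows "v = eval3 A v *s u + eval3 B v *s w"
proof -
  have V: "Var i = Const (u $ i) * A + Const (w $ i) * B + Const (m $ i) * L" for i
    using assms(1) by (simp add: frame_def)
  have "v $ i = (eval3 A v *s u + eval3 B v *s w) $ i" for i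
    using arg_cong[OF V[of i], of "\<lambda>f. eval3 f v"] assms(2) by (simp add: mult.commute)
  then show ?thesis by (simp add: vec_eq_iff)
qed

lemma frame_line_poly:
  assumes "frame u w m A B L"
  shows "line_poly A u w = [:1:]" "line_poly B u w = [:0, 1:]" "line_poly L u w = 0"
  using assms by (auto simp: frame_def line_poly_linear_form)

lemma frame_line_poly_homogenise:
  assumes "frame u w m A B L" "degree p \<le> d"
  shows "line_poly (homogenise A B d p) u w = p"
proof -
  have "line_poly (homogenise A B d p) u w = (\<Sum>j\<le>d. monom (coeff p j) j)"
    by (simp add: homogenise_def frame_line_poly[OF assms(1)] monom_altdef flip: one_pCons)
  also have "\<dots> = p" using assms(2) by (rule poly_as_sum_of_monoms')
  finally show ?thesis .
qed

lemma frame_lift: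
  assumes "frame u w m A B L" "degree p \<le> d"
  obtains f where "f \<in> forms d" "line_poly f u w = p"
proof (rule that)
  show "homogenise A B d p \<in> forms d" using assms(1) by (intro homogenise_forms) (auto simp: frame_def)
qed (rule frame_line_poly_homogenise[OF assms])

text \<open>Modulo \<open>L\<close> every variable is a combination of \<open>A\<close> and \<open>B\<close>, so a form is congruent to a binary
  form in \<open>A\<close> and \<open>B\<close>, and this binary form can be read off on the line. As \<open>d - 1\<close> is truncated,
  the quotient for \<open>d = 0\<close> is described separately.\<close>

lemma frame_decomposition:
  assumes fr: "frame u w m A B L" and f: "f \<in> forms d"
  shows "\<exists>g. g \<in> forms (d - 1) \<and> (d = 0 \<longrightarrow> g = 0) \<and> f = L * g + homogenise A B d (line_poly f u w)"
  using f
proof (induction rule: forms_induct)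
  case (Const c)
  then show ?case by (auto simp: homogenise_def)
next
  case (add d f g)
  define h1 h2 where "h1 = homogenise A B d (line_poly f u w)" and "h2 = homogenise A B d (line_poly g u w)"
  obtain f' g' where f': "f' \<in> forms (d - 1)" "d = 0 \<longrightarrow> f' = 0" "f = L * f' + h1"
    and g': "g' \<in> forms (d - 1)" "d = 0 \<longrightarrow> g' = 0" "g = L * g' + h2"
    using add unfolding h1_def h2_def by blast
  have "homogenise A B d (line_poly (f + g) u w) = h1 + h2" by (simp add: h1_def h2_def homogenise_add)
  moreover have "f + g = L * (f' + g') + (h1 + h2)" using f' g' by (simp add: algebra_simps)
  ultimately show ?case using f' g' by (intro exI[of _ "f' + g'"]) auto
next
  case (Var d i f)
  then obtain g where g: "g \<in> forms (d - 1)" "d = 0 \<longrightarrow> g = 0" "f = L * g + homogenise A B d (line_poly f u w)"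
    by blast
  define h where "h = homogenise A B d (line_poly f u w)"
  have AB: "A \<in> forms 1" "B \<in> forms 1" "L \<in> forms 1" and V: "Var i = Const (u $ i) * A + Const (w $ i) * B + Const (m $ i) * L"
    using fr by (auto simp: frame_def)
  have deg: "degree (line_poly f u w) \<le> d" using Var(1) by (rule degree_line_poly)
  have "homogenise A B (Suc d) (line_poly (Var i * f) u w) = Const (u $ i) * (A * h) + Const (w $ i) * (B * h)"
  proof -
    have "line_poly (Var i * f) u w = smult (u $ i) (line_poly f u w) + pCons 0 (smult (w $ i) (line_poly f u w))"
      by simp
    then show ?thesis
      by (simp only: homogenise_add homogenise_smult homogenise_Suc[OF deg] homogenise_pCons0 h_def mult.left_commute)
  qed
  moreover have "Var i * f = L * (Var i * g + Const (m $ i) * h) + (Const (u $ i) * (A * h) + Const (w $ i) * (B * h))"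
  proof -
    have "Var i * f = L * (Var i * g) + Var i * h" by (subst g(3)) (simp add: h_def algebra_simps)
    also have "Var i * h = L * (Const (m $ i) * h) + (Const (u $ i) * (A * h) + Const (w $ i) * (B * h))"
      unfolding V by (simp add: algebra_simps)
    finally show ?thesis by (simp add: algebra_simps)
  qed
  moreover have "Var i * g + Const (m $ i) * h \<in> forms d"
  proof -
    have "Var i * g \<in> forms d" using g by (cases d) auto
    then show ?thesis unfolding h_def using homogenise_forms[OF AB(1,2)] by blast
  qed
  ultimately show ?case by (intro exI[of _ "Var i * g + Const (m $ i) * h"]) simp
qed

lemma frame_factor:
  assumes "frame u w m A B L" "f \<in> forms d" "line_poly f u w = 0"
  obtains g where "g \<in> forms (d - 1)" "d = 0 \<Longrightarrow> g = 0" "f = L * g"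
proof -
  have "homogenise A B d 0 = 0" by (simp add: homogenise_def)
  then show thesis using frame_decomposition[OF assms(1,2)] assms(3) that by auto
qed

lemma standard_frame:
  "frame (axis 1 1) (axis 2 1) (axis 3 1) (Var 1) (Var 2) (Var 3)"
proof -
  have V: "Var i = Const (axis 1 1 $ i) * Var 1 + Const (axis 2 1 $ i) * Var 2 + Const (axis 3 1 $ i) * Var 3" for i :: 3
    using exhaust_3[of i] by (elim disjE) (simp_all add: axis_def)
  show ?thesis
    unfolding frame_def
  proof (intro conjI allI)
    show "Var i = Const (axis 1 1 $ i) * Var 1 + Const (axis 2 1 $ i) * Var 2 + Const (axis 3 1 $ i) * Var 3" for i
      by (rule V)
  qed (simp_all add: axis_def)
qed

text \<open>The field is infinite. If \<open>f\<close> vanishes everywhere, then its restriction to \<open>x\<^sub>3 = 0\<close> is the zero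
  polynomial, so \<open>f = x\<^sub>3 g\<close>. The form \<open>g\<close> vanishes where \<open>x\<^sub>3 \<noteq> 0\<close>, and then everywhere, because
  every point lies on an affine line along which \<open>x\<^sub>3\<close> is not constant.\<close>

lemma form_eq_0_if_eval3_0:
  fixes f :: "'k::field_char_0 poly3"
  assumes "f \<in> forms d" "\<And>v. eval3 f v = 0"
  shows "f = 0"
  using assms
proof (induction d arbitrary: f)
  case 0
  then obtain c where "f = Const c" by (auto elim: forms_0E)
  then show ?case using 0(2)[of 0] by simp
next
  case (Suc d)
  define u w m where "u = (axis 1 1 :: 'k^3)" and "w = (axis 2 1 :: 'k^3)" and "m = (axis 3 1 :: 'k^3)"
  have fr: "frame u w m (Var 1) (Var 2) (Var 3)" unfolding u_def w_def m_def by (rule standard_frame)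
  have "line_poly f u w = 0" using Suc(3) by (subst poly_all_0_iff_0[symmetric]) (simp add: poly_line_poly)
  then obtain g where g: "g \<in> forms d" "f = Var 3 * g" using frame_factor[OF fr Suc(2)] by auto
  have "eval3 g v = 0" for v
  proof -
    have "poly (line_poly f v m) s = 0" for s using Suc(3) by (simp only: poly_line_poly)
    then have "line_poly f v m = 0" by (subst poly_all_0_iff_0[symmetric]) blast
    then have "line_poly (Var 3) v m * line_poly g v m = 0" by (simp only: g(2) line_poly_simps(6))
    moreover have "line_poly (Var 3) v m \<noteq> 0" by (simp add: m_def)
    ultimately have "line_poly g v m = 0" using mult_eq_0_iff by blast
    then show ?thesis using poly_line_poly[of g v m 0] by simp
  qed
  then have "g = 0" using Suc.IH g by blast
  then show ?case using g by simp
qed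

lemma form_eqI:
  fixes f g :: "'k::field_char_0 poly3"
  assumes "f \<in> forms d" "g \<in> forms d" "\<And>v. eval3 f v = eval3 g v"
  shows "f = g"
  using form_eq_0_if_eval3_0[of "f - g" d] assms by auto

lemma linear_form_eval3:
  assumes "f \<in> forms 1" shows "eval3 f v = (\<Sum>i\<in>UNIV. eval3 f (axis i 1) * v $ i)"
proof -
  have "d = 1 \<longrightarrow> eval3 f v = (\<Sum>i\<in>UNIV. eval3 f (axis i 1) * v $ i)" if "f \<in> forms d" for d
    using that
  proof (induction rule: forms_induct)
    case (add d f g)
    then show ?case by (simp add: algebra_simps sum.distrib)
  next
    case (Var d i f)
    show ?case
    proof
      assume "Suc d = 1"
      then obtain c where c: "f = Const c" using Var forms_0E by auto
      have "(\<Sum>j\<in>UNIV. axis j 1 $ i * c * v $ j) = (\<Sum>j\<in>UNIV. if j = i then c * v $ i else 0)"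
        by (intro sum.cong) (auto simp: axis_def)
      then show "eval3 (Var i * f) v = (\<Sum>j\<in>UNIV. eval3 (Var i * f) (axis j 1) * v $ j)"
        using c by (simp add: mult.commute)
    qed
  qed auto
  then show ?thesis using assms by blast
qed

lemma sum_UNIV_3_distinct:
  fixes h :: "3 \<Rightarrow> 'a::comm_monoid_add"
  assumes "i \<noteq> j" "i \<noteq> k" "j \<noteq> k"
  shows "sum h UNIV = h i + h j + h k"
proof -
  have U: "UNIV = {i, j, k}"
    using assms by (intro card_subset_eq[symmetric]) auto
  show ?thesis using assms by (subst U) (simp add: add.assoc)
qed

text \<open>Let \<open>c\<^sub>k\<close> be a nonzero coefficient of \<open>L\<close> and \<open>w\<^sub>j \<noteq> 0\<close> with \<open>j \<noteq> k\<close>, which exists because \<open>w\<close> lies on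
  the line. The third index \<open>i\<close> then supplies \<open>u\<close>.\<close>

lemma frame_exists:
  fixes L :: "'k::field_char_0 poly3"
  assumes L: "L \<in> forms 1" "L \<noteq> 0" and w: "eval3 L w = 0" "w \<noteq> 0"
  obtains u m A B where "frame u w m A B L"
proof -
  define c where "c i = eval3 L (axis i 1)" for i
  have Lv: "eval3 L v = (\<Sum>i\<in>UNIV. c i * v $ i)" for v
    unfolding c_def by (rule linear_form_eval3[OF L(1)])
  have "\<exists>k. c k \<noteq> 0"
  proof (rule ccontr)
    assume "\<not> ?thesis"
    then have "eval3 L v = 0" for v by (simp add: Lv)
    then show False using form_eq_0_if_eval3_0[OF L(1)] L(2) by blast
  qed
  then obtain k where k: "c k \<noteq> 0" ..
  have "\<exists>j. j \<noteq> k \<and> w $ j \<noteq> 0"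
  proof (rule ccontr)
    assume *: "\<not> ?thesis"
    then have "(\<Sum>i\<in>UNIV. c i * w $ i) = (\<Sum>i\<in>UNIV. if i = k then c k * w $ k else 0)"
      by (intro sum.cong) auto
    then have "w $ k = 0" using w(1) k by (simp add: Lv)
    then have "w = 0" using * by (metis vec_eq_iff zero_index)
    then show False using w by simp
  qed
  then obtain j where j: "j \<noteq> k" "w $ j \<noteq> 0" by blast
  have "card {j, k} < card (UNIV :: 3 set)" using j by simp
  then have "\<exists>i. i \<notin> {j, k}" by (metis UNIV_eq_I less_irrefl)
  then obtain i where i: "i \<noteq> j" "i \<noteq> k" by blast
  have i3: "x = i \<or> x = j \<or> x = k" for x
  proof -
    have "UNIV = {i, j, k}" using i j by (intro card_subset_eq[symmetric]) auto
    then show ?thesis by blast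
  qed
  define u where "u = axis i 1 - (c i / c k) *s axis k 1"
  define m where "m = (1 / c k) *s (axis k 1 :: 'k^3)"
  define A where "A = Var i - Const (w $ i / w $ j) * Var j"
  define B where "B = Const (1 / w $ j) * Var j"
  have forms: "A \<in> forms 1" "B \<in> forms 1" unfolding A_def B_def by blast+
  have u: "u $ i = 1" "u $ j = 0" "u $ k = - (c i / c k)"
    and m: "m $ i = 0" "m $ j = 0" "m $ k = 1 / c k"
    using i j by (auto simp: u_def m_def axis_def)
  have Lv': "eval3 L v = c i * v $ i + c j * v $ j + c k * v $ k" for v
    unfolding Lv by (rule sum_UNIV_3_distinct) (use i j in auto)
  have V: "Var x = Const (u $ x) * A + Const (w $ x) * B + Const (m $ x) * L" for x
  proof (rule form_eqI[of _ 1])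
    show "Const (u $ x) * A + Const (w $ x) * B + Const (m $ x) * L \<in> forms 1"
      using forms L by blast
    fix v
    have wk: "w $ k = - (c i * w $ i + c j * w $ j) / c k"
      using w(1) k unfolding Lv' by (simp add: field_simps) (metis add_eq_0_iff minus_add_cancel mult.commute)
    show "eval3 (Var x) v = eval3 (Const (u $ x) * A + Const (w $ x) * B + Const (m $ x) * L) v"
      using i3[of x]
    proof (elim disjE)
      assume "x = k"
      then show ?thesis using j k by (simp add: u m A_def B_def Lv' wk field_simps)
    qed (use j k in \<open>auto simp: u m A_def B_def Lv' field_simps\<close>)
  qed auto
  have "frame u w m A B L"
    unfolding frame_def
  proof (intro conjI allI)
    show "Var x = Const (u $ x) * A + Const (w $ x) * B + Const (m $ x) * L" for x by (rule V)
  qed (use forms L w j k in \<open>auto simp: A_def B_def u m Lv'\<close>)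
  then show thesis by (rule that)
qed

text \<open>Restriction to \<open>x\<^sub>3 = 0\<close> maps the forms of degree \<open>d + 1\<close> onto the binary forms, a space of
  dimension \<open>d + 2\<close>, and its kernel consists of \<open>x\<^sub>3\<close> times the forms of degree \<open>d\<close>.\<close>

lemma dim_forms: "poly3.dim (forms d :: 'k::field_char_0 poly3 set) = (d + 2) choose 2"
proof (induction d)
  case 0
  have "poly3.dim (forms 0 :: 'k poly3 set) = card {1 :: 'k poly3}"
  proof (rule poly3.dim_unique)
    show "{1} \<subseteq> (forms 0 :: 'k poly3 set)" using forms_Const[of "1::'k"] by simp
    show "forms 0 \<subseteq> poly3.span {1 :: 'k poly3}"
    proof
      fix f :: "'k poly3" assume "f \<in> forms 0"
      then obtain c where "f = scale3 c 1" by (auto elim!: forms_0E simp: scale3_Const)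
      then show "f \<in> poly3.span {1}" by (simp add: poly3.span_base poly3.span_scale)
    qed
  qed auto
  then show ?case by (simp add: numeral_2_eq_2)
next
  case (Suc d)
  define u w m where "u = (axis 1 1 :: 'k^3)" and "w = (axis 2 1 :: 'k^3)" and "m = (axis 3 1 :: 'k^3)"
  have fr: "frame u w m (Var 1) (Var 2) (Var 3)" unfolding u_def w_def m_def by (rule standard_frame)
  have "poly3.dim (forms (Suc d) :: 'k poly3 set) = poly3.dim {f \<in> forms (Suc d). \<forall>j\<in>{..Suc d}. coeff (line_poly f u w) j = 0} + card {..Suc d}"
  proof (rule dim_functional_kernels_eq[OF fin_dim_forms])
    fix j assume "j \<in> {..Suc d}"
    then have "degree (monom (1::'k) j) \<le> Suc d" by (simp add: degree_monom_eq)
    then obtain f where "f \<in> forms (Suc d)" "line_poly f u w = monom 1 j" by (rule frame_lift[OF fr])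
    then show "\<exists>f\<in>forms (Suc d). coeff (line_poly f u w) j \<noteq> 0 \<and> (\<forall>i\<in>{..Suc d}. i \<noteq> j \<longrightarrow> coeff (line_poly f u w) i = 0)"
      by (intro bexI[of _ f]) auto
  qed (auto simp: functional_coeff_line_poly)
  also have "{f \<in> forms (Suc d). \<forall>j\<in>{..Suc d}. coeff (line_poly f u w) j = 0} = (*) (Var 3) ` forms d"
  proof (intro equalityI subsetI)
    fix f assume f: "f \<in> {f \<in> forms (Suc d). \<forall>j\<in>{..Suc d}. coeff (line_poly f u w) j = 0}"
    have "coeff (line_poly f u w) j = 0" for j
      using f degree_line_poly[of f "Suc d" u w] by (cases "j \<le> Suc d") (auto simp: coeff_eq_0)
    then have l0: "line_poly f u w = 0" by (intro poly_eqI) simp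
    have "f \<in> forms (Suc d)" using f by blast
    then obtain g where "g \<in> forms (Suc d - 1)" "f = Var 3 * g" by (rule frame_factor[OF fr _ l0])
    then show "f \<in> (*) (Var 3) ` forms d" using imageI[of g "forms d" "(*) (Var 3)"] by simp
  next
    fix f :: "'k poly3" assume "f \<in> (*) (Var 3) ` forms d"
    then show "f \<in> {f \<in> forms (Suc d). \<forall>j\<in>{..Suc d}. coeff (line_poly f u w) j = 0}"
      using frame_line_poly(3)[OF fr] by auto
  qed
  also have "poly3.dim ((*) (Var 3) ` (forms d :: 'k poly3 set)) = poly3.dim (forms d :: 'k poly3 set)"
  proof (rule dim_mult[OF fin_dim_forms])
    have "eval3 (Var 3) (axis 3 1) \<noteq> (0::'k)" by simp
    then show "Var 3 \<noteq> (0::'k poly3)" by (metis eval3_simps(1))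
  qed
  finally have "poly3.dim (forms (Suc d) :: 'k poly3 set) = (d + 2 choose 2) + (d + 2)" using Suc by simp
  also have "\<dots> = Suc d + 2 choose 2" by (simp add: numeral_2_eq_2)
  finally show ?case .
qed

text \<open>The lines through \<open>p\<close> have coefficient vectors on which the linear form with coefficients \<open>p\<close>
  vanishes. The product of these linear forms, over all \<open>p\<close>, does not vanish identically.\<close>

lemma exists_line_avoiding:
  fixes Y :: "('k::field_char_0 ^ 3) set"
  assumes "finite Y" "0 \<notin> Y"
  obtains L where "L \<in> forms 1" "L \<noteq> 0" "\<forall>p\<in>Y. eval3 L p \<noteq> 0"
proof -
  define lin :: "'k ^ 3 \<Rightarrow> 'k poly3" where "lin c = (\<Sum>i\<in>UNIV. Const (c $ i) * Var i)" for c
  have lin1: "lin c \<in> forms 1" for c unfolding lin_def by (intro forms_sum forms_Const_mult forms_Var)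
  have lin_comm: "eval3 (lin c) p = eval3 (lin p) c" for c p
    by (simp add: lin_def mult.commute)
  have lin0: "lin p \<noteq> 0" if "p \<noteq> 0" for p
  proof
    assume "lin p = 0"
    have "p $ i = 0" for i
    proof -
      have "eval3 (lin p) (axis i 1) = (\<Sum>j\<in>UNIV. if j = i then p $ i else 0)"
        unfolding lin_def eval3_simps by (intro sum.cong) (auto simp: axis_def)
      then show ?thesis using \<open>lin p = 0\<close> by simp
    qed
    then show False using that by (simp add: vec_eq_iff)
  qed
  define Y' where "Y' = insert (axis 1 1) Y"
  have Y': "finite Y'" "0 \<notin> Y'" using assms by (auto simp: Y'_def axis_eq_0_iff)
  have "(\<Prod>p\<in>Z. lin p) \<in> forms (card Z)" if "finite Z" for Z
    using that
  proof (induction Z)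
    case empty
    then show ?case using forms_Const[of 1] by simp
  next
    case (insert p Z)
    then show ?case using forms_mult[OF lin1[of p] insert.IH] by simp
  qed
  then have "(\<Prod>p\<in>Y'. lin p) \<in> forms (card Y')" using Y' by blast
  moreover have "(\<Prod>p\<in>Y'. lin p) \<noteq> 0" using Y' lin0 by (metis prod_zero_iff)
  ultimately obtain c where "eval3 (\<Prod>p\<in>Y'. lin p) c \<noteq> 0" using form_eq_0_if_eval3_0 by blast
  then have c: "eval3 (lin c) p \<noteq> 0" if "p \<in> Y'" for p
    using that Y' by (simp add: lin_comm[of c])
  show thesis
  proof (rule that[OF lin1])
    show "lin c \<noteq> 0" using c[of "axis 1 1"] by (auto simp: Y'_def)
  qed (use c Y'_def in auto)
qed

lemma line_has_point:
  fixes L :: "'k::field_char_0 poly3"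
  assumes "L \<in> forms 1"
  obtains w where "w \<noteq> 0" "eval3 L w = 0"
proof (cases "eval3 L (axis 1 1) = 0")
  case True
  then show thesis using that[of "axis 1 1"] by (simp add: axis_eq_0_iff)
next
  case False
  define w where "w = (- eval3 L (axis 2 1)) *s axis 1 1 + eval3 L (axis 1 1) *s (axis 2 1 :: 'k ^ 3)"
  have "w $ 2 \<noteq> 0" using False by (simp add: w_def axis_def)
  then have "w \<noteq> 0" by auto
  moreover have "eval3 L w = 0"
    unfolding w_def linear_form_add[OF assms] eval3_homogeneous[OF assms] by simp
  ultimately show thesis by (rule that)
qed

lemma line_divides:
  fixes L :: "'k::field_char_0 poly3"
  assumes L: "L \<in> forms 1" "L \<noteq> 0" and G: "G \<in> forms d" "\<And>w. eval3 L w = 0 \<Longrightarrow> eval3 G w = 0"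
  obtains G' where "G' \<in> forms (d - 1)" "G = L * G'"
proof -
  obtain w where w: "w \<noteq> 0" "eval3 L w = 0" by (rule line_has_point[OF L(1)])
  obtain u m A B where fr: "frame u w m A B L" by (rule frame_exists[OF L w(2,1)])
  have "eval3 L (u + s *s w) = 0" for s
    using fr by (simp add: linear_form_add[OF L(1)] frame_def)
  then have "poly (line_poly G u w) s = 0" for s using G(2) by (simp add: poly_line_poly)
  then have "line_poly G u w = 0" using poly_all_0_iff_0 by blast
  then show thesis using frame_factor[OF fr G(1)] that by blast
qed

section \<open>Forms vanishing, or singular, along a finite set\<close>

definition vanishing :: "('k::field ^ 3) set \<Rightarrow> nat \<Rightarrow> 'k poly3 set" where
  "vanishing Y d = {f \<in> forms d. \<forall>p\<in>Y. eval3 f p = 0}"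

text \<open>The value is prescribed besides the gradient because constants have gradient zero.\<close>

definition singular :: "('k::field ^ 3) set \<Rightarrow> nat \<Rightarrow> 'k poly3 set" where
  "singular Y d = {f \<in> forms d. \<forall>p\<in>Y. eval3 f p = 0 \<and> (\<forall>w. eval3 (dir_deriv w f) p = 0)}"

lemma vanishingD: "f \<in> vanishing Y d \<Longrightarrow> f \<in> forms d" "f \<in> vanishing Y d \<Longrightarrow> p \<in> Y \<Longrightarrow> eval3 f p = 0"
  by (auto simp: vanishing_def)

lemma singularD:
  "f \<in> singular Y d \<Longrightarrow> f \<in> forms d" "f \<in> singular Y d \<Longrightarrow> p \<in> Y \<Longrightarrow> eval3 f p = 0"
  "f \<in> singular Y d \<Longrightarrow> p \<in> Y \<Longrightarrow> eval3 (dir_deriv w f) p = 0"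
  by (auto simp: singular_def)

lemma fin_dim_vanishing: "fin_dim (vanishing Y d)"
proof (rule fin_dim_subset[OF fin_dim_forms])
  show "poly3.subspace (vanishing Y d)"
    by (auto simp: poly3.subspace_def vanishing_def scale3_Const)
qed (auto simp: vanishing_def)

lemma fin_dim_singular: "fin_dim (singular Y d)"
proof (rule fin_dim_subset[OF fin_dim_forms])
  show "poly3.subspace (singular Y d)"
    by (auto simp: poly3.subspace_def singular_def scale3_Const)
qed (auto simp: singular_def)

lemma vanishing_mult: "f \<in> vanishing Y a \<Longrightarrow> g \<in> vanishing Y b \<Longrightarrow> f * g \<in> singular Y (a + b)"
  by (auto simp: vanishing_def singular_def intro: forms_mult)

lemma vanishing_mult_form: "f \<in> vanishing Y a \<Longrightarrow> g \<in> forms b \<Longrightarrow> g * f \<in> vanishing Y (b + a)"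
  by (auto simp: vanishing_def intro: forms_mult)

lemma singular_mult_form: "f \<in> singular Y a \<Longrightarrow> g \<in> forms b \<Longrightarrow> f * g \<in> singular Y (a + b)"
  by (auto simp: singular_def intro: forms_mult)

lemma vanishing_add: "f \<in> vanishing Y d \<Longrightarrow> g \<in> vanishing Y d \<Longrightarrow> f + g \<in> vanishing Y d"
  and vanishing_diff: "f \<in> vanishing Y d \<Longrightarrow> g \<in> vanishing Y d \<Longrightarrow> f - g \<in> vanishing Y d"
  and vanishing_Const_mult: "f \<in> vanishing Y d \<Longrightarrow> Const c * f \<in> vanishing Y d"
  and vanishing_0: "0 \<in> vanishing Y d"
  by (auto simp: vanishing_def)

lemma singular_diff: "f \<in> singular Y d \<Longrightarrow> g \<in> singular Y d \<Longrightarrow> f - g \<in> singular Y d"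
  by (auto simp: singular_def)

lemma dir_deriv_singular: "f \<in> singular Y d \<Longrightarrow> dir_deriv w f \<in> vanishing Y (d - 1)"
  by (auto simp: vanishing_def singular_def intro: dir_deriv_forms[unfolded One_nat_def])

lemma vanishing_cancel:
  assumes "L * f \<in> vanishing Y e" "f \<in> forms d" "\<And>p. p \<in> Y \<Longrightarrow> eval3 L p \<noteq> 0"
  shows "f \<in> vanishing Y d"
  using assms by (auto simp: vanishing_def)

lemma singular_cancel:
  assumes "L * f \<in> singular Y e" "f \<in> forms d" "\<And>p. p \<in> Y \<Longrightarrow> eval3 L p \<noteq> 0"
  shows "f \<in> singular Y d"
  using assms by (auto simp: singular_def)

lemma dim_forms_le_vanishing:
  fixes Y :: "('k::field_char_0 ^ 3) set"
  assumes "finite Y"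
  shows "(d + 2) choose 2 \<le> poly3.dim (vanishing Y d) + card Y"
  using dim_functional_kernels_le[OF fin_dim_forms assms, of "\<lambda>p f. eval3 f p" d] functional_eval3
  by (auto simp: dim_forms vanishing_def)

lemma dim_le_mult:
  assumes "fin_dim V" "fin_dim W" "h \<noteq> 0" "\<And>f. f \<in> V \<Longrightarrow> h * f \<in> W"
  shows "poly3.dim V \<le> poly3.dim W"
  using dim_mult[OF assms(1,3)] dim_mono_fin[OF assms(2), of "(*) h ` V"] assms(4) by auto

lemma dim_eq_0D:
  assumes "fin_dim V" "poly3.dim V = 0" "v \<in> V"
  shows "v = 0"
proof -
  obtain B where "finite B" "poly3.span B = V" "card B = poly3.dim V"
    using fin_dim_basis[OF assms(1)] by metis
  then show ?thesis using assms by auto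
qed

lemma dim_pos_nonzero:
  assumes "0 < poly3.dim V" obtains v where "v \<in> V" "v \<noteq> 0"
proof -
  have "\<not> V \<subseteq> poly3.span {}" using poly3.dim_le_card[of V "{}"] assms by auto
  then show thesis using that by auto
qed

section \<open>Logarithmic derivatives at a singular point\<close>

text \<open>Along the line \<open>p + s v\<close> the quotient \<open>F\<^sub>v / F\<close> has a simple pole at \<open>s = 0\<close>, because in
  characteristic zero the derivative has order exactly one less than the function. If \<open>g\<close> has a
  double zero, the product \<open>a\<close> is therefore zero there.\<close>

lemma log_derivative_vanishes_aux:
  fixes F g a :: "'k::field_char_0 poly3"
  assumes rel: "g * dir_deriv v F = F * a" and F: "line_poly F p v \<noteq> 0" "eval3 F p = 0"
    and g: "eval3 g p = 0" "eval3 (dir_deriv v g) p = 0"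
  shows "eval3 a p = 0"
proof (rule ccontr)
  assume a: "eval3 a p \<noteq> 0"
  define f' g' a' where "f' = line_poly F p v" and "g' = line_poly g p v" and "a' = line_poly a p v"
  have e: "g' * pderiv f' = f' * a'"
    unfolding f'_def g'_def a'_def pderiv_line_poly line_poly_simps(6)[symmetric] rel ..
  have f0: "f' \<noteq> 0" "poly f' 0 = 0" and a0: "poly a' 0 \<noteq> 0"
    and g0: "poly g' 0 = 0" "poly (pderiv g') 0 = 0"
    using F g a by (auto simp: f'_def g'_def a'_def pderiv_line_poly poly_line_poly)
  have ne: "f' * a' \<noteq> 0" using f0 a0 by auto
  then have ne': "g' \<noteq> 0" "pderiv f' \<noteq> 0" using e by auto
  have "order 0 g' + order 0 (pderiv f') = order 0 f' + order 0 a'"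
    using ne e by (metis order_mult)
  moreover have "order 0 a' = 0" using a0 by (rule order_0I)
  moreover have "order 0 f' = Suc (order 0 (pderiv f'))" using f0 by (rule order_pderiv)
  ultimately have "order 0 g' = 1" by simp
  moreover have "order 0 g' = Suc (order 0 (pderiv g'))" using ne'(1) g0(1) by (rule order_pderiv)
  ultimately have "pderiv g' = 0" using g0(2) by (metis One_nat_def nat.inject order_root)
  then obtain c where "g' = [:c:]" using pderiv_iszero by blast
  then show False using g0(1) ne'(1) by simp
qed

text \<open>The restriction to the line of direction \<open>v\<close> is informative only if \<open>F\<close> does not vanish on that line.
  If this holds for one direction \<open>v\<^sub>0\<close>, it holds for \<open>v\<^sub>0 + c v\<close> with some \<open>c \<noteq> 0\<close>, and linearity of
  \<open>a\<close> in the direction gives the claim for \<open>v\<close> itself.\<close>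

lemma log_derivative_vanishes:
  fixes F g :: "'k::field_char_0 poly3"
  assumes rel: "\<And>v. v \<in> U \<Longrightarrow> g * dir_deriv v F = F * a v"
    and lin: "\<And>v c. v \<in> U \<Longrightarrow> v0 + c *s v \<in> U \<and> eval3 (a (v0 + c *s v)) p = eval3 (a v0) p + c * eval3 (a v) p"
    and v0: "v0 \<in> U" "line_poly F p v0 \<noteq> 0" and F: "eval3 F p = 0"
    and g: "eval3 g p = 0" "\<And>v. eval3 (dir_deriv v g) p = 0"
    and v: "v \<in> U"
  shows "eval3 (a v) p = 0"
proof -
  obtain s where s: "eval3 F (p + s *s v0) \<noteq> 0"
    using v0(2) poly_all_0_iff_0[of "line_poly F p v0"] by (auto simp: poly_line_poly)
  define q where "q = line_poly F (p + s *s v0) (s *s v)"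
  have "poly q 0 \<noteq> 0" using s by (simp add: q_def poly_line_poly)
  then have "q \<noteq> 0" by auto
  then have "finite (insert 0 {c. poly q c = 0})" using poly_roots_finite[of q] by simp
  then obtain c where c: "c \<noteq> 0" "poly q c \<noteq> 0"
    using ex_new_if_finite[OF infinite_UNIV_char_0] by blast
  have e: "p + s *s v0 + c *s (s *s v) = p + s *s (v0 + c *s v)"
    by (simp add: vec_eq_iff algebra_simps)
  have "poly (line_poly F p (v0 + c *s v)) s \<noteq> 0" using c(2) unfolding q_def poly_line_poly e .
  then have "line_poly F p (v0 + c *s v) \<noteq> 0" by auto
  then have "eval3 (a (v0 + c *s v)) p = 0"
    using log_derivative_vanishes_aux[OF rel _ F g(1) g(2)] lin[OF v] by blast
  moreover have "eval3 (a v0) p = 0"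
    using log_derivative_vanishes_aux[OF rel[OF v0(1)] v0(2) F g(1) g(2)] .
  ultimately show ?thesis using lin[OF v, of c] c(1) by simp
qed

text \<open>Logarithmic differentiation of \<open>g\<^sup>2 = F A\<close> gives \<open>2 g\<^sub>v / g = F\<^sub>v / F + A\<^sub>v / A\<close>. Hence, with
  \<open>a = g F\<^sub>v / F\<close>, the form \<open>2 g\<^sub>v - a\<close> is \<open>g A\<^sub>v / A\<close>.\<close>

lemma square_root_derivative:
  fixes F g A a :: "'k::field_char_0 poly3"
  assumes gg: "g * g = F * A" and rel: "g * dir_deriv v F = F * a" and ne: "F \<noteq> 0" "g \<noteq> 0"
  shows "A * (dir_deriv v g + dir_deriv v g - a) = g * dir_deriv v A" "g * (dir_deriv v g + dir_deriv v g - a) = F * dir_deriv v A"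
proof -
  have e: "dir_deriv v g * g + g * dir_deriv v g = dir_deriv v F * A + F * dir_deriv v A"
    using arg_cong[OF gg, of "dir_deriv v"] by simp
  have "F * (A * (dir_deriv v g + dir_deriv v g - a)) = g * (dir_deriv v g * g + g * dir_deriv v g) - F * a * A"
    using gg by algebra
  also have "\<dots> = F * (g * dir_deriv v A)"
    unfolding e rel[symmetric] by (simp add: algebra_simps)
  finally show 1: "A * (dir_deriv v g + dir_deriv v g - a) = g * dir_deriv v A" using ne by simp
  have "g * (g * (dir_deriv v g + dir_deriv v g - a)) = F * (A * (dir_deriv v g + dir_deriv v g - a))"
    using gg by (simp add: mult.assoc[symmetric])
  also have "\<dots> = g * (F * dir_deriv v A)" unfolding 1 by (rule mult.left_commute)
  finally show "g * (dir_deriv v g + dir_deriv v g - a) = F * dir_deriv v A" using ne by simp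
qed

text \<open>If \<open>g\<close> is smooth at \<open>p\<close>, then \<open>F A\<^sub>v\<close> has a double zero and \<open>g\<close> a simple one, so that the
  cofactor \<open>2 g\<^sub>v - a\<close> of \<open>g\<close> vanishes at \<open>p\<close>. If \<open>g\<close> is singular at \<open>p\<close>, then both \<open>g\<^sub>v\<close> and \<open>a\<close>
  vanish there.\<close>

lemma square_root_derivative_vanishes:
  fixes F g A :: "'k::field_char_0 poly3"
  assumes gg: "g * g = F * A" and ne: "F \<noteq> 0" "g \<noteq> 0"
    and rel: "\<And>v. v \<in> U \<Longrightarrow> g * dir_deriv v F = F * a v"
    and lin: "\<And>v c. v \<in> U \<Longrightarrow> v0 + c *s v \<in> U \<and> eval3 (a (v0 + c *s v)) p = eval3 (a v0) p + c * eval3 (a v) p"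
    and v0: "v0 \<in> U" "line_poly F p v0 \<noteq> 0"
    and F: "eval3 F p = 0" "\<And>v. eval3 (dir_deriv v F) p = 0" and g: "eval3 g p = 0"
    and v: "v \<in> U"
  shows "eval3 (dir_deriv v g + dir_deriv v g - a v) p = 0"
proof (cases "\<forall>w. eval3 (dir_deriv w g) p = 0")
  case True
  then show ?thesis using log_derivative_vanishes[OF rel lin v0 F(1) g _ v] by simp
next
  case False
  then obtain w where w: "eval3 (dir_deriv w g) p \<noteq> 0" by blast
  have "g * (dir_deriv v g + dir_deriv v g - a v) = F * dir_deriv v A"
    by (rule square_root_derivative(2)[OF gg rel[OF v] ne])
  then have "eval3 (dir_deriv w (g * (dir_deriv v g + dir_deriv v g - a v))) p = eval3 (dir_deriv w (F * dir_deriv v A)) p" by simp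
  then have "eval3 (dir_deriv w g) p * eval3 (dir_deriv v g + dir_deriv v g - a v) p = 0"
    unfolding dir_deriv_mult eval3_simps(3,6) F g by simp
  then show ?thesis using w by simp
qed

section \<open>The curve of degree t + 1\<close>

lemma double_choose_two: "2 * (n choose 2) = n * (n - 1)"
proof -
  have "even (n * (n - 1))" by (cases n) auto
  then show ?thesis by (simp add: choose_two)
qed

lemma choose_two_Suc: "(Suc n choose 2) = (n choose 2) + n"
  by (simp add: numeral_2_eq_2)

text \<open>The set \<open>Y\<close> contains one vector for each of the points. In degree \<open>j\<close> the assumed dimension is that of
  the multiples of a form of degree \<open>t + 1\<close>, and truncated subtraction makes it zero for \<open>j \<le> t\<close>.
  For \<open>j = 2 t - 1\<close> it is the smallest dimension that \<open>3 |Y|\<close> conditions can leave.\<close>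

locale extremal_points =
  fixes t :: nat and Y :: "('k::{alg_closed_field, field_char_0} ^ 3) set"
  assumes t: "t \<ge> 3" and finY: "finite Y" and cardY: "card Y = (t + 1) choose 2"
    and dim_singular: "\<And>j. j < 2 * t \<Longrightarrow> poly3.dim (singular Y j) = (j + 1 - t) choose 2"
begin

lemma Y_nonempty: "Y \<noteq> {}"
proof -
  have "2 * card Y = (t + 1) * t" using double_choose_two[of "t + 1"] by (simp add: cardY)
  then have "card Y \<noteq> 0" using t by (intro notI) simp
  then show ?thesis by auto
qed

lemma singular_low:
  assumes "G \<in> singular Y j" "j \<le> t" shows "G = 0"
proof (rule dim_eq_0D[OF fin_dim_singular _ assms(1)])
  have "j + 1 - t < 2" using assms t by simp
  then show "poly3.dim (singular Y j) = 0" using dim_singular[of j] assms(2) t by simp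
qed

lemma curve_exists: obtains F where "F \<in> singular Y (t + 1)" "F \<noteq> 0"
proof (rule dim_pos_nonzero)
  show "0 < poly3.dim (singular Y (t + 1))" using dim_singular[of "t + 1"] t by simp
qed (rule that)

end

locale extremal_curve = extremal_points t Y
  for t and Y :: "('k::{alg_closed_field, field_char_0} ^ 3) set" +
  fixes F :: "'k poly3"
  assumes F: "F \<in> singular Y (t + 1)" and F0: "F \<noteq> 0"
begin

text \<open>The multiples of \<open>F\<close> already have the required dimension.\<close>

lemma singular_multiple:
  assumes G: "G \<in> singular Y j" and j: "j < 2 * t"
  obtains K where "K \<in> forms (j - (t + 1))" "G = F * K"
proof (cases "j \<le> t")
  case True
  then show thesis using that[of 0] singular_low[OF G] by simp
next
  case False
  have "(*) F ` forms (j - (t + 1)) = singular Y j"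
  proof (rule subspace_eq_of_dim[OF fin_dim_singular])
    show "poly3.subspace ((*) F ` forms (j - (t + 1)))"
      by (intro fin_dim_subspace fin_dim_mult fin_dim_forms)
    show "(*) F ` forms (j - (t + 1)) \<subseteq> singular Y j"
      using singular_mult_form[OF F, of _ "j - (t + 1)"] False by auto
    have "j - (t + 1) + 2 = j + 1 - t" using False by simp
    then show "poly3.dim (singular Y j) \<le> poly3.dim ((*) F ` forms (j - (t + 1)))"
      using dim_singular[OF j] by (simp add: dim_mult[OF fin_dim_forms F0] dim_forms)
  qed
  then show thesis using G that by blast
qed

lemma F_at: "p \<in> Y \<Longrightarrow> eval3 F p = 0" "p \<in> Y \<Longrightarrow> eval3 (dir_deriv w F) p = 0"
  using singularD[OF F] by auto

lemma dir_deriv_F: "dir_deriv w F \<in> vanishing Y t"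
  using dir_deriv_singular[OF F] by simp

text \<open>Let \<open>g\<close> be a nonzero form of least degree \<open>e\<close> vanishing on \<open>Y\<close>. The forms \<open>g\<^sup>2\<close> and \<open>g F\<^sub>v\<close> are
  singular along \<open>Y\<close> and of degree less than \<open>2 t\<close>, hence equal to \<open>F A\<close> and \<open>F b\<^sub>v\<close>. The form
  \<open>2 g\<^sub>v - b\<^sub>v\<close> vanishes on \<open>Y\<close> and has degree \<open>e - 1\<close>, so it is zero by the choice of \<open>g\<close>. But
  it equals \<open>g A\<^sub>v / A\<close>, so \<open>A\<close> is constant and \<open>2 e = t + 1\<close>. Multiplying by \<open>g\<close> now embeds the forms of
  degree \<open>2 t - 1 - e\<close> that vanish on \<open>Y\<close> into the singular forms of degree \<open>2 t - 1\<close>, and the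
  dimensions contradict this.\<close>

theorem vanishing_low:
  assumes "G \<in> vanishing Y j" "j < t" shows "G = 0"
proof (rule ccontr)
  assume "G \<noteq> 0"
  then have ex: "\<exists>G. G \<in> vanishing Y j \<and> G \<noteq> 0" using assms by blast
  define e where "e = (LEAST e. \<exists>G. G \<in> vanishing Y e \<and> G \<noteq> 0)"
  have "\<exists>G. G \<in> vanishing Y e \<and> G \<noteq> 0"
    unfolding e_def by (rule LeastI[of "\<lambda>e. \<exists>G. G \<in> vanishing Y e \<and> G \<noteq> 0", OF ex])
  then obtain g where g: "g \<in> vanishing Y e" "g \<noteq> 0" by blast
  have "e \<le> j" unfolding e_def by (rule Least_le[of "\<lambda>e. \<exists>G. G \<in> vanishing Y e \<and> G \<noteq> 0", OF ex])
  then have et: "e < t" using assms by simp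
  have min: "G' = 0" if "G' \<in> vanishing Y e'" "e' < e" for G' e'
    using not_less_Least[of e' "\<lambda>e. \<exists>G. G \<in> vanishing Y e \<and> G \<noteq> 0"] that unfolding e_def by blast
  have e0: "e \<noteq> 0"
  proof
    assume "e = 0"
    then obtain c where "g = Const c" using vanishingD(1)[OF g(1)] forms_0E by auto
    then show False using g Y_nonempty vanishingD(2)[OF g(1)] by auto
  qed
  have "\<exists>a. \<forall>i. a i \<in> forms (e - 1) \<and> g * dir_deriv (axis i 1) F = F * a i"
  proof (rule choice, rule allI)
    fix i :: 3
    have "g * dir_deriv (axis i 1) F \<in> singular Y (e + t)" using vanishing_mult[OF g(1) dir_deriv_F] .
    moreover have "e + t < 2 * t" using et by simp
    ultimately obtain K where "K \<in> forms (e + t - (t + 1))" "g * dir_deriv (axis i 1) F = F * K"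
      by (rule singular_multiple)
    then show "\<exists>a. a \<in> forms (e - 1) \<and> g * dir_deriv (axis i 1) F = F * a" using e0 by auto
  qed
  then obtain a where a: "\<And>i. a i \<in> forms (e - 1)" "\<And>i. g * dir_deriv (axis i 1) F = F * a i" by blast
  define b where "b v = (\<Sum>i\<in>UNIV. Const (v $ i) * a i)" for v
  have b: "b v \<in> forms (e - 1)" "g * dir_deriv v F = F * b v" for v
  proof -
    show "b v \<in> forms (e - 1)" unfolding b_def using a by blast
    show "g * dir_deriv v F = F * b v"
      unfolding b_def dir_deriv_eq_sum[of v F] sum_distrib_left mult.left_commute[of _ "Const _"] a ..
  qed
  have sq: "g * g \<in> singular Y (e + e)" using vanishing_mult[OF g(1) g(1)] .
  have "e + e < 2 * t" using et by simp
  with sq obtain A where A: "A \<in> forms (e + e - (t + 1))" "g * g = F * A" by (rule singular_multiple)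
  have A0: "A \<noteq> 0" using A g by auto
  have dA: "dir_deriv v A = 0" for v
  proof -
    have "dir_deriv v g + dir_deriv v g - b v \<in> vanishing Y (e - 1)"
      unfolding vanishing_def
    proof (intro CollectI conjI ballI)
      show "dir_deriv v g + dir_deriv v g - b v \<in> forms (e - 1)"
        using b dir_deriv_forms[OF vanishingD(1)[OF g(1)]] by blast
      fix p assume p: "p \<in> Y"
      obtain x where x: "eval3 F x \<noteq> 0"
        using form_eq_0_if_eval3_0[OF singularD(1)[OF F]] F0 by blast
      show "eval3 (dir_deriv v g + dir_deriv v g - b v) p = 0"
      \<comment> \<open>\<open>F\<close> does not vanish on the line from \<open>p\<close> to the point \<open>x\<close> off the curve.\<close>
      proof (rule square_root_derivative_vanishes[OF A(2) F0 g(2) b(2), where U = UNIV and ?v0.0 = "x - p"])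
        show "x - p + c *s v \<in> UNIV \<and> eval3 (b (x - p + c *s v)) p = eval3 (b (x - p)) p + c * eval3 (b v) p" for v c
          by (simp add: b_def algebra_simps sum.distrib sum_distrib_left sum_subtractf)
        have "poly (line_poly F p (x - p)) 1 \<noteq> 0" using x by (simp add: poly_line_poly)
        then show "line_poly F p (x - p) \<noteq> 0" by auto
      qed (use p F_at vanishingD(2)[OF g(1)] in auto)
    qed
    then have "dir_deriv v g + dir_deriv v g - b v = 0" using min e0 by (metis diff_less less_one neq0_conv)
    then show ?thesis using square_root_derivative(1)[OF A(2) b(2) F0 g(2), of v] g by simp
  qed
  have "e + e = t + 1"
  proof -
    have "e + e - (t + 1) = 0"
    proof (rule ccontr)
      assume "e + e - (t + 1) \<noteq> 0"
      then have "(of_nat (e + e - (t + 1)) :: 'k) \<noteq> 0" by (simp only: of_nat_eq_0_iff not_False_eq_True)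
      moreover have "of_nat (e + e - (t + 1)) * eval3 A v = 0" for v
        using eval3_euler[OF A(1), of v] by (simp only: dA eval3_simps(1))
      ultimately have "eval3 A v = 0" for v by (simp only: mult_eq_0_iff simp_thms)
      then show False using form_eq_0_if_eval3_0[OF A(1)] A0 by blast
    qed
    moreover have "\<not> e + e \<le> t" using singular_low[OF sq] g by auto
    ultimately show ?thesis by simp
  qed
  \<comment> \<open>The shift makes all subtractions below exact.\<close>
  then obtain r where r: "e = r + 2" "t = 2 * r + 3"
    using t that[of "e - 2"] by (simp add: nat_eq_iff) 
  have "2 * t - 1 - e + e = 2 * t - 1" using r by simp
  then have "poly3.dim (vanishing Y (2 * t - 1 - e)) \<le> poly3.dim (singular Y (2 * t - 1))"
    using vanishing_mult[OF _ g(1), of _ "2 * t - 1 - e"]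
    by (intro dim_le_mult[OF fin_dim_vanishing fin_dim_singular g(2)]) (simp add: mult.commute)
  also have "\<dots> = t choose 2" using dim_singular[of "2 * t - 1"] t by simp
  finally have *: "(2 * t - 1 - e + 2) choose 2 \<le> (t choose 2) + (t + 1 choose 2)"
    using dim_forms_le_vanishing[OF finY, of "2 * t - 1 - e"] cardY by linarith
  have n: "3 * r + 5 = 2 * t - 1 - e + 2" "2 * r + 3 = t" "2 * r + 4 = t + 1" using r by auto
  have "2 * ((3 * r + 5) choose 2) \<le> 2 * ((2 * r + 3) choose 2) + 2 * ((2 * r + 4) choose 2)"
    unfolding n using * by linarith
  then show False unfolding double_choose_two by (simp add: algebra_simps)
qed

lemma dim_vanishing_t: "poly3.dim (vanishing Y t) \<ge> t + 1"
proof -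
  have "(t + 2) choose 2 = (t + 1 choose 2) + (t + 1)" by (simp add: numeral_2_eq_2)
  then show ?thesis using dim_forms_le_vanishing[OF finY, of t] cardY by simp
qed

end

section \<open>Restriction to a general line\<close>

lemma card_roots_rsquarefree:
  fixes p :: "'k::{alg_closed_field, field_char_0} poly"
  assumes "rsquarefree p"
  shows "card {x. poly p x = 0} = degree p"
  using assms
proof (induction "degree p" arbitrary: p)
  case 0
  then obtain c where "p = [:c:]" "c \<noteq> 0" by (metis degree_eq_zeroE pCons_0_0 rsquarefree_def)
  then show ?case by simp
next
  case (Suc n)
  then obtain a where "poly p a = 0" using alg_closed_imp_poly_has_root[of p] by auto
  then obtain q where q: "p = [:- a, 1:] * q" by (auto simp: poly_eq_0_iff_dvd dvd_def)
  have p0: "p \<noteq> 0" using Suc.prems by (simp add: rsquarefree_def)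
  then have q0: "q \<noteq> 0" using q by auto
  have dq: "degree p = Suc (degree q)" unfolding q using q0 by (subst degree_mult_eq) auto
  have pd: "poly (pderiv p) x = poly q x + (x - a) * poly (pderiv q) x" for x
    unfolding q pderiv_mult by (simp add: pderiv_pCons algebra_simps)
  have pp: "poly p x = (x - a) * poly q x" for x
    unfolding q by (simp add: algebra_simps)
  have "rsquarefree q"
    using Suc.prems unfolding rsquarefree_roots pp pd by auto
  then have "card {x. poly q x = 0} = degree q" using Suc(1)[of q] Suc(2) dq by simp
  moreover have "poly q a \<noteq> 0" using Suc.prems pd[of a] \<open>poly p a = 0\<close> unfolding rsquarefree_roots by auto
  moreover have "{x. poly p x = 0} = insert a {x. poly q x = 0}" by (auto simp: pp)
  moreover have "finite {x. poly q x = 0}" using q0 by (rule poly_roots_finite)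
  ultimately show ?case using dq by simp
qed

text \<open>A line that misses \<open>Y\<close>, with \<open>w\<close> off the curve, so that all \<open>t + 1\<close> zeros of \<open>F\<close> on the line are at
  finite values of \<open>s\<close>.\<close>

locale extremal_line = extremal_curve t Y F
  for t and Y :: "('k::{alg_closed_field, field_char_0} ^ 3) set" and F +
  fixes u w m :: "'k ^ 3" and A B L :: "'k poly3"
  assumes fr: "frame u w m A B L" and L_off: "\<And>p. p \<in> Y \<Longrightarrow> eval3 L p \<noteq> 0" and Fw: "eval3 F w \<noteq> 0"
begin

abbreviation r :: "'k poly3 \<Rightarrow> 'k poly" where "r f \<equiv> line_poly f u w"

lemma frame_facts: "A \<in> forms 1" "B \<in> forms 1" "L \<in> forms 1"
  "Var i = Const (u $ i) * A + Const (w $ i) * B + Const (m $ i) * L"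
  "eval3 A u = 1" "eval3 A w = 0" "eval3 B u = 0" "eval3 B w = 1" "eval3 L u = 0" "eval3 L w = 0" "eval3 L m = 1"
  using fr by (auto simp: frame_def)

lemma r_frame: "r A = [:1:]" "r B = [:0, 1:]" "r L = 0"
  using frame_line_poly[OF fr] by auto

lemma L0: "L \<noteq> 0" using frame_facts(11) by auto

lemma restrict_0_vanishing:
  assumes "G \<in> vanishing Y' (Suc j)" "r G = 0" "Y' \<subseteq> Y"
  obtains G' where "G' \<in> vanishing Y' j" "G = L * G'"
proof -
  obtain G' where G': "G' \<in> forms (Suc j - 1)" "G = L * G'"
    using frame_factor[OF fr vanishingD(1)[OF assms(1)] assms(2)] by blast
  then have "G' \<in> vanishing Y' j"
    using assms by (intro vanishing_cancel[of L G' Y' "Suc j"]) (auto simp: L_off)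
  then show thesis using G' that by blast
qed

lemma restrict_inj:
  assumes "G \<in> vanishing Y t" "r G = 0" shows "G = 0"
proof -
  have "G \<in> vanishing Y (Suc (t - 1))" using assms(1) t by simp
  then obtain G' where G': "G' \<in> vanishing Y (t - 1)" "G = L * G'"
    by (rule restrict_0_vanishing[OF _ assms(2) order_refl])
  have "G' = 0" using vanishing_low[OF G'(1)] t by simp
  then show ?thesis using G' by simp
qed

text \<open>Restriction is injective, and there are at least \<open>t + 1\<close> independent forms. For \<open>p \<noteq> 0\<close> the condition
  that the restriction be proportional to \<open>p\<close> amounts to \<open>t\<close> linear equations, which leave a nonzero
  form.\<close>

lemma restrict_surj_t:
  assumes p: "degree p \<le> t"
  obtains G where "G \<in> vanishing Y t" "r G = p"
proof (cases "p = 0")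
  case True
  then show thesis using that[OF vanishing_0] by simp
next
  case False
  define k where "k = degree p"
  have k: "coeff p k \<noteq> 0" "k \<le> t" using False p by (auto simp: k_def)
  define \<phi> where "\<phi> i G = coeff p k * coeff (r G) i - coeff p i * coeff (r G) k" for i G
  have lin: "functional (\<phi> i)" for i
    by (auto simp: functional_def \<phi>_def algebra_simps)
  have "poly3.dim (vanishing Y t) \<le> poly3.dim {G \<in> vanishing Y t. \<forall>i\<in>{..t} - {k}. \<phi> i G = 0} + card ({..t} - {k})"
    by (rule dim_functional_kernels_le[OF fin_dim_vanishing]) (auto intro: lin)
  moreover have "card ({..t} - {k}) = t" using k by simp
  ultimately have "0 < poly3.dim {G \<in> vanishing Y t. \<forall>i\<in>{..t} - {k}. \<phi> i G = 0}"
    using dim_vanishing_t by simp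
  then obtain G where G: "G \<in> vanishing Y t" "\<forall>i\<in>{..t} - {k}. \<phi> i G = 0" "G \<noteq> 0"
    by (auto elim: dim_pos_nonzero)
  define c where "c = coeff (r G) k / coeff p k"
  have rG: "r G = smult c p"
  proof (rule poly_eqI)
    fix i
    show "coeff (r G) i = coeff (smult c p) i"
    proof (cases "i \<le> t")
      case True
      then have "\<phi> i G = 0" using G by (cases "i = k") (auto simp: \<phi>_def)
      then show ?thesis using k by (simp add: \<phi>_def c_def field_simps)
    next
      case False
      then show ?thesis
        using p degree_line_poly[OF vanishingD(1)[OF G(1)], of u w] by (simp add: coeff_eq_0)
    qed
  qed
  then have "c \<noteq> 0" using restrict_inj[OF G(1)] G(3) by auto
  then show thesis
    using that[OF vanishing_Const_mult[OF G(1), of "1 / c"]] by (simp add: rG)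
qed

text \<open>On restrictions \<open>A\<close> and \<open>B\<close> act as multiplication by \<open>1\<close> and by \<open>s\<close>, so surjectivity in degree \<open>t\<close>
  implies surjectivity in all higher degrees.\<close>

lemma restrict_surj:
  assumes "degree p \<le> j" "t \<le> j"
  obtains G where "G \<in> vanishing Y j" "r G = p"
proof -
  have "\<forall>p. degree p \<le> j \<longrightarrow> (\<exists>G\<in>vanishing Y j. r G = p)"
    using assms(2)
  proof (induction j rule: dec_induct)
    case base
    then show ?case using restrict_surj_t by metis
  next
    case (step j)
    show ?case
    proof (intro allI impI)
      fix p :: "'k poly" assume p: "degree p \<le> Suc j"
      obtain a q where aq: "p = pCons a q" by (cases p)
      then have "degree q \<le> j" using p by (cases "q = 0") auto
      then obtain G1 where G1: "G1 \<in> vanishing Y j" "r G1 = q" using step.IH by blast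
      have "degree [:a:] \<le> j" by simp
      then obtain G0 where G0: "G0 \<in> vanishing Y j" "r G0 = [:a:]" using step.IH by blast
      have "A * G0 + B * G1 \<in> vanishing Y (Suc j)"
        using vanishing_mult_form[OF G0(1) frame_facts(1)] vanishing_mult_form[OF G1(1) frame_facts(2)]
        by (intro vanishing_add) auto
      moreover have "r (A * G0 + B * G1) = p" using G0 G1 by (simp add: aq r_frame)
      ultimately show "\<exists>G\<in>vanishing Y (Suc j). r G = p" by blast
    qed
  qed
  then show thesis using assms(1) that by blast
qed

lemma degree_rF: "degree (r F) = t + 1"
proof (rule antisym)
  show "degree (r F) \<le> t + 1" by (rule degree_line_poly[OF singularD(1)[OF F]])
  have "coeff (r F) (t + 1) \<noteq> 0" using coeff_line_poly_top[OF singularD(1)[OF F]] Fw by simp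
  then show "t + 1 \<le> degree (r F)" by (rule le_degree)
qed

lemma rF0: "r F \<noteq> 0" using degree_rF by auto

text \<open>Lift the quotient on the line to a form \<open>K\<^sub>0\<close>. Then \<open>H - F K\<^sub>0\<close> vanishes on the line, and since the line
  misses \<open>Y\<close>, dividing by \<open>L\<close> leaves a singular form of degree \<open>2 t - 1\<close>, which is a multiple of \<open>F\<close>.\<close>

lemma divisible_if_restriction_divisible:
  assumes H: "H \<in> singular Y (2 * t)" and dvd: "r F dvd r H"
  obtains K where "K \<in> forms (t - 1)" "H = F * K"
proof -
  obtain k where k: "r H = r F * k" using dvd by blast
  have "degree k \<le> t - 1"
  proof (cases "k = 0")
    case False
    then have "degree (r H) = t + 1 + degree k" unfolding k using rF0 by (simp add: degree_mult_eq degree_rF)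
    moreover have "degree (r H) \<le> 2 * t" by (rule degree_line_poly[OF singularD(1)[OF H]])
    ultimately show ?thesis by simp
  qed simp
  then obtain K0 where K0: "K0 \<in> forms (t - 1)" "r K0 = k" by (rule frame_lift[OF fr])
  have "F * K0 \<in> singular Y (2 * t)" using singular_mult_form[OF F K0(1)] t by (simp add: mult_2)
  then have D: "H - F * K0 \<in> singular Y (2 * t)" using H by (rule singular_diff[rotated])
  moreover have "r (H - F * K0) = 0" using k K0 by simp
  ultimately obtain Q where Q: "Q \<in> forms (2 * t - 1)" "H - F * K0 = L * Q"
    using frame_factor[OF fr singularD(1)[OF D]] by blast
  then have "Q \<in> singular Y (2 * t - 1)" using D L_off by (intro singular_cancel[of L Q Y "2 * t"]) auto
  moreover have "2 * t - 1 < 2 * t" using t by simp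
  ultimately obtain K1 where K1: "K1 \<in> forms (2 * t - 1 - (t + 1))" "Q = F * K1" by (rule singular_multiple)
  have "1 + (2 * t - 1 - (t + 1)) = t - 1" using t by simp
  then have "L * K1 \<in> forms (t - 1)" using forms_mult[OF frame_facts(3) K1(1)] by (simp only:)
  moreover have "H = F * (K0 + L * K1)" using Q(2) K1(2) by (simp add: algebra_simps)
  ultimately show thesis using that[of "K0 + L * K1"] K0 by blast
qed

lemma vanishing_product_divisible:
  assumes "g \<in> vanishing Y t" "h \<in> vanishing Y t" "r F dvd r g * r h"
  obtains K where "K \<in> forms (t - 1)" "g * h = F * K"
  using divisible_if_restriction_divisible[of "g * h"] vanishing_mult[OF assms(1,2)] assms(3)
  by (auto simp: mult_2)

text \<open>Suppose \<open>F\<close> has a double zero \<open>\<phi>\<close> on the line. Divide its restriction by \<open>s - \<phi>\<close> once and lift the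
  result \<open>p\<^sub>0\<close> to a form \<open>g\<close> vanishing on \<open>Y\<close>. As \<open>p\<^sub>0\<close> still contains the factor \<open>s - \<phi>\<close>, the product
  \<open>g\<^sup>2\<close> is a multiple \<open>F Q\<close>; and so is \<open>g F\<^sub>v\<close> for each direction \<open>v\<close> along the line, because \<open>F\<^sub>v\<close>
  also vanishes at \<open>\<phi>\<close>. The form \<open>g Q\<^sub>v / Q\<close> of degree \<open>t - 1\<close> vanishes on \<open>Y\<close>, so it is zero.
  Thus \<open>Q\<close> has no derivatives along the line and, having positive degree, vanishes on the line. But
  there \<open>g\<^sup>2 = F Q\<close> is not zero.\<close>

theorem restriction_squarefree: "rsquarefree (r F)"
  unfolding rsquarefree_roots
proof (intro allI notI)
  fix \<phi> assume \<phi>: "poly (r F) \<phi> = 0 \<and> poly (pderiv (r F)) \<phi> = 0"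
  then obtain p0 where p0: "r F = [:- \<phi>, 1:] * p0" by (auto simp: poly_eq_0_iff_dvd dvd_def)
  have "poly (pderiv (r F)) \<phi> = poly p0 \<phi>"
    unfolding p0 pderiv_mult by (simp add: pderiv_pCons)
  then obtain k where k: "p0 = [:- \<phi>, 1:] * k" using \<phi> by (auto simp: poly_eq_0_iff_dvd dvd_def)
  have p00: "p0 \<noteq> 0" using rF0 p0 by auto
  have "degree (r F) = Suc (degree p0)" unfolding p0 using p00 by (subst degree_mult_eq) auto
  then have "degree p0 \<le> t" using degree_rF by simp
  then obtain g where g: "g \<in> vanishing Y t" "r g = p0" by (rule restrict_surj_t)
  have g0: "g \<noteq> 0" using g p00 by auto
  have "p0 * p0 = p0 * ([:- \<phi>, 1:] * k)" by (simp only: k[symmetric])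
  also have "\<dots> = r F * k" unfolding p0 by (rule trans[OF mult.left_commute mult.assoc[symmetric]])
  finally have "r F dvd r g * r g" unfolding g by (rule dvdI)
  then obtain Q where Q: "Q \<in> forms (t - 1)" "g * g = F * Q"
    by (rule vanishing_product_divisible[OF g(1) g(1)])
  define x where "x = u + \<phi> *s w"
  have ww: "eval3 (dir_deriv w F) x = 0" using \<phi> by (simp add: x_def pderiv_line_poly poly_line_poly)
  have "eval3 (dir_deriv x F) x = 0"
    using eval3_euler[OF singularD(1)[OF F], of x] \<phi> by (simp add: x_def poly_line_poly)
  then have uu: "eval3 (dir_deriv u F) x = 0"
    using ww by (simp add: x_def dir_deriv_add_dir dir_deriv_scale_dir)
  have "\<exists>K. K \<in> forms (t - 1) \<and> g * dir_deriv v F = F * K" if "eval3 (dir_deriv v F) x = 0" for v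
  proof -
    have "poly (r (dir_deriv v F)) \<phi> = 0" using that by (simp add: poly_line_poly x_def)
    then have "[:- \<phi>, 1:] dvd r (dir_deriv v F)" by (simp add: poly_eq_0_iff_dvd)
    then have "r F dvd r g * r (dir_deriv v F)" unfolding g p0
      by (subst mult.commute[of p0]) (rule mult_dvd_mono[OF _ dvd_refl])
    then show ?thesis using vanishing_product_divisible[OF g(1) dir_deriv_F, of v] by metis
  qed
  then obtain au aw where au: "au \<in> forms (t - 1)" "g * dir_deriv u F = F * au"
    and aw: "aw \<in> forms (t - 1)" "g * dir_deriv w F = F * aw" using uu ww by metis
  define U where "U = {v. eval3 L v = 0}"
  define a where "a v = Const (eval3 A v) * au + Const (eval3 B v) * aw" for v
  have rel: "g * dir_deriv v F = F * a v" if "v \<in> U" for v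
  proof -
    have "dir_deriv v F = Const (eval3 A v) * dir_deriv u F + Const (eval3 B v) * dir_deriv w F"
      using frame_direction[OF fr, of v] that unfolding U_def by (metis dir_deriv_add_dir dir_deriv_scale_dir mem_Collect_eq)
    then have "g * dir_deriv v F = Const (eval3 A v) * (g * dir_deriv u F) + Const (eval3 B v) * (g * dir_deriv w F)"
      by (simp add: algebra_simps)
    then show ?thesis unfolding au aw a_def by (simp add: algebra_simps)
  qed
  have dQ: "dir_deriv v Q = 0" if v: "v \<in> U" for v
  proof -
    have "dir_deriv v g + dir_deriv v g - a v \<in> vanishing Y (t - 1)"
      unfolding vanishing_def
    proof (intro CollectI conjI ballI)
      show "dir_deriv v g + dir_deriv v g - a v \<in> forms (t - 1)"
        unfolding a_def using au aw dir_deriv_forms[OF vanishingD(1)[OF g(1)]] by blast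
      fix p assume p: "p \<in> Y"
      have "F * L \<noteq> 0" using F0 L0 by simp
      then obtain x where x: "eval3 F x \<noteq> 0" "eval3 L x \<noteq> 0"
        using form_eq_0_if_eval3_0[OF forms_mult[OF singularD(1)[OF F] frame_facts(3)]] by auto
      define c where "c = eval3 L p / eval3 L x"
      have c: "c \<noteq> 0" using x L_off[OF p] by (simp add: c_def)
      have "eval3 L (c *s x + (- 1) *s p) = c * eval3 L x - eval3 L p"
        using eval3_homogeneous[OF frame_facts(3), of c x] by (simp only: linear_form_add[OF frame_facts(3)]) simp
      \<comment> \<open>A direction along the line, leading from \<open>p\<close> to the multiple \<open>c x\<close> of a point off the curve.\<close>
      moreover define x0 where "x0 = c *s x - p"
      ultimately have inU: "x0 \<in> U" using x by (simp add: U_def c_def x0_def)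
      show "eval3 (dir_deriv v g + dir_deriv v g - a v) p = 0"
      proof (rule square_root_derivative_vanishes[OF Q(2) F0 g0 rel _ inU])
        show "x0 + b *s v \<in> U \<and> eval3 (a (x0 + b *s v)) p = eval3 (a x0) p + b * eval3 (a v) p"
          if "v \<in> U" for v b
          using that inU unfolding U_def a_def
          by (simp add: linear_form_add[OF frame_facts(1)] linear_form_add[OF frame_facts(2)] linear_form_add[OF frame_facts(3)] algebra_simps)
        have "poly (line_poly F p x0) 1 \<noteq> 0"
          using x c eval3_homogeneous[OF singularD(1)[OF F], of c x] by (simp add: x0_def poly_line_poly)
        then show "line_poly F p x0 \<noteq> 0" by auto
      qed (use p v F_at vanishingD(2)[OF g(1)] in auto)
    qed
    then have "dir_deriv v g + dir_deriv v g - a v = 0" by (rule vanishing_low) (use t in simp)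
    then show ?thesis using square_root_derivative(1)[OF Q(2) rel[OF v] F0 g0] g0 by simp
  qed
  have "poly (r Q) s = 0" for s
  proof -
    have "u + s *s w \<in> U" using frame_facts by (simp add: U_def linear_form_add)
    then have "of_nat (t - 1) * eval3 Q (u + s *s w) = 0"
      using eval3_euler[OF Q(1), of "u + s *s w"] dQ by simp
    then show ?thesis using t by (simp add: poly_line_poly)
  qed
  then have "r Q = 0" using poly_all_0_iff_0 by blast
  then have "r (g * g) = 0" unfolding Q by simp
  then show False using g p00 by simp
qed

end

section \<open>The lines of the configuration\<close>

text \<open>Both sides are the quadratic part at \<open>p\<close> of the product.\<close>

lemma dir_deriv_product_at_common_zero:
  fixes F g h K :: "'k::field_char_0 poly3"
  assumes "g * h = F * K" "eval3 g p = 0" "eval3 h p = 0" "eval3 F p = 0" "\<And>w. eval3 (dir_deriv w F) p = 0"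
  shows "2 * (eval3 (dir_deriv v g) p * eval3 (dir_deriv v h) p) = eval3 K p * eval3 (dir_deriv v (dir_deriv v F)) p"
proof -
  have "eval3 (dir_deriv v (dir_deriv v (g * h))) p = eval3 (dir_deriv v (dir_deriv v (F * K))) p" using assms(1) by simp
  then show ?thesis
    unfolding dir_deriv_mult dir_deriv_simps eval3_simps assms(2-5) by (simp add: algebra_simps)
qed

text \<open>Derivatives at a fixed point are linear functionals of the direction, and a product of two nonzero
  functionals is nonzero.\<close>

lemma product_of_directional_derivatives:
  fixes f g :: "'k::field_char_0 poly3"
  assumes "\<And>v. eval3 (dir_deriv v f) p * eval3 (dir_deriv v g) p = 0"
  shows "(\<forall>v. eval3 (dir_deriv v f) p = 0) \<or> (\<forall>v. eval3 (dir_deriv v g) p = 0)"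
proof (rule ccontr)
  assume "\<not> ?thesis"
  then obtain v w where vw: "eval3 (dir_deriv v f) p \<noteq> 0" "eval3 (dir_deriv w g) p \<noteq> 0" by blast
  then have "eval3 (dir_deriv v g) p = 0" "eval3 (dir_deriv w f) p = 0" using assms[of v] assms[of w] by auto
  then show False using assms[of "v + w"] vw by (simp add: dir_deriv_add_dir)
qed

context extremal_line
begin

definition roots :: "'k set" where
  "roots = {\<phi>. poly (r F) \<phi> = 0}"

lemma finite_roots: "finite roots"
  unfolding roots_def by (rule poly_roots_finite[OF rF0])

lemma card_roots: "card roots = t + 1"
  unfolding roots_def using card_roots_rsquarefree[OF restriction_squarefree] degree_rF by simp

definition cofactor :: "'k \<Rightarrow> 'k poly" where
  "cofactor \<phi> = r F div [:- \<phi>, 1:]"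

lemma cofactor:
  assumes "\<phi> \<in> roots"
  shows "r F = [:- \<phi>, 1:] * cofactor \<phi>" "cofactor \<phi> \<noteq> 0" "poly (cofactor \<phi>) \<phi> \<noteq> 0" "degree (cofactor \<phi>) \<le> t"
proof -
  have "[:- \<phi>, 1:] dvd r F" using assms by (simp add: roots_def poly_eq_0_iff_dvd)
  then show e: "r F = [:- \<phi>, 1:] * cofactor \<phi>" unfolding cofactor_def by (rule dvd_mult_div_cancel[symmetric])
  then show ne: "cofactor \<phi> \<noteq> 0" using rF0 by auto
  have "poly (pderiv (r F)) \<phi> = poly (cofactor \<phi>) \<phi>"
    unfolding e pderiv_mult by (simp add: pderiv_pCons)
  moreover have "poly (pderiv (r F)) \<phi> \<noteq> 0"
    using assms restriction_squarefree by (auto simp: roots_def rsquarefree_roots)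
  ultimately show "poly (cofactor \<phi>) \<phi> \<noteq> 0" by simp
  have "degree (r F) = Suc (degree (cofactor \<phi>))" by (subst e, subst degree_mult_eq) (use ne in auto)
  then show "degree (cofactor \<phi>) \<le> t" using degree_rF by simp
qed

text \<open>In the end this is, up to a scalar, the product of all lines in \<open>F\<close> except the one through the zero
  \<open>\<phi>\<close>. Until then only its restriction and its vanishing on \<open>Y\<close> are known.\<close>

definition component :: "'k \<Rightarrow> 'k poly3" where
  "component \<phi> = (SOME g. g \<in> vanishing Y t \<and> r g = cofactor \<phi>)"

lemma component:
  assumes "\<phi> \<in> roots"
  shows "component \<phi> \<in> vanishing Y t" "r (component \<phi>) = cofactor \<phi>"
proof -
  obtain g where "g \<in> vanishing Y t \<and> r g = cofactor \<phi>"
    using restrict_surj_t[OF cofactor(4)[OF assms]] by blast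
  then have "component \<phi> \<in> vanishing Y t \<and> r (component \<phi>) = cofactor \<phi>"
    unfolding component_def by (rule someI)
  then show "component \<phi> \<in> vanishing Y t" "r (component \<phi>) = cofactor \<phi>" by auto
qed

text \<open>Together, the zero \<open>\<phi>\<close> of \<open>h\<close> and the remaining zeros, which belong to the component, make up those of
  \<open>F\<close> on the line.\<close>

lemma component_mult:
  assumes "\<phi> \<in> roots" "h \<in> vanishing Y t" "poly (r h) \<phi> = 0"
  obtains K where "component \<phi> * h = F * K"
proof -
  have "[:- \<phi>, 1:] dvd r h" using assms(3) by (simp add: poly_eq_0_iff_dvd)
  then have "r F dvd r h * r (component \<phi>)"
    unfolding component(2)[OF assms(1)] cofactor(1)[OF assms(1)] by (rule mult_dvd_mono[OF _ dvd_refl])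
  then have "r F dvd r (component \<phi>) * r h" by (simp only: mult.commute)
  then show thesis using vanishing_product_divisible[OF component(1)[OF assms(1)] assms(2)] that by metis
qed

definition slope :: "'k \<Rightarrow> 'k ^ 3 \<Rightarrow> 'k ^ 3 \<Rightarrow> 'k" where
  "slope \<phi> p v = eval3 (dir_deriv v (component \<phi>)) p"

text \<open>Where exactly two lines of \<open>F\<close> meet, the product of all lines but one is singular unless the omitted
  line is one of the two. So these are the points of \<open>Y\<close> that should lie on the line through the zero
  \<open>\<phi>\<close>.\<close>

definition on_component :: "'k \<Rightarrow> ('k ^ 3) set" where
  "on_component \<phi> = {p \<in> Y. \<exists>v. slope \<phi> p v \<noteq> 0}"

lemma slope_product:
  assumes "\<phi> \<in> roots" "h \<in> vanishing Y t" "poly (r h) \<phi> = 0" "p \<in> Y"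
  shows "\<exists>\<kappa>. \<forall>v. slope \<phi> p v * eval3 (dir_deriv v h) p = \<kappa> * eval3 (dir_deriv v (dir_deriv v F)) p"
proof -
  obtain K where K: "component \<phi> * h = F * K" by (rule component_mult[OF assms(1-3)])
  have "slope \<phi> p v * eval3 (dir_deriv v h) p = (eval3 K p / 2) * eval3 (dir_deriv v (dir_deriv v F)) p" for v
    using dir_deriv_product_at_common_zero[OF K vanishingD(2)[OF component(1)[OF assms(1)] assms(4)]
        vanishingD(2)[OF assms(2,4)] F_at(1)[OF assms(4)] F_at(2)[OF assms(4)], of v]
    by (simp add: slope_def field_simps)
  then show ?thesis by blast
qed

lemma slopes_product:
  assumes "\<phi> \<in> roots" "\<psi> \<in> roots" "\<phi> \<noteq> \<psi>" "p \<in> Y"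
  shows "\<exists>\<kappa>. \<forall>v. slope \<phi> p v * slope \<psi> p v = \<kappa> * eval3 (dir_deriv v (dir_deriv v F)) p"
proof -
  have "poly (r F) \<phi> = 0" using assms by (simp add: roots_def)
  then have "poly (cofactor \<psi>) \<phi> = 0" unfolding cofactor(1)[OF assms(2)] using assms(3) by simp
  then show ?thesis
    using slope_product[OF assms(1) component(1)[OF assms(2)] _ assms(4)] component(2)[OF assms(2)]
    unfolding slope_def[of \<psi>] by simp
qed

text \<open>Otherwise one differential spans those of all forms of degree \<open>2 t - 1\<close> vanishing on \<open>Y\<close>. At \<open>p\<close>
  two conditions then suffice to make such a form singular, so that \<open>3 |Y| - 1\<close> conditions define the
  singular forms, one fewer than their dimension allows.\<close>

lemma exists_transversal_form:
  assumes p: "p \<in> Y" and e: "eval3 (dir_deriv e f) p \<noteq> 0"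
  shows "\<exists>G\<in>vanishing Y (2 * t - 1). \<exists>v. eval3 (dir_deriv v f) p = 0 \<and> eval3 (dir_deriv v G) p \<noteq> 0"
proof (rule ccontr)
  assume "\<not> ?thesis"
  then have all: "eval3 (dir_deriv v G) p = 0" if "G \<in> vanishing Y (2 * t - 1)" "eval3 (dir_deriv v f) p = 0" for G v
    using that by blast
  \<comment> \<open>At \<open>p\<close> the direction \<open>p\<close> itself stands for the value, by Euler's formula.\<close>
  define I where "I = (Y - {p}) \<times> range (\<lambda>i. axis i 1) \<union> {(p, p), (p, e)}"
  have finR: "finite (range (\<lambda>i::3. axis i (1::'k)))" by simp
  then have finI: "finite I" unfolding I_def using finY by simp
  have c3: "card (range (\<lambda>i::3. axis i (1::'k))) \<le> 3"
    using card_image_le[of "UNIV :: 3 set" "\<lambda>i. axis i (1::'k)"] by simp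
  have cY: "card Y = Suc (card (Y - {p}))" using p finY by (rule card.remove[rotated])
  have "card I \<le> card ((Y - {p}) \<times> range (\<lambda>i::3. axis i (1::'k))) + card {(p, p), (p, e)}"
    unfolding I_def by (rule card_Un_le)
  also have "\<dots> \<le> card (Y - {p}) * 3 + 2"
    using c3 by (intro add_mono) (auto simp: card_cartesian_product card_insert_if)
  finally have cI: "card I + 1 \<le> 3 * card Y" using cY by simp
  let ?V = "{G \<in> forms (2 * t - 1). \<forall>i\<in>I. eval3 (dir_deriv (snd i) G) (fst i) = 0}"
  have "?V \<subseteq> singular Y (2 * t - 1)"
  proof
    fix G assume G: "G \<in> ?V"
    then have Gf: "G \<in> forms (2 * t - 1)" by simp
    have euler: "eval3 G q = 0" if "eval3 (dir_deriv q G) q = 0" for q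
    proof -
      have "of_nat (2 * t - 1) \<noteq> (0::'k)" using t by (simp only: of_nat_eq_0_iff)
      moreover have "of_nat (2 * t - 1) * eval3 G q = 0" using eval3_euler[OF Gf, of q] that by (simp only:)
      ultimately show ?thesis by (simp only: mult_eq_0_iff simp_thms)
    qed
    have other: "eval3 (dir_deriv v G) q = 0" if "q \<in> Y - {p}" for q v
    proof -
      have "eval3 (dir_deriv (axis i 1) G) q = 0" for i
        using G that by (force simp: I_def)
      then show ?thesis unfolding dir_deriv_eq_sum[of v G] by simp
    qed
    have pp: "eval3 (dir_deriv p G) p = 0" "eval3 (dir_deriv e G) p = 0" using G by (auto simp: I_def)
    have Gv: "G \<in> vanishing Y (2 * t - 1)"
      unfolding vanishing_def using Gf euler other pp by blast
    have "eval3 (dir_deriv v G) p = 0" for v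
    proof -
      define c where "c = eval3 (dir_deriv v f) p / eval3 (dir_deriv e f) p"
      have "eval3 (dir_deriv (v + (- c) *s e) f) p = 0" using e unfolding dir_deriv_add_dir dir_deriv_scale_dir c_def by simp
      then have "eval3 (dir_deriv (v + (- c) *s e) G) p = 0" by (rule all[OF Gv])
      then show ?thesis using pp unfolding dir_deriv_add_dir dir_deriv_scale_dir by simp
    qed
    then show "G \<in> singular Y (2 * t - 1)"
      using Gv other unfolding singular_def vanishing_def by blast
  qed
  then have "poly3.dim ?V \<le> t choose 2"
    using dim_mono_fin[OF fin_dim_singular, of ?V Y "2 * t - 1"] dim_singular[of "2 * t - 1"] t by simp
  moreover have "poly3.dim (forms (2 * t - 1) :: 'k poly3 set) \<le> poly3.dim ?V + card I"
    by (rule dim_functional_kernels_le[OF fin_dim_forms finI functional_eval3_dir_deriv])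
  ultimately have "(2 * t - 1 + 2 choose 2) + 1 \<le> (t choose 2) + 3 * card Y"
    using cI by (simp add: dim_forms)
  then have *: "2 * (2 * t - 1 + 2 choose 2) + 2 \<le> 2 * (t choose 2) + 3 * (2 * (t + 1 choose 2))"
    unfolding cardY by linarith
  obtain s where s: "t = Suc s" using t by (cases t) auto
  have n: "2 * t - 1 + 2 = 2 * s + 3" using s by simp
  from * show False unfolding double_choose_two n s by (simp add: algebra_simps)
qed

text \<open>The quadratic part \<open>h\<close> of \<open>F\<close> at \<open>p\<close> is proportional to the product of any two of the three
  differentials. Hence these are proportional to each other, and \<open>h\<close> to the square of one of them. For a
  form \<open>G\<close> of degree \<open>t\<close> vanishing on \<open>Y\<close>, a suitable multiple of the first component can be subtracted so
  that the difference vanishes at its zero on the line; the product with that component then shows that the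
  differential of \<open>G\<close> is proportional to the same one. The forms of higher degree vanishing on \<open>Y\<close> are
  generated by those of degree \<open>t\<close>, so this holds in degree \<open>2 t - 1\<close> as well, where it is
  impossible.\<close>

lemma no_three_components:
  assumes \<phi>: "\<phi>1 \<in> roots" "\<phi>2 \<in> roots" "\<phi>3 \<in> roots" "\<phi>1 \<noteq> \<phi>2" "\<phi>1 \<noteq> \<phi>3" "\<phi>2 \<noteq> \<phi>3"
    and p: "p \<in> on_component \<phi>1" "p \<in> on_component \<phi>2" "p \<in> on_component \<phi>3"
  shows False
proof -
  have pY: "p \<in> Y" using p by (simp add: on_component_def)
  define h where "h v = eval3 (dir_deriv v (dir_deriv v F)) p" for v
  obtain k12 where k12: "\<And>v. slope \<phi>1 p v * slope \<phi>2 p v = k12 * h v"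
    using slopes_product[OF \<phi>(1,2,4) pY] unfolding h_def by blast
  obtain k13 where k13: "\<And>v. slope \<phi>1 p v * slope \<phi>3 p v = k13 * h v"
    using slopes_product[OF \<phi>(1,3,5) pY] unfolding h_def by blast
  obtain k23 where k23: "\<And>v. slope \<phi>2 p v * slope \<phi>3 p v = k23 * h v"
    using slopes_product[OF \<phi>(2,3,6) pY] unfolding h_def by blast
  have nz: "\<exists>v. slope \<phi> p v \<noteq> 0" if "p \<in> on_component \<phi>" for \<phi>
    using that by (simp add: on_component_def)
  have kne: "k \<noteq> 0" if "\<And>v. slope \<phi> p v * slope \<psi> p v = k * h v" "p \<in> on_component \<phi>" "p \<in> on_component \<psi>" for k \<phi> \<psi>
  proof
    assume "k = 0"
    then have "slope \<phi> p v * slope \<psi> p v = 0" for v using that(1) by simp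
    then show False
      using product_of_directional_derivatives[of "component \<phi>" p "component \<psi>"] nz that(2,3)
      unfolding slope_def by blast
  qed
  have k: "k12 \<noteq> 0" "k13 \<noteq> 0" "k23 \<noteq> 0"
    using kne[OF k12] kne[OF k13] kne[OF k23] p by auto
  have cancel: "slope \<phi>2 p v = (k12 / k13) * slope \<phi>3 p v" "slope \<phi>1 p v = (k12 / k23) * slope \<phi>3 p v" for v
  proof -
    have "eval3 (dir_deriv v (component \<phi>1)) p * eval3 (dir_deriv v (Const k13 * component \<phi>2 - Const k12 * component \<phi>3)) p = 0" for v
    proof -
      have "k13 * (slope \<phi>1 p v * slope \<phi>2 p v) = k12 * (slope \<phi>1 p v * slope \<phi>3 p v)" using k12 k13 by simp
      then show ?thesis by (simp add: slope_def algebra_simps)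
    qed
    then have "eval3 (dir_deriv v (Const k13 * component \<phi>2 - Const k12 * component \<phi>3)) p = 0"
      using product_of_directional_derivatives nz[OF p(1)] unfolding slope_def by blast
    then show "slope \<phi>2 p v = (k12 / k13) * slope \<phi>3 p v" using k by (simp add: slope_def field_simps)
    have "eval3 (dir_deriv v (component \<phi>2)) p * eval3 (dir_deriv v (Const k23 * component \<phi>1 - Const k12 * component \<phi>3)) p = 0" for v
    proof -
      have "k23 * (slope \<phi>1 p v * slope \<phi>2 p v) = k12 * (slope \<phi>2 p v * slope \<phi>3 p v)" using k12 k23 by simp
      then show ?thesis by (simp add: slope_def algebra_simps)
    qed
    then have "eval3 (dir_deriv v (Const k23 * component \<phi>1 - Const k12 * component \<phi>3)) p = 0"
      using product_of_directional_derivatives nz[OF p(2)] unfolding slope_def by blast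
    then show "slope \<phi>1 p v = (k12 / k23) * slope \<phi>3 p v" using k by (simp add: slope_def field_simps)
  qed
  define \<eta> where "\<eta> = (k12 / k13) * (k23 / k12) / k12"
  have h: "h v = \<eta> * (slope \<phi>1 p v * slope \<phi>1 p v)" for v
  proof -
    have e: "slope \<phi>2 p v = (k12 / k13) * (k23 / k12) * slope \<phi>1 p v" using cancel[of v] k by simp
    have "h v = slope \<phi>1 p v * slope \<phi>2 p v / k12" using k12[of v] k by simp
    also have "\<dots> = \<eta> * (slope \<phi>1 p v * slope \<phi>1 p v)" unfolding e \<eta>_def by simp
    finally show ?thesis .
  qed
  have slope_t: "eval3 (dir_deriv v G) p = 0" if G: "G \<in> vanishing Y t" and v: "slope \<phi>1 p v = 0" for G v
  proof -
    define g where "g = component \<phi>1"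
    note gg = component[OF \<phi>(1), folded g_def]
    \<comment> \<open>This multiple makes the difference vanish at \<open>\<phi>1\<close>.\<close>
    define c where "c = poly (r G) \<phi>1 / poly (cofactor \<phi>1) \<phi>1"
    define G' where "G' = G - Const c * g"
    have G'v: "G' \<in> vanishing Y t" unfolding G'_def by (intro vanishing_diff vanishing_Const_mult gg G)
    have "poly (r G') \<phi>1 = 0" using cofactor(3)[OF \<phi>(1)] by (simp add: G'_def gg c_def)
    then obtain \<kappa> where "\<And>v. slope \<phi>1 p v * eval3 (dir_deriv v G') p = \<kappa> * h v"
      using slope_product[OF \<phi>(1) G'v _ pY] unfolding h_def by blast
    then have "slope \<phi>1 p v * eval3 (dir_deriv v G') p = slope \<phi>1 p v * (\<kappa> * \<eta> * slope \<phi>1 p v)" for v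
      by (simp add: h algebra_simps)
    then have "eval3 (dir_deriv v g) p * eval3 (dir_deriv v (G' - Const (\<kappa> * \<eta>) * g)) p = 0" for v
      unfolding slope_def g_def[symmetric] by (simp add: algebra_simps)
    then have "eval3 (dir_deriv v (G' - Const (\<kappa> * \<eta>) * g)) p = 0"
      using product_of_directional_derivatives nz[OF p(1)] unfolding slope_def g_def by blast
    then show ?thesis using v by (simp add: G'_def slope_def g_def)
  qed
  have "\<forall>G\<in>vanishing Y j. \<forall>v. slope \<phi>1 p v = 0 \<longrightarrow> eval3 (dir_deriv v G) p = 0" if "t \<le> j" for j
    using that
  proof (induction j rule: dec_induct)
    case base
    then show ?case using slope_t by blast
  next
    case (step j)
    show ?case
    proof (intro ballI allI impI)
      fix G v assume G: "G \<in> vanishing Y (Suc j)" and v: "slope \<phi>1 p v = 0"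
      obtain a q where aq: "r G = pCons a q" by (cases "r G")
      have "degree (r G) \<le> Suc j" by (rule degree_line_poly[OF vanishingD(1)[OF G]])
      then have "degree q \<le> j" unfolding aq by (cases "q = 0") auto
      then obtain G1 where G1: "G1 \<in> vanishing Y j" "r G1 = q" by (rule restrict_surj[OF _ step(1)])
      have "degree [:a:] \<le> j" by simp
      then obtain G0 where G0: "G0 \<in> vanishing Y j" "r G0 = [:a:]" by (rule restrict_surj[OF _ step(1)])
      define D where "D = G - (A * G0 + B * G1)"
      have "D \<in> vanishing Y (Suc j)"
        using vanishing_mult_form[OF G0(1) frame_facts(1)] vanishing_mult_form[OF G1(1) frame_facts(2)]
        unfolding D_def by (intro vanishing_diff[OF G] vanishing_add) auto
      moreover have "r D = 0" using G0 G1 by (simp add: D_def aq r_frame)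
      ultimately obtain G2 where G2: "G2 \<in> vanishing Y j" "D = L * G2"
        by (rule restrict_0_vanishing[OF _ _ order_refl])
      have "G = A * G0 + B * G1 + L * G2" using G2(2) unfolding D_def by (simp add: algebra_simps)
      then show "eval3 (dir_deriv v G) p = 0"
        using step.IH v G0(1) G1(1) G2(1) vanishingD(2)[OF _ pY] by simp
    qed
  qed
  moreover have "t \<le> 2 * t - 1" using t by simp
  ultimately have "\<forall>G\<in>vanishing Y (2 * t - 1). \<forall>v. slope \<phi>1 p v = 0 \<longrightarrow> eval3 (dir_deriv v G) p = 0" by blast
  moreover obtain e where "slope \<phi>1 p e \<noteq> 0" using nz[OF p(1)] by blast
  ultimately show False using exists_transversal_form[OF pY, of e "component \<phi>1"] unfolding slope_def by blast
qed

text \<open>At each point of \<open>Y\<close> the component is singular or \<open>S\<close> vanishes, so the product is singular along \<open>Y\<close>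
  and thus a multiple of \<open>F\<close>. On the line, \<open>S\<close> must supply the zero \<open>\<phi>\<close> that the component lacks.\<close>

lemma root_of_form_through_component:
  assumes \<phi>: "\<phi> \<in> roots" and S: "S \<in> vanishing (on_component \<phi>) j" "j < t"
  shows "poly (r S) \<phi> = 0"
proof -
  note c = component[OF \<phi>]
  have "S * component \<phi> \<in> singular Y (j + t)"
    unfolding singular_def
  proof (intro CollectI conjI ballI allI)
    show "S * component \<phi> \<in> forms (j + t)"
      using forms_mult[OF vanishingD(1)[OF S(1)] vanishingD(1)[OF c(1)]] .
    fix p assume p: "p \<in> Y"
    have c0: "eval3 (component \<phi>) p = 0" by (rule vanishingD(2)[OF c(1) p])
    then show "eval3 (S * component \<phi>) p = 0" by simp
    show "eval3 (dir_deriv w (S * component \<phi>)) p = 0" for w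
    proof (cases "p \<in> on_component \<phi>")
      case True
      then show ?thesis using c0 vanishingD(2)[OF S(1)] by simp
    next
      case False
      then show ?thesis using c0 p by (simp add: on_component_def slope_def)
    qed
  qed
  moreover have "j + t < 2 * t" using S by simp
  ultimately obtain K where K: "S * component \<phi> = F * K" by (rule singular_multiple)
  then have "r (S * component \<phi>) = r (F * K)" by (rule arg_cong)
  then have "r S * cofactor \<phi> = [:- \<phi>, 1:] * cofactor \<phi> * r K"
    by (simp only: line_poly_simps c cofactor(1)[OF \<phi>, symmetric])
  then have "cofactor \<phi> * r S = cofactor \<phi> * ([:- \<phi>, 1:] * r K)"
    by (simp only: mult.commute mult.left_commute)
  then have "r S = [:- \<phi>, 1:] * r K" using cofactor(2)[OF \<phi>] mult_left_cancel by blast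
  then have "poly (r S) \<phi> = poly ([:- \<phi>, 1:] * r K) \<phi>" by (rule arg_cong)
  then show ?thesis by simp
qed

text \<open>The restrictions of the forms of degree \<open>j + 1\<close> all vanish at \<open>\<phi>\<close>, so they fill a space of dimension at most
  \<open>j + 1\<close> instead of \<open>j + 2\<close>.\<close>

lemma dim_vanishing_component_Suc:
  assumes \<phi>: "\<phi> \<in> roots" and j: "Suc j < t"
  shows "poly3.dim (vanishing (on_component \<phi>) (Suc j)) \<le> poly3.dim (vanishing (on_component \<phi>) j) + Suc j"
proof -
  let ?X = "on_component \<phi>"
  let ?K = "{S \<in> vanishing ?X (Suc j). \<forall>i\<in>{1..Suc j}. coeff (r S) i = 0}"
  have "poly3.dim (vanishing ?X (Suc j)) \<le> poly3.dim ?K + card {1..Suc j}"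
    by (rule dim_functional_kernels_le[OF fin_dim_vanishing]) (auto simp: functional_coeff_line_poly)
  moreover have "poly3.dim ?K \<le> poly3.dim ((*) L ` vanishing ?X j)"
  proof (rule dim_mono_fin[OF fin_dim_mult[OF fin_dim_vanishing]], rule subsetI)
    fix S assume S: "S \<in> ?K"
    then have Sv: "S \<in> vanishing ?X (Suc j)" by blast
    have "coeff (r S) (Suc i) = 0" for i
      using S degree_line_poly[OF vanishingD(1)[OF Sv], of u w] by (cases "Suc i \<le> Suc j") (auto simp: coeff_eq_0)
    then have c: "r S = [:coeff (r S) 0:]"
      by (intro poly_eqI) (auto simp: coeff_pCons split: nat.splits)
    have "poly (r S) \<phi> = 0" by (rule root_of_form_through_component[OF \<phi> Sv j])
    then have "coeff (r S) 0 = 0" by (subst (asm) c) simp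
    then have "r S = 0" using c by simp
    moreover have "?X \<subseteq> Y" by (auto simp: on_component_def)
    ultimately obtain S' where "S' \<in> vanishing ?X j" "S = L * S'" by (rule restrict_0_vanishing[OF Sv])
    then show "S \<in> (*) L ` vanishing ?X j" by blast
  qed
  ultimately show ?thesis using dim_mult[OF fin_dim_vanishing L0, of ?X j] by simp
qed

lemma dim_vanishing_component:
  assumes \<phi>: "\<phi> \<in> roots" and j: "j < t"
  shows "poly3.dim (vanishing (on_component \<phi>) j) \<le> (j + 1) choose 2"
  using j
proof (induction j)
  case 0
  have "vanishing (on_component \<phi>) 0 \<subseteq> poly3.span {}"
  proof
    fix S assume S: "S \<in> vanishing (on_component \<phi>) 0"
    then obtain c where c: "S = Const c" using vanishingD(1) forms_0E by blast
    have "poly (r S) \<phi> = 0" using root_of_form_through_component[OF \<phi> S] t by simp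
    then show "S \<in> poly3.span {}" using c by simp
  qed
  then have "poly3.dim (vanishing (on_component \<phi>) 0) \<le> 0" using poly3.dim_le_card[of _ "{}"] by simp
  then show ?case by simp
next
  case (Suc j)
  then show ?case using dim_vanishing_component_Suc[OF \<phi>, of j] choose_two_Suc[of "Suc j"] by simp
qed

text \<open>Compared with all forms of degree \<open>t - 1\<close>, those vanishing on the set lose at least one dimension for
  each of the degrees \<open>0, \<dots>, t - 1\<close>; so at least \<open>t\<close> points are needed.\<close>

lemma card_on_component_ge:
  assumes \<phi>: "\<phi> \<in> roots" shows "t \<le> card (on_component \<phi>)"
proof -
  have "finite (on_component \<phi>)" using finY by (simp add: on_component_def)
  then have "(t - 1 + 2) choose 2 \<le> poly3.dim (vanishing (on_component \<phi>) (t - 1)) + card (on_component \<phi>)"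
    by (rule dim_forms_le_vanishing)
  moreover have "poly3.dim (vanishing (on_component \<phi>) (t - 1)) \<le> (t - 1 + 1) choose 2"
    using t by (intro dim_vanishing_component[OF \<phi>]) simp
  moreover have "t - 1 + 2 = Suc t" "t - 1 + 1 = t" using t by auto
  ultimately show ?thesis using choose_two_Suc[of t] by (simp only:)
qed

text \<open>Without such a linear form one more dimension is lost in degree \<open>1\<close>, and \<open>t + 1\<close> points would be
  needed.\<close>

lemma line_through_component:
  assumes \<phi>: "\<phi> \<in> roots" and card: "card (on_component \<phi>) = t"
  obtains l where "l \<in> vanishing (on_component \<phi>) 1" "l \<noteq> 0" "poly (r l) \<phi> = 0"
proof -
  let ?d = "\<lambda>j. poly3.dim (vanishing (on_component \<phi>) j)"
  have "0 < ?d 1"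
  proof (rule ccontr)
    assume d1: "\<not> 0 < ?d 1"
    have "?d (Suc j) + 1 \<le> (j + 2) choose 2" if "Suc j < t" for j
      using that
    proof (induction j)
      case 0
      then show ?case using d1 by (simp add: numeral_2_eq_2)
    next
      case (Suc j)
      then show ?case using dim_vanishing_component_Suc[OF \<phi>, of "Suc j"] choose_two_Suc[of "Suc (Suc j)"] by simp
    qed
    from this[of "t - 2"] have "?d (t - 1) + 1 \<le> t choose 2" using t by (simp add: Suc_diff_Suc numeral_2_eq_2)
    moreover have "finite (on_component \<phi>)" using finY by (simp add: on_component_def)
    then have "(t - 1 + 2) choose 2 \<le> ?d (t - 1) + card (on_component \<phi>)" by (rule dim_forms_le_vanishing)
    moreover have "t - 1 + 2 = Suc t" using t by simp
    ultimately show False using choose_two_Suc[of t] card by (simp only:)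
  qed
  then obtain l where l: "l \<in> vanishing (on_component \<phi>) 1" "l \<noteq> 0" by (rule dim_pos_nonzero)
  moreover have "poly (r l) \<phi> = 0" using root_of_form_through_component[OF \<phi> l(1)] t by simp
  ultimately show thesis by (rule that)
qed

lemma card_roots_at_point:
  assumes "p \<in> Y" shows "card {\<phi> \<in> roots. p \<in> on_component \<phi>} \<le> 2"
proof (rule ccontr)
  assume "\<not> ?thesis"
  then have "3 \<le> card {\<phi> \<in> roots. p \<in> on_component \<phi>}" by simp
  then obtain T where T: "T \<subseteq> {\<phi> \<in> roots. p \<in> on_component \<phi>}" "card T = 3"
    by (meson obtain_subset_with_card_n)
  then obtain a b c where "T = {a, b, c}" "a \<noteq> b" "a \<noteq> c" "b \<noteq> c" by (auto simp: card_3_iff)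
  then show False using no_three_components[of a b c p] T by blast
qed

text \<open>The \<open>t + 1\<close> sets have at least \<open>t\<close> points each, and each of the \<open>(t + 1) choose 2\<close> points lies in at
  most two of the sets. Both bounds for the number of incidences are \<open>t (t + 1)\<close>.\<close>

lemma double_count:
  shows "\<phi> \<in> roots \<Longrightarrow> card (on_component \<phi>) = t"
    and "p \<in> Y \<Longrightarrow> card {\<phi> \<in> roots. p \<in> on_component \<phi>} = 2"
proof -
  have "(\<Sum>\<phi>\<in>roots. card (on_component \<phi>)) = (\<Sum>\<phi>\<in>roots. \<Sum>p\<in>Y. if p \<in> on_component \<phi> then 1 else 0)"
  proof (rule sum.cong[OF refl])
    fix \<phi>
    have "(\<Sum>p\<in>Y. if p \<in> on_component \<phi> then 1 else 0) = card {p \<in> Y. p \<in> on_component \<phi>}"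
      using finY by (simp add: sum.If_cases Int_def)
    also have "{p \<in> Y. p \<in> on_component \<phi>} = on_component \<phi>" by (auto simp: on_component_def)
    finally show "card (on_component \<phi>) = (\<Sum>p\<in>Y. if p \<in> on_component \<phi> then 1 else 0)" ..
  qed
  also have "\<dots> = (\<Sum>p\<in>Y. \<Sum>\<phi>\<in>roots. if p \<in> on_component \<phi> then 1 else 0)" by (rule sum.swap)
  also have "\<dots> = (\<Sum>p\<in>Y. card {\<phi> \<in> roots. p \<in> on_component \<phi>})"
    using finite_roots by (simp add: sum.If_cases Int_def)
  finally have eq: "(\<Sum>\<phi>\<in>roots. card (on_component \<phi>)) = (\<Sum>p\<in>Y. card {\<phi> \<in> roots. p \<in> on_component \<phi>})" .
  have up: "(\<Sum>p\<in>Y. card {\<phi> \<in> roots. p \<in> on_component \<phi>}) \<le> (\<Sum>p\<in>Y. 2)"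
    by (intro sum_mono card_roots_at_point)
  have low: "(\<Sum>\<phi>\<in>roots. t) \<le> (\<Sum>\<phi>\<in>roots. card (on_component \<phi>))"
    by (intro sum_mono card_on_component_ge)
  have tot: "(\<Sum>\<phi>\<in>roots. t) = (\<Sum>p\<in>Y. 2)"
    using double_choose_two[of "t + 1"] by (simp add: card_roots cardY)
  show "card (on_component \<phi>) = t" if "\<phi> \<in> roots"
  proof (rule ccontr)
    assume "card (on_component \<phi>) \<noteq> t"
    then have "t < card (on_component \<phi>)" using card_on_component_ge[OF that] by simp
    then have "(\<Sum>\<phi>\<in>roots. t) < (\<Sum>\<phi>\<in>roots. card (on_component \<phi>))"
      using that by (intro sum_strict_mono_ex1[OF finite_roots]) (auto intro: card_on_component_ge)
    then show False using up eq tot by simp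
  qed
  show "card {\<phi> \<in> roots. p \<in> on_component \<phi>} = 2" if "p \<in> Y"
  proof (rule ccontr)
    assume "card {\<phi> \<in> roots. p \<in> on_component \<phi>} \<noteq> 2"
    then have "card {\<phi> \<in> roots. p \<in> on_component \<phi>} < 2" using card_roots_at_point[OF that] by simp
    then have "(\<Sum>p\<in>Y. card {\<phi> \<in> roots. p \<in> on_component \<phi>}) < (\<Sum>p\<in>Y. 2)"
      using that by (intro sum_strict_mono_ex1[OF finY]) (auto intro: card_roots_at_point)
    then show False using low eq tot by simp
  qed
qed

text \<open>The lines are distinct because they meet \<open>L = 0\<close> in different points. Two proportional forms would
  vanish at two points of that line and hence be multiples of \<open>L\<close>, which has no zeros in \<open>Y\<close>.\<close>

lemma lines_exist:
  "\<exists>(I :: 'k set) l. finite I \<and> card I = t + 1 \<and> (\<forall>i\<in>I. l i \<in> forms 1 \<and> l i \<noteq> 0) \<and>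
     (\<forall>i\<in>I. \<forall>j\<in>I. \<forall>c. i \<noteq> j \<longrightarrow> l i \<noteq> Const c * l j) \<and>
     (\<forall>p\<in>Y. \<exists>i\<in>I. \<exists>j\<in>I. i \<noteq> j \<and> eval3 (l i) p = 0 \<and> eval3 (l j) p = 0)"
proof -
  have "\<exists>l. \<forall>\<phi>\<in>roots. l \<phi> \<in> vanishing (on_component \<phi>) 1 \<and> l \<phi> \<noteq> 0 \<and> poly (r (l \<phi>)) \<phi> = 0"
  proof (rule bchoice, rule ballI)
    fix \<phi> assume \<phi>: "\<phi> \<in> roots"
    show "\<exists>l. l \<in> vanishing (on_component \<phi>) 1 \<and> l \<noteq> 0 \<and> poly (r l) \<phi> = 0"
      using line_through_component[OF \<phi> double_count(1)[OF \<phi>]] by blast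
  qed
  then obtain l where l: "\<And>\<phi>. \<phi> \<in> roots \<Longrightarrow> l \<phi> \<in> vanishing (on_component \<phi>) 1"
      "\<And>\<phi>. \<phi> \<in> roots \<Longrightarrow> l \<phi> \<noteq> 0" "\<And>\<phi>. \<phi> \<in> roots \<Longrightarrow> poly (r (l \<phi>)) \<phi> = 0" by blast
  have distinct: "l \<phi> \<noteq> Const c * l \<psi>" if \<phi>: "\<phi> \<in> roots" "\<psi> \<in> roots" "\<phi> \<noteq> \<psi>" for \<phi> \<psi> c
  proof
    assume e: "l \<phi> = Const c * l \<psi>"
    have f1: "l \<phi> \<in> forms 1" using vanishingD(1)[OF l(1)[OF \<phi>(1)]] .
    have "poly (r (l \<phi>)) \<psi> = 0" using l(3)[OF \<phi>(2)] by (simp add: e)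
    then have "eval3 (l \<phi>) u + \<psi> * eval3 (l \<phi>) w = 0" "eval3 (l \<phi>) u + \<phi> * eval3 (l \<phi>) w = 0"
      using l(3)[OF \<phi>(1)] unfolding line_poly_linear_form[OF f1] by auto
    moreover have "(\<phi> - \<psi>) * eval3 (l \<phi>) w = (eval3 (l \<phi>) u + \<phi> * eval3 (l \<phi>) w) - (eval3 (l \<phi>) u + \<psi> * eval3 (l \<phi>) w)"
      by (simp add: algebra_simps)
    ultimately have "(\<phi> - \<psi>) * eval3 (l \<phi>) w = 0" by simp
    then have "eval3 (l \<phi>) w = 0" "eval3 (l \<phi>) u = 0"
      using \<phi>(3) \<open>eval3 (l \<phi>) u + \<psi> * eval3 (l \<phi>) w = 0\<close> by auto
    then have r0: "r (l \<phi>) = 0" unfolding line_poly_linear_form[OF f1] by simp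
    obtain G where G: "G \<in> forms (1 - 1)" "l \<phi> = L * G" by (rule frame_factor[OF fr f1 r0])
    then obtain b where b: "G = Const b" using forms_0E by auto
    have "on_component \<phi> \<noteq> {}" using double_count(1)[OF \<phi>(1)] t by auto
    then obtain p where p: "p \<in> on_component \<phi>" by blast
    then have "eval3 (l \<phi>) p = 0" by (rule vanishingD(2)[OF l(1)[OF \<phi>(1)]])
    moreover have "eval3 L p \<noteq> 0" using p by (intro L_off) (simp add: on_component_def)
    ultimately have "b = 0" using G b by simp
    then show False using l(2)[OF \<phi>(1)] G b by simp
  qed
  have "\<exists>i\<in>roots. \<exists>j\<in>roots. i \<noteq> j \<and> eval3 (l i) p = 0 \<and> eval3 (l j) p = 0" if pY: "p \<in> Y" for p
  proof -
    obtain i j where "{\<phi> \<in> roots. p \<in> on_component \<phi>} = {i, j}" "i \<noteq> j"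
      using double_count(2)[OF pY] by (auto simp: card_2_iff)
    then have "i \<in> roots" "j \<in> roots" "p \<in> on_component i" "p \<in> on_component j" by auto
    then show ?thesis using \<open>i \<noteq> j\<close> vanishingD(2)[OF l(1)] by blast
  qed
  then show ?thesis
    using finite_roots card_roots l vanishingD(1) distinct
    by (intro exI[of _ roots] exI[of _ l]) blast
qed

end

context extremal_points
begin

theorem star_lines:
  assumes "0 \<notin> Y"
  shows "\<exists>(I :: 'k set) l. finite I \<and> card I = t + 1 \<and> (\<forall>i\<in>I. l i \<in> forms 1 \<and> l i \<noteq> 0) \<and>
     (\<forall>i\<in>I. \<forall>j\<in>I. \<forall>c. i \<noteq> j \<longrightarrow> l i \<noteq> Const c * l j) \<and>
     (\<forall>p\<in>Y. \<exists>i\<in>I. \<exists>j\<in>I. i \<noteq> j \<and> eval3 (l i) p = 0 \<and> eval3 (l j) p = 0)"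
proof -
  obtain F where F: "F \<in> singular Y (t + 1)" "F \<noteq> 0" by (rule curve_exists)
  obtain L where L: "L \<in> forms 1" "L \<noteq> 0" "\<forall>p\<in>Y. eval3 L p \<noteq> 0"
    by (rule exists_line_avoiding[OF finY assms])
  have "\<exists>w. eval3 L w = 0 \<and> eval3 F w \<noteq> 0"
  proof (rule ccontr)
    assume "\<not> ?thesis"
    then have "\<And>w. eval3 L w = 0 \<Longrightarrow> eval3 F w = 0" by blast
    from line_divides[OF L(1,2) singularD(1)[OF F(1)] this]
    obtain G where G: "G \<in> forms t" "F = L * G" by (metis add_diff_cancel_right')
    have "G \<in> singular Y t" using F G L(3) by (intro singular_cancel[of L G Y "t + 1"]) auto
    then have "G = 0" by (rule singular_low) simp
    then show False using F G by simp
  qed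
  then obtain w where w: "eval3 L w = 0" "eval3 F w \<noteq> 0" by blast
  have "w \<noteq> 0"
  proof
    assume "w = 0"
    then have "eval3 F w = 0" using eval3_homogeneous[OF singularD(1)[OF F(1)], of 0 w] by simp
    then show False using w by simp
  qed
  then obtain u m A B where "frame u w m A B L" by (rule frame_exists[OF L(1,2) w(1)])
  then interpret extremal_line t Y F u w m A B L
    using F L(3) w(2) by unfold_locales auto
  show ?thesis by (rule lines_exist)
qed

end

section \<open>Star configurations have the expected Hilbert function\<close>

lemma double_roots_bound:
  fixes p :: "'k::field_char_0 poly"
  assumes "finite S" "p \<noteq> 0" "\<And>s. s \<in> S \<Longrightarrow> poly p s = 0 \<and> poly (pderiv p) s = 0"
  shows "2 * card S \<le> degree p"
  using assms
proof (induction S arbitrary: p)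
  case (insert a S)
  obtain q where q: "p = [:- a, 1:] * q" using insert.prems(2)[of a] by (auto simp: poly_eq_0_iff_dvd dvd_def)
  have "poly (pderiv p) a = poly q a" unfolding q pderiv_mult by (simp add: pderiv_pCons)
  then obtain k where k: "q = [:- a, 1:] * k" using insert.prems(2)[of a] by (auto simp: poly_eq_0_iff_dvd dvd_def)
  have k0: "k \<noteq> 0" using insert.prems(1) q k by auto
  then have q0: "q \<noteq> 0" unfolding k by (simp only: mult_eq_0_iff) simp
  have "degree q = Suc (degree k)" unfolding k by (subst degree_mult_eq) (use k0 in auto)
  moreover have "degree p = Suc (degree q)" unfolding q by (subst degree_mult_eq) (use q0 in auto)
  moreover have "2 * card S \<le> degree k"
  proof (rule insert.IH[OF k0])
    fix s assume s: "s \<in> S"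
    then have sa: "s - a \<noteq> 0" using insert.hyps by auto
    have pv: "poly p s = (s - a) * ((s - a) * poly k s)" unfolding q k by (simp add: algebra_simps)
    have "poly p s = 0" "poly (pderiv p) s = 0" using insert.prems(2)[of s] s by auto
    then have ks: "poly k s = 0" using pv sa by simp
    have "poly (pderiv p) s = (s - a) * ((s - a) * poly (pderiv k) s) + 2 * ((s - a) * poly k s)"
      unfolding q k pderiv_mult by (simp add: pderiv_pCons algebra_simps)
    then have "poly (pderiv k) s = 0" using ks sa \<open>poly (pderiv p) s = 0\<close> by simp
    with ks show "poly k s = 0 \<and> poly (pderiv k) s = 0" by blast
  qed
  ultimately show ?case using insert.hyps by simp
qed simp

text \<open>In a coordinate of the line for which none of the points is at infinity, the restriction of \<open>G\<close> has at
  least \<open>t\<close> double zeros, but degree less than \<open>2 t\<close>.\<close>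

lemma singular_divisible_by_line:
  fixes Y :: "('k::field_char_0 ^ 3) set"
  assumes Y: "finite Y" "0 \<notin> Y" "\<forall>p\<in>Y. \<forall>q\<in>Y. \<forall>c. p = c *s q \<longrightarrow> p = q"
    and l: "l \<in> forms 1" "l \<noteq> 0" "card {p \<in> Y. eval3 l p = 0} \<ge> t"
    and G: "G \<in> singular Y j" "j < 2 * t" and v: "eval3 l v = 0"
  shows "eval3 G v = 0"
proof -
  define T where "T = {p \<in> Y. eval3 l p = 0}"
  have finT: "finite T" using Y by (simp add: T_def)
  obtain w0 where w0: "w0 \<noteq> 0" "eval3 l w0 = 0" by (rule line_has_point[OF l(1)])
  obtain u0 m0 A0 B0 where fr0: "frame u0 w0 m0 A0 B0 l" by (rule frame_exists[OF l(1,2) w0(2,1)])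
  note f0 = fr0[unfolded frame_def]
  \<comment> \<open>These are the values of \<open>x\<close> for which \<open>w0 + x u0\<close> represents one of the points.\<close>
  obtain x where x: "x \<notin> (\<lambda>p. eval3 A0 p / eval3 B0 p) ` T"
    using ex_new_if_finite[OF infinite_UNIV_char_0] finT by blast
  define w where "w = w0 + x *s u0"
  have w: "eval3 B0 w = 1" "eval3 A0 w = x" "eval3 l w = 0"
    using f0 by (simp_all add: w_def linear_form_add)
  have w_ne: "w \<noteq> 0"
  proof
    assume "w = 0"
    then show False using w(1) f0 eval3_homogeneous[of B0 1 0 w] by simp
  qed
  obtain u m A B where fr: "frame u w m A B l" by (rule frame_exists[OF l(1,2) w(3) w_ne])
  note f = fr[unfolded frame_def]
  have A_ne: "eval3 A p \<noteq> 0" if p: "p \<in> T" for p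
  proof
    assume "eval3 A p = 0"
    define b where "b = eval3 B p"
    have pw: "p = b *s w" using frame_direction[OF fr, of p] p \<open>eval3 A p = 0\<close> by (simp add: T_def b_def)
    have "eval3 B0 p = b" "eval3 A0 p = b * x"
      unfolding pw using f0 w eval3_homogeneous[of _ 1 b w] by auto
    moreover have "b \<noteq> 0" using pw p Y(2) by (auto simp: T_def)
    ultimately have "x = eval3 A0 p / eval3 B0 p" by simp
    then show False using x p by blast
  qed
  define s where "s p = eval3 B p / eval3 A p" for p
  have ps: "p = eval3 A p *s (u + s p *s w)" if p: "p \<in> T" for p
    using frame_direction[OF fr, of p] p A_ne[OF p] by (simp add: T_def s_def vec_eq_iff algebra_simps)
  have "inj_on s T"
  proof (rule inj_onI)
    fix p q assume pq: "p \<in> T" "q \<in> T" "s p = s q"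
    have q: "u + s p *s w = (1 / eval3 A q) *s q"
      using ps[OF pq(2)] A_ne[OF pq(2)] pq(3) by (simp add: vec_eq_iff field_simps)
    have "p = (eval3 A p / eval3 A q) *s q" using ps[OF pq(1)] unfolding q by simp
    then show "p = q" using Y(3) pq(1,2) unfolding T_def by blast
  qed
  then have card: "card (s ` T) \<ge> t" using l(3) by (simp add: card_image T_def)
  have zero: "eval3 H (u + s p *s w) = 0" if "H \<in> forms d" "eval3 H p = 0" "p \<in> T" for H d p
    using eval3_homogeneous[OF that(1), of "eval3 A p" "u + s p *s w"] ps[OF that(3)] that(2) A_ne[OF that(3)]
    by simp
  have Gl: "line_poly G u w = 0"
  proof (rule ccontr)
    assume ne: "line_poly G u w \<noteq> 0"
    have "poly (line_poly G u w) y = 0 \<and> poly (pderiv (line_poly G u w)) y = 0" if "y \<in> s ` T" for y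
    proof -
      obtain p where p: "p \<in> T" "y = s p" using \<open>y \<in> s ` T\<close> by blast
      then have "p \<in> Y" by (simp add: T_def)
      then show ?thesis
        unfolding pderiv_line_poly poly_line_poly p(2)
        using zero[OF singularD(1)[OF G(1)] _ p(1)] zero[OF dir_deriv_forms[OF singularD(1)[OF G(1)]] _ p(1)] singularD(2,3)[OF G(1)]
        by blast
    qed
    then have "2 * card (s ` T) \<le> degree (line_poly G u w)" using finT ne by (intro double_roots_bound) auto
    then show False using degree_line_poly[OF singularD(1)[OF G(1)], of u w] card G(2) by simp
  qed
  obtain G' where "G = l * G'" by (rule frame_factor[OF fr singularD(1)[OF G(1)] Gl])
  then show ?thesis using v by simp
qed

text \<open>If the product of some of the lines divides \<open>G\<close>, the quotient vanishes on any further line, since the product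
  does not vanish identically there.\<close>

lemma divisible_by_product_of_lines:
  fixes l :: "'i \<Rightarrow> 'k::field_char_0 poly3"
  assumes "finite J" "\<And>i. i \<in> J \<Longrightarrow> l i \<in> forms 1 \<and> l i \<noteq> 0"
    and "\<And>i j c. i \<in> J \<Longrightarrow> j \<in> J \<Longrightarrow> i \<noteq> j \<Longrightarrow> l i \<noteq> Const c * l j"
    and "G \<in> forms d" "\<And>i v. i \<in> J \<Longrightarrow> eval3 (l i) v = 0 \<Longrightarrow> eval3 G v = 0"
  shows "\<exists>K. K \<in> forms (d - card J) \<and> (d < card J \<longrightarrow> K = 0) \<and> G = (\<Prod>i\<in>J. l i) * K"
  using assms(1-3,5)
proof (induction J)
  case empty
  then show ?case using assms(4) by simp
next
  case (insert i J)
  have "\<exists>K. K \<in> forms (d - card J) \<and> (d < card J \<longrightarrow> K = 0) \<and> G = (\<Prod>i\<in>J. l i) * K"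
  proof (rule insert.IH)
    show "l j \<in> forms 1 \<and> l j \<noteq> 0" if "j \<in> J" for j using insert.prems(1) that by blast
    show "l j \<noteq> Const c * l j'" if "j \<in> J" "j' \<in> J" "j \<noteq> j'" for j j' c
      using insert.prems(2) that by blast
    show "eval3 G v = 0" if "j \<in> J" "eval3 (l j) v = 0" for j v using insert.prems(3) that by blast
  qed
  then obtain K where K: "K \<in> forms (d - card J)" "d < card J \<longrightarrow> K = 0" "G = (\<Prod>i\<in>J. l i) * K" by blast
  have li: "l i \<in> forms 1" "l i \<noteq> 0" using insert.prems(1) by auto
  obtain w where w: "w \<noteq> 0" "eval3 (l i) w = 0" by (rule line_has_point[OF li(1)])
  obtain u m A B where fr: "frame u w m A B (l i)" by (rule frame_exists[OF li w(2,1)])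
  have "eval3 (l i) (u + s *s w) = 0" for s
    using fr by (simp add: linear_form_add[OF li(1)] frame_def)
  then have "poly (line_poly G u w) s = 0" for s using insert.prems(3)[of i] by (simp add: poly_line_poly)
  then have "line_poly G u w = 0" using poly_all_0_iff_0 by blast
  then have "(\<Prod>j\<in>J. line_poly (l j) u w) * line_poly K u w = 0" unfolding K(3) by simp
  moreover have "line_poly (l j) u w \<noteq> 0" if j: "j \<in> J" for j
  proof
    assume l0: "line_poly (l j) u w = 0"
    have "l j \<in> forms 1" using insert.prems(1) j by blast
    then obtain G' where "G' \<in> forms (1 - 1)" "l j = l i * G'" by (rule frame_factor[OF fr _ l0])
    then obtain c where "l j = Const c * l i" using forms_0E by (metis diff_self_eq_0 mult.commute)
    then show False using insert.prems(2)[of j i] j insert.hyps by auto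
  qed
  then have "(\<Prod>j\<in>J. line_poly (l j) u w) \<noteq> 0" using insert.hyps by simp
  ultimately have "line_poly K u w = 0" by (metis mult_eq_0_iff)
  then obtain K' where K': "K' \<in> forms (d - card J - 1)" "d - card J = 0 \<longrightarrow> K' = 0" "K = l i * K'"
    by (rule frame_factor[OF fr K(1)]) (rule that, assumption, blast, assumption)
  show ?case
  proof (intro exI conjI impI)
    show "K' \<in> forms (d - card (insert i J))" using K'(1) insert.hyps by simp
    show "K' = 0" if "d < card (insert i J)" using that K'(2) insert.hyps by simp
    show "G = (\<Prod>i\<in>insert i J. l i) * K'" using K(3) K'(3) insert.hyps by (simp add: ac_simps)
  qed
qed

lemma dim_forms_le_singular:
  fixes Y :: "('k::field_char_0 ^ 3) set"
  assumes "finite Y" "d \<noteq> 0"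
  shows "(d + 2) choose 2 \<le> poly3.dim (singular Y d) + 3 * card Y"
proof -
  let ?V = "{f \<in> forms d. \<forall>i\<in>Y \<times> (UNIV :: 3 set). eval3 (dir_deriv (axis (snd i) 1) f) (fst i) = 0}"
  have "poly3.dim (forms d :: 'k poly3 set) \<le> poly3.dim ?V + card (Y \<times> (UNIV :: 3 set))"
    using assms by (intro dim_functional_kernels_le[OF fin_dim_forms] functional_eval3_dir_deriv) auto
  moreover have "?V \<subseteq> singular Y d"
  proof
    fix f assume f: "f \<in> ?V"
    have d: "eval3 (dir_deriv v f) p = 0" if "p \<in> Y" for p v
      unfolding dir_deriv_eq_sum[of v f] using f that by simp
    moreover have "eval3 f p = 0" if "p \<in> Y" for p
      using eval3_euler[of f d p] f d[OF that] assms(2) by simp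
    ultimately show "f \<in> singular Y d" using f by (simp add: singular_def)
  qed
  then have "poly3.dim ?V \<le> poly3.dim (singular Y d)" by (rule dim_mono_fin[OF fin_dim_singular])
  ultimately show ?thesis by (simp add: dim_forms card_cartesian_product)
qed

text \<open>Restrict to a line that misses \<open>Y\<close>: the kernel is that line times the singular forms of degree \<open>j\<close>. So
  independence of the conditions passes from degree \<open>j\<close> to degree \<open>j + 1\<close>.\<close>

lemma dim_singular_Suc_le:
  fixes Y :: "('k::field_char_0 ^ 3) set"
  assumes "finite Y" "0 \<notin> Y"
  shows "poly3.dim (singular Y (Suc j)) \<le> poly3.dim (singular Y j) + (j + 2)"
proof -
  obtain L where L: "L \<in> forms 1" "L \<noteq> 0" "\<forall>p\<in>Y. eval3 L p \<noteq> 0"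
    by (rule exists_line_avoiding[OF assms])
  obtain w where w: "w \<noteq> 0" "eval3 L w = 0" by (rule line_has_point[OF L(1)])
  obtain u m A B where fr: "frame u w m A B L" by (rule frame_exists[OF L(1,2) w(2,1)])
  let ?K = "{G \<in> singular Y (Suc j). \<forall>i\<in>{..Suc j}. coeff (line_poly G u w) i = 0}"
  have "poly3.dim (singular Y (Suc j)) \<le> poly3.dim ?K + card {..Suc j}"
    by (rule dim_functional_kernels_le[OF fin_dim_singular]) (auto simp: functional_coeff_line_poly)
  moreover have "poly3.dim ?K \<le> poly3.dim ((*) L ` singular Y j)"
  proof (rule dim_mono_fin[OF fin_dim_mult[OF fin_dim_singular]], rule subsetI)
    fix G assume G: "G \<in> ?K"
    then have Gs: "G \<in> singular Y (Suc j)" by blast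
    have "coeff (line_poly G u w) i = 0" for i
      using G degree_line_poly[OF singularD(1)[OF Gs], of u w] by (cases "i \<le> Suc j") (auto simp: coeff_eq_0)
    then have l0: "line_poly G u w = 0" by (intro poly_eqI) simp
    obtain G' where G': "G' \<in> forms (Suc j - 1)" "G = L * G'"
      by (rule frame_factor[OF fr singularD(1)[OF Gs] l0])
    then have "G' \<in> singular Y j" using Gs L(3) by (intro singular_cancel[of L G' Y "Suc j"]) auto
    then show "G \<in> (*) L ` singular Y j" using G' by blast
  qed
  ultimately show ?thesis using dim_mult[OF fin_dim_singular L(2), of Y j] by simp
qed

lemma prod_of_lines_singular:
  fixes l :: "'i \<Rightarrow> 'k::field_char_0 poly3"
  assumes I: "finite I" "\<And>i. i \<in> I \<Longrightarrow> l i \<in> forms 1"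
    and Y: "\<And>p. p \<in> Y \<Longrightarrow> \<exists>i\<in>I. \<exists>j\<in>I. i \<noteq> j \<and> eval3 (l i) p = 0 \<and> eval3 (l j) p = 0"
  shows "(\<Prod>i\<in>I. l i) \<in> singular Y (card I)"
proof -
  have f: "(\<Prod>i\<in>J. l i) \<in> forms (card J)" if "J \<subseteq> I" for J
    using finite_subset[OF that I(1)] that
  proof (induction J)
    case empty
    then show ?case using forms_Const[of 1] by simp
  next
    case (insert i J)
    then show ?case using forms_mult[OF I(2)[of i], of "\<Prod>i\<in>J. l i" "card J"] by simp
  qed
  have "eval3 (\<Prod>i\<in>I. l i) p = 0 \<and> eval3 (dir_deriv v (\<Prod>i\<in>I. l i)) p = 0" if p: "p \<in> Y" for p v
  proof -
    obtain i j where ij: "i \<in> I" "j \<in> I" "i \<noteq> j" "eval3 (l i) p = 0" "eval3 (l j) p = 0"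
      using Y[OF p] by blast
    have "(\<Prod>i\<in>I. l i) = l i * (l j * (\<Prod>i\<in>I - {i} - {j}. l i))"
      using ij I by (simp add: prod.remove)
    then show ?thesis using ij by simp
  qed
  then show ?thesis using f[of I] by (simp add: singular_def)
qed

text \<open>In degrees less than \<open>2 t\<close> the singular forms are the multiples of the product of the lines. For
  \<open>j = 2 t - 1\<close> both formulas agree, and the conditions stay independent in higher degrees.\<close>

theorem star_dimensions:
  fixes l :: "'i \<Rightarrow> 'k::field_char_0 poly3"
  assumes t: "t \<ge> 1"
    and I: "finite I" "card I = t + 1" "\<And>i. i \<in> I \<Longrightarrow> l i \<in> forms 1 \<and> l i \<noteq> 0"
      "\<And>i j c. i \<in> I \<Longrightarrow> j \<in> I \<Longrightarrow> i \<noteq> j \<Longrightarrow> l i \<noteq> Const c * l j"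
    and Y: "finite Y" "card Y = (t + 1) choose 2" "0 \<notin> Y"
      "\<forall>p\<in>Y. \<forall>q\<in>Y. \<forall>c. p = c *s q \<longrightarrow> p = q"
    and two: "\<And>p. p \<in> Y \<Longrightarrow> \<exists>i\<in>I. \<exists>j\<in>I. i \<noteq> j \<and> eval3 (l i) p = 0 \<and> eval3 (l j) p = 0"
    and many: "\<And>i. i \<in> I \<Longrightarrow> card {p \<in> Y. eval3 (l i) p = 0} \<ge> t"
  shows "j < 2 * t \<Longrightarrow> poly3.dim (singular Y j) = (j + 1 - t) choose 2"
    and "2 * t - 1 \<le> j \<Longrightarrow> poly3.dim (singular Y j) + 3 * card Y = (j + 2) choose 2"
proof -
  define F where "F = (\<Prod>i\<in>I. l i)"
  have F: "F \<in> singular Y (t + 1)"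
    unfolding F_def I(2)[symmetric] by (rule prod_of_lines_singular) (use I two in auto)
  have F0: "F \<noteq> 0" unfolding F_def using I by simp
  have mult: "\<exists>K. K \<in> forms (j - (t + 1)) \<and> (j < t + 1 \<longrightarrow> K = 0) \<and> G = F * K"
    if "G \<in> singular Y j" "j < 2 * t" for G j
    unfolding F_def I(2)[symmetric]
  proof (rule divisible_by_product_of_lines[OF I(1,3,4) singularD(1)[OF that(1)]])
    fix i v assume "i \<in> I" "eval3 (l i) v = 0"
    then show "eval3 G v = 0"
      using singular_divisible_by_line[OF Y(1,3,4) _ _ many that] I(3) by blast
  qed
  show low: "poly3.dim (singular Y j) = (j + 1 - t) choose 2" if j: "j < 2 * t" for j
  proof (cases "j < t + 1")
    case True
    then have "singular Y j \<subseteq> poly3.span {}" using mult[OF _ j] by auto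
    then have "poly3.dim (singular Y j) \<le> 0" using poly3.dim_le_card[of _ "{}"] by simp
    moreover have "j + 1 - t < 2" using True by simp
    ultimately show ?thesis by simp
  next
    case False
    have "singular Y j = (*) F ` forms (j - (t + 1))"
    proof
      show "singular Y j \<subseteq> (*) F ` forms (j - (t + 1))" using mult[OF _ j] by blast
      show "(*) F ` forms (j - (t + 1)) \<subseteq> singular Y j"
        using singular_mult_form[OF F, of _ "j - (t + 1)"] False by auto
    qed
    moreover have "j - (t + 1) + 2 = j + 1 - t" using False by simp
    ultimately show ?thesis by (simp add: dim_mult[OF fin_dim_forms F0] dim_forms)
  qed
  show "poly3.dim (singular Y j) + 3 * card Y = (j + 2) choose 2" if "2 * t - 1 \<le> j"
    using that
  proof (induction j rule: dec_induct)
    case base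
    obtain s where s: "t = Suc s" using t by (cases t) auto
    have n: "2 * t - 1 < 2 * t" "2 * t - 1 + 1 - t = t" "2 * t - 1 + 2 = 2 * s + 3" using s by auto
    have d: "poly3.dim (singular Y (2 * t - 1)) = t choose 2" using low[OF n(1)] n(2) by simp
    have "2 * ((t choose 2) + 3 * (t + 1 choose 2)) = 2 * (2 * t - 1 + 2 choose 2)"
      unfolding n(3) unfolding distrib_left mult.left_commute[of 2 3] double_choose_two unfolding s
      by (simp add: algebra_simps)
    then show ?case unfolding d Y(2) by (subst (asm) mult_left_cancel) (simp, assumption)
  next
    case (step j)
    have "(Suc j + 2) choose 2 = ((j + 2) choose 2) + (j + 2)" using choose_two_Suc[of "j + 2"] by simp
    then show ?case
      using step.IH dim_singular_Suc_le[OF Y(1,3), of j] dim_forms_le_singular[OF Y(1), of "Suc j"] by simp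
  qed
qed

section \<open>The ideal of double points\<close>

definition rep :: "('k::field ^ 3) set \<Rightarrow> 'k ^ 3" where
  "rep P = (SOME p. p \<noteq> 0 \<and> P = range (\<lambda>c. c *s p))"

lemma rep:
  assumes "P \<in> proj_plane"
  shows "rep P \<noteq> 0" "P = range (\<lambda>c. c *s rep P)"
proof -
  have P: "vec.subspace P" "vec.dim P = 1" using assms by (auto simp: proj_plane_def)
  obtain B where B: "B \<subseteq> P" "vec.independent B" "P \<subseteq> vec.span B" "card B = vec.dim P"
    by (rule vec.basis_exists)
  then obtain p where p: "B = {p}" using P card_1_singletonE by metis
  have "p \<noteq> 0" using B(2) p by simp
  moreover have "P = vec.span {p}" using B P p vec.span_minimal by blast
  ultimately have "p \<noteq> 0 \<and> P = range (\<lambda>c. c *s p)" by (simp add: vec.span_singleton)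
  then have "rep P \<noteq> 0 \<and> P = range (\<lambda>c. c *s rep P)" unfolding rep_def by (rule someI)
  then show "rep P \<noteq> 0" "P = range (\<lambda>c. c *s rep P)" by auto
qed

lemma range_scale_in_proj_plane:
  assumes "p \<noteq> 0" shows "range (\<lambda>c. c *s p) \<in> proj_plane"
proof -
  have "range (\<lambda>c. c *s p) = vec.span {p}" by (simp add: vec.span_singleton)
  moreover have "vec.dim (vec.span {p}) = 1" using assms vec.dim_span_eq_card_independent[of "{p}"] by simp
  ultimately show ?thesis by (simp add: proj_plane_def)
qed

lemma rep_proportional:
  assumes "P \<in> proj_plane" "Q \<in> proj_plane" "rep P = c *s rep Q"
  shows "P = Q"
proof -
  have c: "c \<noteq> 0" using rep(1)[OF assms(1)] assms(3) by auto
  have "range (\<lambda>d. d *s rep P) = range (\<lambda>d. d *s rep Q)"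
  proof (intro equalityI subsetI)
    fix x assume "x \<in> range (\<lambda>d. d *s rep P)"
    then show "x \<in> range (\<lambda>d. d *s rep Q)" unfolding assms(3) by auto
  next
    fix x assume "x \<in> range (\<lambda>d. d *s rep Q)"
    then obtain d where "x = d *s rep Q" by blast
    then have "x = (d / c) *s rep P" unfolding assms(3) using c by simp
    then show "x \<in> range (\<lambda>d. d *s rep P)" by blast
  qed
  then show ?thesis using rep(2)[OF assms(1)] rep(2)[OF assms(2)] by simp
qed

lemma inj_on_rep:
  assumes "X \<subseteq> proj_plane" shows "inj_on rep X"
proof (rule inj_onI)
  fix P Q assume "P \<in> X" "Q \<in> X" "rep P = rep Q"
  then show "P = Q" using rep_proportional[of P Q 1] assms by auto
qed

lemma zero_notin_rep:
  assumes "X \<subseteq> proj_plane" shows "0 \<notin> rep ` X"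
proof
  assume "0 \<in> rep ` X"
  then obtain P where "P \<in> X" "rep P = 0" by force
  then show False using rep(1)[of P] assms by blast
qed

lemma vanishes_at_rep:
  assumes "f \<in> forms d" "P \<in> proj_plane"
  shows "vanishes_at f P \<longleftrightarrow> eval3 f (rep P) = 0"
proof
  assume v: "vanishes_at f P"
  have "1 *s rep P \<in> P" by (subst (2) rep(2)[OF assms(2)]) blast
  then show "eval3 f (rep P) = 0" using v by (simp add: vanishes_at_def)
next
  assume "eval3 f (rep P) = 0"
  then have "eval3 f (c *s rep P) = 0" for c using eval3_homogeneous[OF assms(1)] by simp
  then show "vanishes_at f P"
    unfolding vanishes_at_def by (subst rep(2)[OF assms(2)]) blast
qed

lemma point_ideal_vanishes:
  assumes "f \<in> point_ideal P" "P \<in> proj_plane"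
  shows "eval3 f (rep P) = 0"
  using assms(1) unfolding point_ideal_def
proof (induction rule: ideal.span_induct_alt)
  case (step c x y)
  then show ?case using vanishes_at_rep[OF _ assms(2)] by auto
qed simp

lemma ideal_square_singular:
  assumes "f \<in> ideal_square (point_ideal P)" "P \<in> proj_plane"
  shows "eval3 f (rep P) = 0 \<and> (\<forall>v. eval3 (dir_deriv v f) (rep P) = 0)"
  using assms(1) unfolding ideal_square_def
proof (induction rule: ideal.span_induct_alt)
  case (step c x y)
  then obtain g h where "x = g * h" "g \<in> point_ideal P" "h \<in> point_ideal P" by blast
  then show ?case using point_ideal_vanishes[OF _ assms(2)] step by simp
qed simp

text \<open>The forms \<open>p\<^sub>k x\<^sub>j - p\<^sub>j x\<^sub>k\<close> generate the ideal of \<open>p\<close>. Modulo them every variable is a multiple of \<open>x\<^sub>k\<close>.\<close>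

lemma taylor_at_point:
  fixes p :: "'k::field ^ 3"
  assumes k: "p $ k \<noteq> 0" and f: "f \<in> forms d"
  shows "\<exists>g c. (\<forall>j. g j \<in> forms (d - 1) \<and> (d = 0 \<longrightarrow> g j = 0)) \<and>
    f = (\<Sum>j\<in>UNIV. (Const (p $ k) * Var j - Const (p $ j) * Var k) * g j) + Const c * Var k ^ d"
  using f
proof (induction rule: forms_induct)
  case (Const c)
  then show ?case by (intro exI[of _ "\<lambda>_. 0"] exI[of _ c]) simp
next
  case (add d f f')
  then obtain g c g' c' where g: "\<forall>j. g j \<in> forms (d - 1) \<and> (d = 0 \<longrightarrow> g j = 0)"
      "f = (\<Sum>j\<in>UNIV. (Const (p $ k) * Var j - Const (p $ j) * Var k) * g j) + Const c * Var k ^ d"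
    and g': "\<forall>j. g' j \<in> forms (d - 1) \<and> (d = 0 \<longrightarrow> g' j = 0)"
      "f' = (\<Sum>j\<in>UNIV. (Const (p $ k) * Var j - Const (p $ j) * Var k) * g' j) + Const c' * Var k ^ d"
    by blast
  show ?case
    using g g' by (intro exI[of _ "\<lambda>j. g j + g' j"] exI[of _ "c + c'"])
      (auto simp: distrib_left distrib_right sum.distrib)
next
  case (Var d i f)
  then obtain g c where g: "\<forall>j. g j \<in> forms (d - 1) \<and> (d = 0 \<longrightarrow> g j = 0)"
      "f = (\<Sum>j\<in>UNIV. (Const (p $ k) * Var j - Const (p $ j) * Var k) * g j) + Const c * Var k ^ d"
    by blast
  define a where "a j = Const (p $ k) * Var j - Const (p $ j) * Var k" for j
  define h where "h j = (if j = i then Const (c / p $ k) * Var k ^ d else 0)" for j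
  have V: "Var i * (Const c * Var k ^ d) = a i * (Const (c / p $ k) * Var k ^ d) + Const (c * p $ i / p $ k) * Var k ^ Suc d"
  proof -
    have "Const (c / p $ k) * Const (p $ k) = Const c" "Const (c / p $ k) * Const (p $ i) = Const (c * p $ i / p $ k)"
      using k by (simp_all flip: Const_simps(3) add: mult_single)
    then show ?thesis unfolding a_def by (simp del: Const_simps add: algebra_simps power_Suc)
  qed
  have "Var i * f = (\<Sum>j\<in>UNIV. a j * (Var i * g j)) + Var i * (Const c * Var k ^ d)"
    unfolding g(2) a_def[symmetric] distrib_left sum_distrib_left mult.left_commute[of "Var i" "a _"] ..
  also have "\<dots> = (\<Sum>j\<in>UNIV. a j * (Var i * g j)) + (\<Sum>j\<in>UNIV. a j * h j) + Const (c * p $ i / p $ k) * Var k ^ Suc d"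
    unfolding V by (simp add: h_def if_distrib cong: if_cong)
  also have "\<dots> = (\<Sum>j\<in>UNIV. a j * (Var i * g j + h j)) + Const (c * p $ i / p $ k) * Var k ^ Suc d"
    by (simp add: distrib_left sum.distrib)
  finally have e: "Var i * f = (\<Sum>j\<in>UNIV. a j * (Var i * g j + h j)) + Const (c * p $ i / p $ k) * Var k ^ Suc d" .
  have "Var i * g j + h j \<in> forms d" for j
  proof -
    have "Var i * g j \<in> forms d" using g(1) by (cases d) auto
    moreover have "h j \<in> forms d" using forms_power[OF forms_Var, of k d] by (auto simp: h_def)
    ultimately show ?thesis by blast
  qed
  then show ?case
    using e unfolding a_def by (intro exI[of _ "\<lambda>j. Var i * g j + h j"] exI[of _ "c * p $ i / p $ k"]) simp
qed

text \<open>Write \<open>f\<close> as a combination of the generators \<open>p\<^sub>k x\<^sub>j - p\<^sub>j x\<^sub>k\<close> with \<open>j \<noteq> k\<close>. The coefficient of such a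
  generator takes at \<open>p\<close> the value of the partial derivative in direction \<open>j\<close>, up to the factor \<open>p\<^sub>k\<close>;
  so the coefficients vanish at \<open>p\<close> too.\<close>

lemma singular_in_ideal_square:
  assumes f: "f \<in> forms d" and P: "P \<in> proj_plane"
    and s: "eval3 f (rep P) = 0" "\<And>v. eval3 (dir_deriv v f) (rep P) = 0"
  shows "f \<in> ideal_square (point_ideal P)"
proof -
  define p where "p = rep P"
  obtain k where k: "p $ k \<noteq> 0" using rep(1)[OF P] by (auto simp: p_def vec_eq_iff)
  define a :: "3 \<Rightarrow> 'a poly3" where "a j = Const (p $ k) * Var j - Const (p $ j) * Var k" for j
  have a1: "a j \<in> forms 1" for j unfolding a_def by (intro forms_diff forms_Const_mult forms_Var)
  have ap: "eval3 (a j) p = 0" for j by (simp add: a_def)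
  obtain g c where g: "\<forall>j. g j \<in> forms (d - 1) \<and> (d = 0 \<longrightarrow> g j = 0)"
      "f = (\<Sum>j\<in>UNIV. a j * g j) + Const c * Var k ^ d"
    using taylor_at_point[OF k f] unfolding a_def by blast
  have "eval3 (Var k ^ d) p = (p $ k) ^ d" by (induction d) simp_all
  then have "eval3 f p = c * (p $ k) ^ d" unfolding g(2) by (simp add: ap)
  then have "c = 0" using s(1) k by (simp add: p_def)
  then have f_eq: "f = (\<Sum>j\<in>UNIV. a j * g j)" using g(2) by simp
  have gp: "eval3 (g j) p = 0" if "j \<noteq> k" for j
  proof -
    have "eval3 (dir_deriv (axis j 1) f) p = (\<Sum>i\<in>UNIV. if i = j then p $ k * eval3 (g j) p else 0)"
      unfolding f_eq dir_deriv_simps(8) eval3_simps(9) dir_deriv_mult eval3_simps(3,6) ap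
      by (intro sum.cong) (use that in \<open>auto simp: a_def axis_def\<close>)
    then show ?thesis using s(2) k by (simp add: p_def)
  qed
  have "a j * g j \<in> ideal_square (point_ideal P)" for j
  proof (cases "j = k")
    case True
    then show ?thesis by (simp add: a_def ideal_square_def ideal.span_zero)
  next
    case False
    have "h \<in> point_ideal P" if "h \<in> forms e" "eval3 h p = 0" for h e
      unfolding point_ideal_def using that vanishes_at_rep[OF that(1) P] p_def
      by (intro ideal.span_base) auto
    then have "a j \<in> point_ideal P" "g j \<in> point_ideal P" using a1 ap g(1) gp[OF False] by blast+
    then show ?thesis unfolding ideal_square_def by (intro ideal.span_base) blast
  qed
  then show ?thesis unfolding f_eq ideal_square_def by (intro ideal.span_sum)
qed

lemma double_points_ideal_forms:
  assumes "X \<subseteq> proj_plane"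
  shows "double_points_ideal X \<inter> forms d = singular (rep ` X) d"
proof (intro equalityI subsetI)
  fix f assume "f \<in> double_points_ideal X \<inter> forms d"
  then show "f \<in> singular (rep ` X) d"
    using ideal_square_singular assms unfolding double_points_ideal_def singular_def by blast
next
  fix f assume "f \<in> singular (rep ` X) d"
  then show "f \<in> double_points_ideal X \<inter> forms d"
    using singular_in_ideal_square assms unfolding double_points_ideal_def singular_def by blast
qed

section \<open>Hilbert functions\<close>

lemma dim_singular_le: "poly3.dim (singular Y d) \<le> (d + 2) choose 2"
  for Y :: "('k::field_char_0 ^ 3) set"
  using dim_mono_fin[OF fin_dim_forms, of "singular Y d" d] by (auto simp: dim_forms singular_def)

lemma hilbert_function_double_points:
  fixes X :: "('k::field_char_0 ^ 3) set set"
  assumes "X \<subseteq> proj_plane"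
  shows "int (hilbert_function (double_points_ideal X) d) =
    int ((d + 2) choose 2) - int (poly3.dim (singular (rep ` X) d))"
proof -
  obtain W where "finite W" "forms d \<subseteq> poly3.span (W :: 'k poly3 set)"
    using fin_dim_forms unfolding fin_dim_def by blast
  then have "quotient_dim (forms d) (singular (rep ` X) d) = poly3.dim (forms d :: 'k poly3 set) - poly3.dim (singular (rep ` X) d)"
    by (intro quotient_dim_eq[OF forms_subspace fin_dim_subspace[OF fin_dim_singular]]) (auto simp: singular_def)
  then show ?thesis
    unfolding hilbert_function_def double_points_ideal_forms[OF assms]
    using dim_singular_le[of "rep ` X" d] by (simp add: dim_forms of_nat_diff)
qed

lemma star_sequence_nth:
  assumes "i < 2 * t"
  shows "([1..<t + 1] @ replicate t (t + 1)) ! i = (if i < t then i + 1 else t + 1)"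
  using assms by (auto simp: nth_append simp del: upt_Suc)

lemma choose_two_int: "int ((n + 1) choose 2) = int (n choose 2) + int n"
  using choose_two_Suc[of n] by simp

text \<open>Summing the sequence gives \<open>(i + 2) choose 2\<close> minus the stated dimension.\<close>

lemma star_sequence_imp_dimensions:
  fixes X :: "('k::field_char_0 ^ 3) set set"
  assumes X: "X \<subseteq> proj_plane"
    and h: "has_hilbert_diff (double_points_ideal X) ([1..<t + 1] @ replicate t (t + 1))"
    and i: "i < 2 * t"
  shows "poly3.dim (singular (rep ` X) i) = (i + 1 - t) choose 2"
proof -
  let ?H = "\<lambda>i. int (hilbert_function (double_points_ideal X) i)"
  have d: "hilbert_diff (double_points_ideal X) i = (if i < t then int i + 1 else int t + 1)" if "i < 2 * t" for i
    using h that star_sequence_nth[OF that] unfolding has_hilbert_diff_def by (simp del: upt_Suc)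
  have "?H i = int ((i + 2) choose 2) - int ((i + 1 - t) choose 2)"
    using i
  proof (induction i)
    case 0
    then show ?case using d[of 0] by (simp add: hilbert_diff_def numeral_2_eq_2)
  next
    case (Suc i)
    have "?H (Suc i) = ?H i + (if Suc i < t then int (Suc i) + 1 else int t + 1)"
      using d[OF Suc.prems] by (simp add: hilbert_diff_def)
    moreover have "?H i = int ((i + 2) choose 2) - int ((i + 1 - t) choose 2)" using Suc by simp
    moreover have "int ((Suc i + 2) choose 2) = int ((i + 2) choose 2) + int (i + 2)"
      using choose_two_int[of "i + 2"] by simp
    moreover have "int ((Suc i + 1 - t) choose 2) = int ((i + 1 - t) choose 2) + int (i + 1 - t)"
    proof (cases "Suc i < t")
      case True
      then show ?thesis by simp
    next
      case False
      then have "Suc i + 1 - t = (i + 1 - t) + 1" by simp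
      then show ?thesis using choose_two_int[of "i + 1 - t"] by simp
    qed
    ultimately show ?case by (auto simp: of_nat_diff)
  qed
  then show ?thesis using hilbert_function_double_points[OF X, of i] by simp
qed

lemma dimensions_imp_star_sequence:
  fixes X :: "('k::field_char_0 ^ 3) set set"
  assumes X: "X \<subseteq> proj_plane" and t: "t \<ge> 1"
    and low: "\<And>i. i < 2 * t \<Longrightarrow> poly3.dim (singular (rep ` X) i) = (i + 1 - t) choose 2"
    and high: "\<And>i. 2 * t - 1 \<le> i \<Longrightarrow> poly3.dim (singular (rep ` X) i) + N = (i + 2) choose 2"
  shows "has_hilbert_diff (double_points_ideal X) ([1..<t + 1] @ replicate t (t + 1))"
  unfolding has_hilbert_diff_def
proof
  fix i
  let ?H = "\<lambda>i. int (hilbert_function (double_points_ideal X) i)"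
  have Hlow: "?H i = int ((i + 2) choose 2) - int ((i + 1 - t) choose 2)" if "i < 2 * t" for i
    using hilbert_function_double_points[OF X, of i] low[OF that] by simp
  have Hhigh: "?H i = int N" if "2 * t - 1 \<le> i" for i
    using hilbert_function_double_points[OF X, of i] high[OF that] by simp
  have len: "length ([1..<t + 1] @ replicate t (t + 1)) = 2 * t" by simp
  show "hilbert_diff (double_points_ideal X) i = (if i < length ([1..<t + 1] @ replicate t (t + 1))
      then int (([1..<t + 1] @ replicate t (t + 1)) ! i) else 0)"
  proof (cases "i < 2 * t")
    case True
    have "hilbert_diff (double_points_ideal X) i = (if i < t then int i + 1 else int t + 1)"
    proof (cases i)
      case 0
      then show ?thesis using t Hlow[of 0] by (simp add: hilbert_diff_def numeral_2_eq_2)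
    next
      case (Suc j)
      have "int ((Suc j + 2) choose 2) = int ((j + 2) choose 2) + int (j + 2)"
        using choose_two_int[of "j + 2"] by simp
      moreover have "int ((Suc j + 1 - t) choose 2) = int ((j + 1 - t) choose 2) + int (j + 1 - t)"
      proof (cases "Suc j < t")
        case True
        then show ?thesis by simp
      next
        case False
        then have "Suc j + 1 - t = (j + 1 - t) + 1" by simp
        then show ?thesis using choose_two_int[of "j + 1 - t"] by simp
      qed
      moreover have "j < 2 * t" using True Suc by simp
      ultimately show ?thesis
        using Hlow[OF True] Hlow[of j] unfolding hilbert_diff_def Suc by (auto simp: of_nat_diff)
    qed
    then show ?thesis unfolding len using True star_sequence_nth[OF True] by (simp del: upt_Suc)
  next
    case False
    then have "?H i = ?H (i - 1)" using Hhigh[of i] Hhigh[of "i - 1"] by simp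
    then show ?thesis unfolding len using False t by (simp add: hilbert_diff_def)
  qed
qed

section \<open>Lines of the projective plane\<close>

definition line_of :: "'k::field poly3 \<Rightarrow> ('k ^ 3) set set" where
  "line_of l = {P \<in> proj_plane. vanishes_at l P}"

lemma line_of_iff: "l \<in> forms 1 \<Longrightarrow> P \<in> line_of l \<longleftrightarrow> P \<in> proj_plane \<and> eval3 l (rep P) = 0"
  using vanishes_at_rep by (auto simp: line_of_def)

lemma proj_lines_eq: "proj_lines = line_of ` {l. l \<in> forms 1 \<and> l \<noteq> 0}"
  by (auto simp: proj_lines_def line_of_def)

lemma point_on_line_of:
  assumes "l \<in> forms 1" "v \<noteq> 0" "eval3 l v = 0"
  shows "range (\<lambda>c. c *s v) \<in> line_of l"
proof -
  have "eval3 l (c *s v) = 0" for c using eval3_homogeneous[OF assms(1)] assms(3) by simp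
  then show ?thesis using range_scale_in_proj_plane[OF assms(2)] by (auto simp: line_of_def vanishes_at_def)
qed

text \<open>If \<open>P\<close> and \<open>Q\<close> are different, they span the line \<open>l\<close>, so that \<open>l'\<close> vanishes on all of it.\<close>

lemma common_point_unique:
  fixes l l' :: "'k::field_char_0 poly3"
  assumes l: "l \<in> forms 1" "l \<noteq> 0" "l' \<in> forms 1" and ne: "\<And>c. l' \<noteq> Const c * l"
    and P: "P \<in> line_of l" "P \<in> line_of l'" and Q: "Q \<in> line_of l" "Q \<in> line_of l'"
  shows "P = Q"
proof (rule ccontr)
  assume PQ: "P \<noteq> Q"
  define p q where "p = rep P" and "q = rep Q"
  have pr: "P \<in> proj_plane" "Q \<in> proj_plane" and ev: "eval3 l p = 0" "eval3 l' p = 0" "eval3 l q = 0" "eval3 l' q = 0"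
    using P Q l by (auto simp: line_of_iff p_def q_def)
  have "p \<noteq> 0" using rep(1)[OF pr(1)] by (simp add: p_def)
  then obtain u m A B where fr: "frame u p m A B l" by (rule frame_exists[OF l(1,2) ev(1)])
  have q: "q = eval3 A q *s u + eval3 B q *s p" by (rule frame_direction[OF fr ev(3)])
  have "eval3 A q \<noteq> 0"
  proof
    assume "eval3 A q = 0"
    then have "q = eval3 B q *s p" using q by simp
    then have "Q = P" using rep_proportional[OF pr(2,1)] by (simp add: p_def q_def)
    then show False using PQ by simp
  qed
  moreover have "eval3 l' q = eval3 A q * eval3 l' u + eval3 B q * eval3 l' p"
    using eval3_homogeneous[OF l(3), of "eval3 A q" u] by (subst q) (simp add: linear_form_add[OF l(3)])
  ultimately have "eval3 l' u = 0" using ev by simp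
  then have l0: "line_poly l' u p = 0" unfolding line_poly_linear_form[OF l(3)] using ev by simp
  obtain G where "G \<in> forms (1 - 1)" "l' = l * G" by (rule frame_factor[OF fr l(3) l0])
  then show False using ne forms_0E by (metis diff_self_eq_0 mult.commute)
qed

lemma lines_meet:
  fixes l l' :: "'k::field_char_0 poly3"
  assumes l: "l \<in> forms 1" "l \<noteq> 0" "l' \<in> forms 1"
  shows "line_of l \<inter> line_of l' \<noteq> {}"
proof -
  obtain w where w: "w \<noteq> 0" "eval3 l w = 0" by (rule line_has_point[OF l(1)])
  obtain u m A B where fr: "frame u w m A B l" by (rule frame_exists[OF l(1,2) w(2,1)])
  note f = fr[unfolded frame_def]
  have "\<exists>v. v \<noteq> 0 \<and> eval3 l v = 0 \<and> eval3 l' v = 0"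
  proof (cases "eval3 l' w = 0")
    case True
    then show ?thesis using w by blast
  next
    case False
    define v where "v = u + (- (eval3 l' u / eval3 l' w)) *s w"
    have "eval3 A v = 1" "eval3 l v = 0" "eval3 l' v = 0"
      unfolding v_def using f False l by (simp_all only: linear_form_add) simp_all
    moreover have "v \<noteq> 0"
    proof
      assume "v = 0"
      then show False using \<open>eval3 A v = 1\<close> f eval3_homogeneous[of A 1 0 v] by simp
    qed
    ultimately show ?thesis by blast
  qed
  then show ?thesis using point_on_line_of l by blast
qed

lemma line_of_eqD:
  fixes l l' :: "'k::field_char_0 poly3"
  assumes l: "l \<in> forms 1" "l \<noteq> 0" "l' \<in> forms 1" and e: "line_of l = line_of l'"
  shows "\<exists>c. l' = Const c * l"
proof -
  have "eval3 l' v = 0" if "eval3 l v = 0" for v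
  proof (cases "v = 0")
    case True
    then show ?thesis using eval3_homogeneous[OF l(3), of 0 v] by simp
  next
    case False
    then have "range (\<lambda>c. c *s v) \<in> line_of l'" using point_on_line_of[OF l(1) False that] e by simp
    then have "eval3 l' (1 *s v) = 0" unfolding line_of_def vanishes_at_def by blast
    then show ?thesis by simp
  qed
  from line_divides[OF l(1,2,3) this] obtain G where "G \<in> forms (1 - 1)" "l' = l * G" by metis
  then show ?thesis using forms_0E by (metis diff_self_eq_0 mult.commute)
qed

section \<open>The characterisation\<close>

text \<open>Each line carries \<open>t\<close> points: the intersections with the other lines are different because no three lines
  are concurrent.\<close>

lemma star_configuration_imp_hilbert_diff:
  fixes X :: "('k::field_char_0 ^ 3) set set"
  assumes t: "t \<ge> 1" and X: "X \<subseteq> proj_plane" "finite X" "card X = (t + 1) choose 2"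
    and star: "star_configuration t X"
  shows "has_hilbert_diff (double_points_ideal X) ([1..<t + 1] @ replicate t (t + 1))"
proof -
  obtain M where M: "M \<subseteq> proj_lines" "finite M" "card M = t + 1"
      "\<And>l m n. l \<in> M \<Longrightarrow> m \<in> M \<Longrightarrow> n \<in> M \<Longrightarrow> l \<noteq> m \<Longrightarrow> l \<noteq> n \<Longrightarrow> m \<noteq> n \<Longrightarrow> l \<inter> m \<inter> n = {}"
      "X = \<Union>{l \<inter> m | l m. l \<in> M \<and> m \<in> M \<and> l \<noteq> m}"
    using star unfolding star_configuration_def by blast
  have "\<exists>l. \<forall>m\<in>M. l m \<in> forms 1 \<and> l m \<noteq> 0 \<and> line_of (l m) = m"
    using M(1) unfolding proj_lines_eq by (intro bchoice) blast
  then obtain l where l: "\<And>m. m \<in> M \<Longrightarrow> l m \<in> forms 1 \<and> l m \<noteq> 0" "\<And>m. m \<in> M \<Longrightarrow> line_of (l m) = m" by blast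
  define Y where "Y = rep ` X"
  have inj: "inj_on rep X" by (rule inj_on_rep[OF X(1)])
  have ne: "l m \<noteq> Const c * l n" if mn: "m \<in> M" "n \<in> M" "m \<noteq> n" for m n c
  proof
    assume e: "l m = Const c * l n"
    then have "c \<noteq> 0" using l(1)[OF mn(1)] by auto
    then have "line_of (l m) = line_of (l n)" unfolding line_of_def vanishes_at_def e by simp
    then show False using l(2) mn by simp
  qed
  have "card {p \<in> Y. eval3 (l m) p = 0} \<ge> t" if m: "m \<in> M" for m
  proof -
    have "\<exists>P. \<forall>n\<in>M - {m}. P n \<in> m \<inter> n"
    proof (rule bchoice, rule ballI)
      fix n assume "n \<in> M - {m}"
      then show "\<exists>P. P \<in> m \<inter> n" using lines_meet[of "l m" "l n"] l m by blast
    qed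
    then obtain P where P: "\<And>n. n \<in> M - {m} \<Longrightarrow> P n \<in> m \<inter> n" by blast
    have "inj_on P (M - {m})"
    proof (rule inj_onI, rule ccontr)
      fix n n' assume n: "n \<in> M - {m}" "n' \<in> M - {m}" "P n = P n'" "n \<noteq> n'"
      then have "P n \<in> m \<inter> n \<inter> n'" using P by fastforce
      moreover have "m \<inter> n \<inter> n' = {}" using M(4)[of m n n'] n m by blast
      ultimately show False by blast
    qed
    then have c1: "card (P ` (M - {m})) = t" using M m by (simp add: card_image)
    have PX: "P ` (M - {m}) \<subseteq> X" unfolding M(5) using P m by blast
    then have c2: "card (rep ` P ` (M - {m})) = card (P ` (M - {m}))"
      by (intro card_image inj_on_subset[OF inj])
    have sub: "rep ` P ` (M - {m}) \<subseteq> {p \<in> Y. eval3 (l m) p = 0}"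
    proof
      fix x assume "x \<in> rep ` P ` (M - {m})"
      then obtain n where n: "n \<in> M - {m}" "x = rep (P n)" by blast
      then have "P n \<in> line_of (l m)" using P[of n] l(2)[OF m] by simp
      then have "eval3 (l m) x = 0" using line_of_iff[of "l m"] l(1)[OF m] n(2) by simp
      moreover have "x \<in> Y" using PX n unfolding Y_def by blast
      ultimately show "x \<in> {p \<in> Y. eval3 (l m) p = 0}" by simp
    qed
    have "finite Y" using X by (simp add: Y_def)
    then have "card (rep ` P ` (M - {m})) \<le> card {p \<in> Y. eval3 (l m) p = 0}"
      by (intro card_mono[OF _ sub]) simp
    then show ?thesis using c1 c2 by simp
  qed
  note many = this
  have two: "\<exists>m\<in>M. \<exists>n\<in>M. m \<noteq> n \<and> eval3 (l m) p = 0 \<and> eval3 (l n) p = 0" if pY: "p \<in> Y" for p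
  proof -
    obtain P m n where P: "p = rep P" "P \<in> m \<inter> n" "m \<in> M" "n \<in> M" "m \<noteq> n"
      using pY unfolding Y_def M(5) by blast
    then have "eval3 (l m) p = 0" "eval3 (l n) p = 0" using l line_of_iff by blast+
    then show ?thesis using P by blast
  qed
  have "0 \<notin> Y" unfolding Y_def by (rule zero_notin_rep[OF X(1)])
  then have Y: "finite Y" "card Y = (t + 1) choose 2" "0 \<notin> Y"
    using X inj by (simp_all add: Y_def card_image)
  have Yp: "\<forall>p\<in>Y. \<forall>q\<in>Y. \<forall>c. p = c *s q \<longrightarrow> p = q"
  proof (intro ballI allI impI)
    fix p q c assume pq: "p \<in> Y" "q \<in> Y" "p = c *s q"
    obtain P where P: "P \<in> X" "p = rep P" using pq(1) unfolding Y_def by blast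
    obtain Q where Q: "Q \<in> X" "q = rep Q" using pq(2) unfolding Y_def by blast
    have "P = Q" using rep_proportional[of P Q c] X(1) P Q pq(3) by blast
    then show "p = q" using P Q by simp
  qed
  note dims = star_dimensions[OF t M(2,3) l(1) ne Y Yp two many]
  show ?thesis
    using dims by (intro dimensions_imp_star_sequence[OF X(1) t, where N = "3 * card Y"]) (auto simp: Y_def)
qed

text \<open>Assign to each point two of the lines through it. The assignment is injective, since two lines have only
  one common point, and there are as many points as pairs of lines. So every intersection of two lines is one of
  the points, and it determines the pair, which excludes a third line through it.\<close>

lemma hilbert_diff_imp_star_configuration:
  fixes X :: "('k::{alg_closed_field, field_char_0} ^ 3) set set"
  assumes t: "t \<ge> 3" and X: "X \<subseteq> proj_plane" "finite X" "card X = (t + 1) choose 2"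
    and h: "has_hilbert_diff (double_points_ideal X) ([1..<t + 1] @ replicate t (t + 1))"
  shows "star_configuration t X"
proof -
  define Y where "Y = rep ` X"
  have inj: "inj_on rep X" by (rule inj_on_rep[OF X(1)])
  interpret extremal_points t Y
  proof
    show "card Y = (t + 1) choose 2" using X inj by (simp add: Y_def card_image)
  qed (use t X star_sequence_imp_dimensions[OF X(1) h] in \<open>auto simp: Y_def\<close>)
  have "0 \<notin> Y" unfolding Y_def by (rule zero_notin_rep[OF X(1)])
  from star_lines[OF this] obtain I :: "'k set" and l where Il: "finite I \<and> card I = t + 1 \<and>
     (\<forall>i\<in>I. l i \<in> forms 1 \<and> l i \<noteq> 0) \<and>
     (\<forall>i\<in>I. \<forall>j\<in>I. \<forall>c. i \<noteq> j \<longrightarrow> l i \<noteq> Const c * l j) \<and>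
     (\<forall>p\<in>Y. \<exists>i\<in>I. \<exists>j\<in>I. i \<noteq> j \<and> eval3 (l i) p = 0 \<and> eval3 (l j) p = 0)"
    by (elim exE) (rule that)
  then have I: "finite I" "card I = t + 1"
    and l: "\<And>i. i \<in> I \<Longrightarrow> l i \<in> forms 1 \<and> l i \<noteq> 0"
    and ne: "\<And>i j c. i \<in> I \<Longrightarrow> j \<in> I \<Longrightarrow> i \<noteq> j \<Longrightarrow> l i \<noteq> Const c * l j"
    and two: "\<And>p. p \<in> Y \<Longrightarrow> \<exists>i\<in>I. \<exists>j\<in>I. i \<noteq> j \<and> eval3 (l i) p = 0 \<and> eval3 (l j) p = 0"
    by blast+
  define line where "line i = line_of (l i)" for i
  have lninj: "inj_on line I"
  proof (rule inj_onI, rule ccontr)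
    fix i j assume ij: "i \<in> I" "j \<in> I" "line i = line j" "i \<noteq> j"
    then obtain c where "l j = Const c * l i" using line_of_eqD[of "l i" "l j"] l unfolding line_def by blast
    then show False using ne[of j i c] ij by auto
  qed
  have uniq: "P = Q" if "i \<in> I" "j \<in> I" "i \<noteq> j" "P \<in> line i \<inter> line j" "Q \<in> line i \<inter> line j" for i j P Q
    using common_point_unique[of "l i" "l j" P Q] l ne that unfolding line_def by blast
  have "\<exists>S. S \<subseteq> I \<and> card S = 2 \<and> (\<forall>i\<in>S. P \<in> line i)" if P: "P \<in> X" for P
  proof -
    obtain i j where ij: "i \<in> I" "j \<in> I" "i \<noteq> j" "eval3 (l i) (rep P) = 0" "eval3 (l j) (rep P) = 0"
      using two P unfolding Y_def by blast
    have "P \<in> line i" "P \<in> line j" using ij l P X(1) unfolding line_def by (auto simp: line_of_iff)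
    then show ?thesis using ij by (intro exI[of _ "{i, j}"]) auto
  qed
  then have "\<exists>S. \<forall>P\<in>X. S P \<subseteq> I \<and> card (S P) = 2 \<and> (\<forall>i\<in>S P. P \<in> line i)" by (intro bchoice) blast
  then obtain S where S: "\<And>P. P \<in> X \<Longrightarrow> S P \<subseteq> I" "\<And>P. P \<in> X \<Longrightarrow> card (S P) = 2"
    "\<And>P i. P \<in> X \<Longrightarrow> i \<in> S P \<Longrightarrow> P \<in> line i" by blast
  have Sinj: "inj_on S X"
  proof (rule inj_onI)
    fix P Q assume PQ: "P \<in> X" "Q \<in> X" "S P = S Q"
    then obtain i j where "S P = {i, j}" "i \<noteq> j" using S(2) by (meson card_2_iff)
    then show "P = Q" using S PQ by (intro uniq[of i j]) auto
  qed
  have "S ` X = {T. T \<subseteq> I \<and> card T = 2}"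
  proof (rule card_subset_eq)
    show "finite {T. T \<subseteq> I \<and> card T = 2}" using I by simp
    show "S ` X \<subseteq> {T. T \<subseteq> I \<and> card T = 2}" using S by blast
    show "card (S ` X) = card {T. T \<subseteq> I \<and> card T = 2}"
      using Sinj X(3) I n_subsets[of I 2] by (simp add: card_image)
  qed
  then have Ssurj: "\<exists>P\<in>X. S P = {i, j}" if "i \<in> I" "j \<in> I" "i \<noteq> j" for i j
  proof -
    have "{i, j} \<in> {T. T \<subseteq> I \<and> card T = 2}" using that by simp
    then show ?thesis using \<open>S ` X = _\<close> by (metis (no_types, lifting) imageE)
  qed
  have on: "P \<in> X \<and> S P = {i, j}" if ij: "i \<in> I" "j \<in> I" "i \<noteq> j" "P \<in> line i" "P \<in> line j" for i j P
  proof -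
    obtain Q where Q: "Q \<in> X" "S Q = {i, j}" using Ssurj[OF ij(1-3)] by blast
    then have "Q \<in> line i \<inter> line j" using S(3)[OF Q(1)] by simp
    then have "P = Q" using uniq[OF ij(1-3)] ij by blast
    then show ?thesis using Q by simp
  qed
  show ?thesis
    unfolding star_configuration_def
  proof (intro exI[of _ "line ` I"] conjI ballI impI)
    show "line ` I \<subseteq> proj_lines" unfolding proj_lines_eq line_def using l by blast
    show "finite (line ` I)" using I by simp
    show "card (line ` I) = t + 1" using I lninj by (simp add: card_image)
  next
    fix a b c assume "a \<in> line ` I" "b \<in> line ` I" "c \<in> line ` I" and d: "a \<noteq> b" "a \<noteq> c" "b \<noteq> c"
    then obtain i j k where ijk: "a = line i" "b = line j" "c = line k" "i \<in> I" "j \<in> I" "k \<in> I" by blast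
    show "a \<inter> b \<inter> c = {}"
    proof (rule equals0I)
      fix P assume "P \<in> a \<inter> b \<inter> c"
      then have "S P = {i, j}" "S P = {i, k}" using on ijk d by auto
      then show False using d ijk by (metis doubleton_eq_iff)
    qed
  next
    show "X = \<Union>{a \<inter> b | a b. a \<in> line ` I \<and> b \<in> line ` I \<and> a \<noteq> b}"
    proof (intro equalityI subsetI)
      fix P assume P: "P \<in> X"
      then obtain i j where ij: "S P = {i, j}" "i \<noteq> j" using S(2) by (meson card_2_iff)
      then have "P \<in> line i \<inter> line j" "i \<in> I" "j \<in> I" using S P by auto
      moreover have "line i \<noteq> line j" using lninj ij(2) calculation(2,3) by (meson inj_onD)
      ultimately show "P \<in> \<Union>{a \<inter> b | a b. a \<in> line ` I \<and> b \<in> line ` I \<and> a \<noteq> b}" by blast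
    next
      fix P assume "P \<in> \<Union>{a \<inter> b | a b. a \<in> line ` I \<and> b \<in> line ` I \<and> a \<noteq> b}"
      then obtain i j where "i \<in> I" "j \<in> I" "P \<in> line i" "P \<in> line j" "line i \<noteq> line j" by blast
      then show "P \<in> X" using on by blast
    qed
  qed
qed

theorem theorem4p4:
  fixes t :: nat
    and X :: "('k::{alg_closed_field, field_char_0} ^ 3) set set"
  assumes "t \<ge> 3"
    and "X \<subseteq> proj_plane" and "finite X" and "card X = (t + 1) choose 2"
  shows "has_hilbert_diff (double_points_ideal X) ([1..<t + 1] @ replicate t (t + 1))
    \<longleftrightarrow> star_configuration t X"
  using hilbert_diff_imp_star_configuration[OF assms] star_configuration_imp_hilbert_diff[OF _ assms(2-4)] assms(1)
  by fastforce

end
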